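(* Let $X,Y$ be complex Banach spaces and $f\in\mathcal{H}L_0(B_X,Y)$. The following are equivalent: (i) $f:B_X\to Y$ is weakly compact holomorphic Lipschitz. (ii) $T_f:\mathcal{G}_0(B_X)\to Y$ is weakly compact. (iii) $f^t:Y^*\to\mathcal{H}L_0(B_X)$ is weakly compact. (iv) $f^t:Y^*\to\mathcal{H}L_0(B_X)$ is weak*-to-weak continuous. (v) There exist a reflexive Banach space $Z$, an operator $T\in\mathcal{L}(Z,Y)$ and a mapping $g\in\mathcal{H}L_0(B_X,Z)$ such that $f=T\circ g$.
   Context: All Banach spaces are complex. $B_X$ is the open unit ball of $X$. $\mathcal{H}L_0(B_X,Y)$ is the Banach space of all holomorphic Lipschitz maps $f:B_X\to Y$ with $f(0)=0$, with norm $L(f)=\sup\{\|f(x)-f(y)\|/\|x-y\|: x\ne y\}$; $\mathcal{H}L_0(B_X)=\mathcal{H}L_0(B_X,\mathbb{C})$. A map $f\in\mathcal{H}L_0(B_X,Y)$ is weakly compact holomorphic Lipschitz if $\mathrm{Im}_L(f)=\{(f(x)-f(y))/\|x-y\|:x,y\in B_X,\ x\neq y\}$ is contained in the image of the closed unit ball under some weakly compact operator from a Banach space into $Y$ (equivalently, $\mathrm{Im}_L(f)$ is relatively weakly compact in $Y$). The transpose $f^t\in\mathcal{L}(Y^*,\mathcal{H}L_0(B_X))$ is $f^t(y^* )=y^*\circ f$. $\delta_X(x)(g)=g(x)$ for $x\in B_X$, $g\in\mathcal{H}L_0(B_X)$, and $\mathcal{G}_0(B_X)=\overline{\mathrm{lin}}(\delta_X(B_X))\subseteq\mathcal{H}L_0(B_X)^*$.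 $T_f\in\mathcal{L}(\mathcal{G}_0(B_X),Y)$ is the unique bounded operator with $T_f\circ\delta_X=f$; it is known that $f\mapsto T_f$ is an isometric isomorphism from $\mathcal{H}L_0(B_X,Y)$ onto $\mathcal{L}(\mathcal{G}_0(B_X),Y)$. *)

theory Defs
  imports "HOL-Analysis.Analysis" "HOL-Library.Function_Algebras"
begin

text \<open>
  Spaces such as \<open>\<G>\<^sub>0(B\<^sub>X)\<close> or an existentially quantified Banach space cannot be types.
  A complex normed space is therefore a linear subspace of an ambient complex vector space
  (a type of class \<open>complex_vector\<close>, without any topology) together with its own norm.
\<close>

class complex_vector = ab_group_add +
  fixes scaleC :: "complex \<Rightarrow> 'a \<Rightarrow> 'a"  (infixr "*\<^sub>C" 75)
  assumes scaleC_add_right: "a *\<^sub>C (x + y) = a *\<^sub>C x + a *\<^sub>C y"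
    and scaleC_add_left: "(a + b) *\<^sub>C x = a *\<^sub>C x + b *\<^sub>C x"
    and scaleC_scaleC: "a *\<^sub>C (b *\<^sub>C x) = (a * b) *\<^sub>C x"
    and scaleC_one: "1 *\<^sub>C x = x"

global_interpretation complex_vector: vector_space "scaleC :: complex \<Rightarrow> 'a \<Rightarrow> 'a::complex_vector"
  by unfold_locales (simp_all add: scaleC_add_right scaleC_add_left scaleC_scaleC scaleC_one)

instantiation complex :: complex_vector
begin

definition scaleC_complex :: "complex \<Rightarrow> complex \<Rightarrow> complex" where
  "scaleC_complex a x = a * x"

instance
  by intro_classes (simp_all add: scaleC_complex_def algebra_simps)

end

instantiation "fun" :: (type, complex_vector) complex_vector
begin

definition scaleC_fun :: "complex \<Rightarrow> ('a \<Rightarrow> 'b) \<Rightarrow> 'a \<Rightarrow> 'b" where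
  "scaleC_fun a f = (\<lambda>x. a *\<^sub>C f x)"

instance
  by intro_classes
    (simp_all add: scaleC_fun_def fun_eq_iff scaleC_add_right scaleC_add_left scaleC_scaleC scaleC_one)

end

record 'a cspace =
  vecs :: "'a set"
  vnorm :: "'a \<Rightarrow> real"

definition cnormed :: "'a::complex_vector cspace \<Rightarrow> bool" where
  "cnormed V \<longleftrightarrow>
     complex_vector.subspace (vecs V) \<and>
     (\<forall>x\<in>vecs V. 0 \<le> vnorm V x) \<and>
     (\<forall>x\<in>vecs V. vnorm V x = 0 \<longleftrightarrow> x = 0) \<and>
     (\<forall>x\<in>vecs V. \<forall>y\<in>vecs V. vnorm V (x + y) \<le> vnorm V x + vnorm V y) \<and>
     (\<forall>a. \<forall>x\<in>vecs V. vnorm V (a *\<^sub>C x) = cmod a * vnorm V x)"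

text \<open>
  The value 0 off the carrier is irrelevant; it is there because \<^locale>\<open>Metric_space\<close>
  requires nonnegativity and symmetry of the distance on the whole type.
\<close>
definition ndist :: "'a::complex_vector cspace \<Rightarrow> 'a \<Rightarrow> 'a \<Rightarrow> real" where
  "ndist V x y = (if x \<in> vecs V \<and> y \<in> vecs V then vnorm V (x - y) else 0)"

definition norm_topology :: "'a::complex_vector cspace \<Rightarrow> 'a topology" where
  "norm_topology V = Metric_space.mtopology (vecs V) (ndist V)"

definition cbanach :: "'a::complex_vector cspace \<Rightarrow> bool" where
  "cbanach V \<longleftrightarrow> cnormed V \<and> Metric_space.mcomplete (vecs V) (ndist V)"

definition open_unit_ball :: "'a cspace \<Rightarrow> 'a set" where
  "open_unit_ball V = {x \<in> vecs V. vnorm V x < 1}"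

definition closed_unit_ball :: "'a cspace \<Rightarrow> 'a set" where
  "closed_unit_ball V = {x \<in> vecs V. vnorm V x \<le> 1}"

definition scalars :: "complex cspace" where
  "scalars = \<lparr>vecs = UNIV, vnorm = cmod\<rparr>"

text \<open>
  Maps defined on a subset of a type (bounded operators here, maps on \<open>B\<^sub>X\<close> below) are
  represented by the total function extending them by 0.  This makes the representation
  unique and is compatible with the pointwise vector space operations.
\<close>
definition bounded_ops ::
    "'a::complex_vector cspace \<Rightarrow> 'b::complex_vector cspace \<Rightarrow> ('a \<Rightarrow> 'b) set" where
  "bounded_ops V W =
     {T. (\<forall>x\<in>vecs V. T x \<in> vecs W) \<and> (\<forall>x. x \<notin> vecs V \<longrightarrow> T x = 0) \<and>
         (\<forall>x\<in>vecs V. \<forall>y\<in>vecs V. T (x + y) = T x + T y) \<and>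
         (\<forall>a. \<forall>x\<in>vecs V. T (a *\<^sub>C x) = a *\<^sub>C T x) \<and>
         (\<exists>K. \<forall>x\<in>vecs V. vnorm W (T x) \<le> K * vnorm V x)}"

definition op_norm ::
    "'a::complex_vector cspace \<Rightarrow> 'b::complex_vector cspace \<Rightarrow> ('a \<Rightarrow> 'b) \<Rightarrow> real" where
  "op_norm V W T = Sup ((\<lambda>x. vnorm W (T x)) ` closed_unit_ball V)"

definition dual :: "'a::complex_vector cspace \<Rightarrow> ('a \<Rightarrow> complex) cspace" where
  "dual V = \<lparr>vecs = bounded_ops V scalars, vnorm = op_norm V scalars\<rparr>"

definition weak_topology :: "'a::complex_vector cspace \<Rightarrow> 'a topology" where
  "weak_topology V =
     topology_generated_by {{x \<in> vecs V. \<phi> x \<in> U} | \<phi> U. \<phi> \<in> vecs (dual V) \<and> open U}"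

definition weak_star_topology :: "'a::complex_vector cspace \<Rightarrow> ('a \<Rightarrow> complex) topology" where
  "weak_star_topology V =
     topology_generated_by {{\<phi> \<in> vecs (dual V). \<phi> x \<in> U} | x U. x \<in> vecs V \<and> open U}"

definition weakly_compact_op ::
    "'a::complex_vector cspace \<Rightarrow> 'b::complex_vector cspace \<Rightarrow> ('a \<Rightarrow> 'b) \<Rightarrow> bool" where
  "weakly_compact_op V W T \<longleftrightarrow>
     T \<in> bounded_ops V W \<and>
     compactin (weak_topology W) (weak_topology W closure_of (T ` closed_unit_ball V))"

definition bidual_embedding :: "'a::complex_vector cspace \<Rightarrow> 'a \<Rightarrow> ('a \<Rightarrow> complex) \<Rightarrow> complex" where
  "bidual_embedding V x = (\<lambda>\<phi>. if \<phi> \<in> vecs (dual V) then \<phi> x else 0)"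

definition reflexive :: "'a::complex_vector cspace \<Rightarrow> bool" where
  "reflexive V \<longleftrightarrow> bidual_embedding V ` vecs V = vecs (dual (dual V))"

text \<open>
  Holomorphic on \<open>B\<^sub>X\<close>: complex Frechet differentiable at every point. The values of \<open>f\<close> off
  the open set \<open>B\<^sub>X\<close> do not matter for the limit.
\<close>
definition holomorphic_on_ball ::
    "'a::complex_vector cspace \<Rightarrow> 'b::complex_vector cspace \<Rightarrow> ('a \<Rightarrow> 'b) \<Rightarrow> bool" where
  "holomorphic_on_ball X Y f \<longleftrightarrow>
     (\<forall>a\<in>open_unit_ball X. \<exists>D\<in>bounded_ops X Y.
        ((\<lambda>x. vnorm Y (f x - f a - D (x - a)) / vnorm X (x - a)) \<longlongrightarrow> 0) (atin (norm_topology X) a))"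

definition lipschitz_on_ball ::
    "'a::complex_vector cspace \<Rightarrow> 'b::complex_vector cspace \<Rightarrow> ('a \<Rightarrow> 'b) \<Rightarrow> bool" where
  "lipschitz_on_ball X Y f \<longleftrightarrow>
     (\<exists>K. \<forall>x\<in>open_unit_ball X. \<forall>y\<in>open_unit_ball X. vnorm Y (f x - f y) \<le> K * vnorm X (x - y))"

text \<open>The inserted 0 only matters for \<open>X = {0}\<close>, where there are no two distinct points.\<close>
definition lipschitz_norm ::
    "'a::complex_vector cspace \<Rightarrow> 'b::complex_vector cspace \<Rightarrow> ('a \<Rightarrow> 'b) \<Rightarrow> real" where
  "lipschitz_norm X Y f =
     Sup (insert 0 {vnorm Y (f x - f y) / vnorm X (x - y) | x y.
       x \<in> open_unit_ball X \<and> y \<in> open_unit_ball X \<and> x \<noteq> y})"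

definition HL0 ::
    "'a::complex_vector cspace \<Rightarrow> 'b::complex_vector cspace \<Rightarrow> ('a \<Rightarrow> 'b) cspace" where
  "HL0 X Y =
     \<lparr>vecs = {f. (\<forall>x\<in>open_unit_ball X. f x \<in> vecs Y) \<and> (\<forall>x. x \<notin> open_unit_ball X \<longrightarrow> f x = 0) \<and>
                f 0 = 0 \<and> holomorphic_on_ball X Y f \<and> lipschitz_on_ball X Y f},
      vnorm = lipschitz_norm X Y\<rparr>"

definition Im_L ::
    "'a::complex_vector cspace \<Rightarrow> 'b::complex_vector cspace \<Rightarrow> ('a \<Rightarrow> 'b) \<Rightarrow> 'b set" where
  "Im_L X Y f =
     {complex_of_real (1 / vnorm X (x - y)) *\<^sub>C (f x - f y) | x y.
       x \<in> open_unit_ball X \<and> y \<in> open_unit_ball X \<and> x \<noteq> y}"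

text \<open>
  HOL cannot quantify over types inside a formula, so the following two notions, which assert the
  existence of some Banach space, take the ambient type of that space as a parameter.  Every ambient
  space large enough yields the same notion.  In particular the ambient type of \<open>Y\<close> suffices: if \<open>S\<close> is a
  bounded operator from a Banach space \<open>E\<close> into \<open>Y\<close>, then \<open>E\<close> can be replaced by the range of \<open>S\<close>
  with the quotient norm of \<open>E/ker S\<close>.
\<close>
definition weakly_compact_hol_lip ::
    "'c::complex_vector itself \<Rightarrow> 'a::complex_vector cspace \<Rightarrow> 'b::complex_vector cspace \<Rightarrow>
     ('a \<Rightarrow> 'b) \<Rightarrow> bool" where
  "weakly_compact_hol_lip _ X Y f \<longleftrightarrow>
     f \<in> vecs (HL0 X Y) \<and>
     (\<exists>(E::'c cspace) S. cbanach E \<and> weakly_compact_op E Y S \<and> Im_L X Y f \<subseteq> S ` closed_unit_ball E)"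

definition factors_through_reflexive ::
    "'c::complex_vector itself \<Rightarrow> 'a::complex_vector cspace \<Rightarrow> 'b::complex_vector cspace \<Rightarrow>
     ('a \<Rightarrow> 'b) \<Rightarrow> bool" where
  "factors_through_reflexive _ X Y f \<longleftrightarrow>
     (\<exists>(Z::'c cspace) T g. cbanach Z \<and> reflexive Z \<and> T \<in> bounded_ops Z Y \<and> g \<in> vecs (HL0 X Z) \<and>
        f = T \<circ> g)"

definition eval_at ::
    "'a::complex_vector cspace \<Rightarrow> 'a \<Rightarrow> ('a \<Rightarrow> complex) \<Rightarrow> complex" where
  "eval_at X x = (\<lambda>g. if g \<in> vecs (HL0 X scalars) then g x else 0)"

definition G0 :: "'a::complex_vector cspace \<Rightarrow> (('a \<Rightarrow> complex) \<Rightarrow> complex) cspace" where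
  "G0 X =
     \<lparr>vecs = norm_topology (dual (HL0 X scalars)) closure_of
               complex_vector.span (eval_at X ` open_unit_ball X),
      vnorm = vnorm (dual (HL0 X scalars))\<rparr>"

definition linearization ::
    "'a::complex_vector cspace \<Rightarrow> 'b::complex_vector cspace \<Rightarrow> ('a \<Rightarrow> 'b) \<Rightarrow>
     (('a \<Rightarrow> complex) \<Rightarrow> complex) \<Rightarrow> 'b" where
  "linearization X Y f =
     (THE T. T \<in> bounded_ops (G0 X) Y \<and> (\<forall>x\<in>open_unit_ball X. T (eval_at X x) = f x))"

definition transpose_map ::
    "'b::complex_vector cspace \<Rightarrow> ('a \<Rightarrow> 'b) \<Rightarrow> ('b \<Rightarrow> complex) \<Rightarrow> 'a \<Rightarrow> complex" where
  "transpose_map Y f = (\<lambda>\<phi>. if \<phi> \<in> vecs (dual Y) then \<phi> \<circ> f else 0)"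

end

theory Submission
  imports Defs "HOL-Complex_Analysis.Conformal_Mappings"
begin

text \<open>
  Write \<open>H\<close> for the space of scalar holomorphic Lipschitz maps and let \<open>Im\<close> be the set of difference quotients of
  \<open>f\<close>. All five conditions are equivalent to one condition on \<open>Y\<close> alone: \<open>Im\<close> lies in a bounded absolutely
  convex set \<open>C\<close> that is relatively weakly compact (\<open>relatively_weakly_compact_image\<close>). What links the
  conditions is the observation that a functional \<open>\<phi>\<close> on \<open>Y\<close> that is bounded by \<open>1\<close> on \<open>C\<close> makes \<open>\<phi> \<circ> f\<close> an
  element of the unit ball of \<open>H\<close>. So every functional \<open>\<Phi>\<close> on \<open>H\<close> of norm at most \<open>1\<close> induces a functional
  \<open>\<phi> \<mapsto> \<Phi> (\<phi> \<circ> f)\<close> on the dual of \<open>Y\<close> that is dominated by the supremum over \<open>C\<close>.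

  Helly's theorem and weak compactness (\<open>dominated_imp_evaluation\<close>) then show that this induced functional is the
  evaluation at a point of \<open>Y\<close>. Conversely, if every \<open>\<Phi>\<close> is represented by a point of \<open>Y\<close> in this way, then
  the points that represent the dual unit ball form a weakly compact set containing \<open>Im\<close>, by the Banach-Alaoglu theorem.
  If every \<open>\<Phi>\<close> is represented, its composition with the transpose is an evaluation, so the transpose is weak-star-to-weak
  continuous, and then it is weakly compact, again by Banach-Alaoglu. To return from weak compactness of the transpose to
  representability one needs that a functional on the dual of a Banach space that is weak-star continuous on the unit
  ball is an evaluation (\<open>weak_star_continuous_on_ball_imp_evaluation\<close>).

  The linearization is the restriction of the same representation to the predual: for \<open>u\<close> in the predual, its value at
  \<open>u\<close> is the point representing \<open>u\<close>. Such a point exists because it does for evaluations at points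
  of the ball, and the set of represented functionals is a closed subspace (\<open>represents_approx\<close>). Its weak
  compactness is that of \<open>C\<close>, because the values on the unit ball lie in the bipolar of \<open>C\<close>.

  The factorization uses the interpolation space \<open>Z\<close> of Davis, Figiel, Johnson and Pelczynski between the bipolar \<open>K\<close> of
  \<open>C\<close> and \<open>Y\<close>. It is a subset of \<open>Y\<close> whose unit ball contains a multiple of \<open>K\<close>, and it is reflexive
  (\<open>reflexive_interp_space\<close>). That \<open>f\<close> is Lipschitz into \<open>Z\<close> is immediate. That it is holomorphic into \<open>Z\<close>
  follows from a second-order Taylor estimate with a constant common to all \<open>\<phi> \<circ> f\<close> (\<open>contraction_taylor\<close>),
  which places the Taylor remainder of \<open>f\<close> in a multiple of \<open>K\<close> of quadratic size. In the other direction, an operator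
  on a reflexive space is weakly compact, so a factorization exhibits \<open>f\<close> as a weakly compact map. Since \<open>Z\<close> consists of
  elements of \<open>Y\<close>, the ambient type of \<open>Y\<close> suffices for all auxiliary Banach spaces.
\<close>

section \<open>Seminorms, linear functionals and infimal convolution\<close>

abbreviation csubspace :: "'a::complex_vector set \<Rightarrow> bool" where
  "csubspace \<equiv> complex_vector.subspace"

abbreviation scaleRC :: "real \<Rightarrow> 'a \<Rightarrow> 'a::complex_vector"  (infixr "*\<^sub>r" 75) where
  "t *\<^sub>r x \<equiv> complex_of_real t *\<^sub>C x"

lemmas csub_0 [simp] = complex_vector.subspace_0
  and csub_add [simp] = complex_vector.subspace_add
  and csub_diff [simp] = complex_vector.subspace_diff
  and csub_neg [simp] = complex_vector.subspace_neg
  and csub_scale [simp] = complex_vector.subspace_scale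

declare scaleC_one [simp] scaleC_scaleC [simp]

definition clin :: "'a::complex_vector set \<Rightarrow> ('a \<Rightarrow> complex) \<Rightarrow> bool" where
  "clin V \<phi> \<longleftrightarrow> (\<forall>x\<in>V. \<forall>y\<in>V. \<phi> (x + y) = \<phi> x + \<phi> y) \<and> (\<forall>a. \<forall>x\<in>V. \<phi> (a *\<^sub>C x) = a * \<phi> x)"

definition seminorm_on :: "'a::complex_vector set \<Rightarrow> ('a \<Rightarrow> real) \<Rightarrow> bool" where
  "seminorm_on V p \<longleftrightarrow> (\<forall>x\<in>V. 0 \<le> p x) \<and> (\<forall>x\<in>V. \<forall>y\<in>V. p (x + y) \<le> p x + p y) \<and>
     (\<forall>a. \<forall>x\<in>V. p (a *\<^sub>C x) = cmod a * p x)"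

text \<open>
  Homogeneity is only asked as an inequality, which is what infima of sublinear functionals inherit
  directly; applying it to \<^term>\<open>t\<close> and \<^term>\<open>1 / t\<close> gives equality.
\<close>
definition sublinear_on :: "'a::complex_vector set \<Rightarrow> ('a \<Rightarrow> real) \<Rightarrow> bool" where
  "sublinear_on V p \<longleftrightarrow> (\<forall>x\<in>V. \<forall>y\<in>V. p (x + y) \<le> p x + p y) \<and>
     (\<forall>t>0. \<forall>x\<in>V. p (t *\<^sub>r x) \<le> t * p x)"

lemma clinD:
  assumes "clin V \<phi>"
  shows "x \<in> V \<Longrightarrow> y \<in> V \<Longrightarrow> \<phi> (x + y) = \<phi> x + \<phi> y" "x \<in> V \<Longrightarrow> \<phi> (a *\<^sub>C x) = a * \<phi> x"
  using assms by (auto simp: clin_def)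

lemma clin_diff_zero:
  assumes "clin V \<phi>" "csubspace V"
  shows "x \<in> V \<Longrightarrow> y \<in> V \<Longrightarrow> \<phi> (x - y) = \<phi> x - \<phi> y" "\<phi> 0 = 0" "x \<in> V \<Longrightarrow> \<phi> (- x) = - \<phi> x"
proof -
  have neg: "\<phi> (- x) = - \<phi> x" if "x \<in> V" for x
    using clinD(2)[OF assms(1) that, of "-1"] by simp
  show "\<phi> 0 = 0"
    using clinD(2)[OF assms(1), of 0 0] assms(2) by simp
  show "x \<in> V \<Longrightarrow> \<phi> (- x) = - \<phi> x" by (rule neg)
  show "x \<in> V \<Longrightarrow> y \<in> V \<Longrightarrow> \<phi> (x - y) = \<phi> x - \<phi> y"
    using clinD(1)[OF assms(1), of x "- y"] neg[of y] assms(2) by simp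
qed

lemma clin_subset: "clin V \<phi> \<Longrightarrow> W \<subseteq> V \<Longrightarrow> clin W \<phi>"
  unfolding clin_def by blast

lemma clin_sum:
  assumes "clin V \<phi>" "csubspace V" "\<And>i. i \<in> I \<Longrightarrow> v i \<in> V"
  shows "\<phi> (\<Sum>i\<in>I. v i) = (\<Sum>i\<in>I. \<phi> (v i))"
  using assms(3)
  by (induction I rule: infinite_finite_induct)
     (auto simp: clin_diff_zero[OF assms(1,2)] clinD[OF assms(1)] complex_vector.subspace_sum[OF assms(2)])

lemma seminormD:
  assumes "seminorm_on V p"
  shows "x \<in> V \<Longrightarrow> 0 \<le> p x" "x \<in> V \<Longrightarrow> y \<in> V \<Longrightarrow> p (x + y) \<le> p x + p y"
    "x \<in> V \<Longrightarrow> p (a *\<^sub>C x) = cmod a * p x"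
  using assms by (auto simp: seminorm_on_def)

lemma seminorm_diff:
  assumes "seminorm_on V p" "csubspace V"
  shows "p 0 = 0" "x \<in> V \<Longrightarrow> p (- x) = p x"
    "x \<in> V \<Longrightarrow> y \<in> V \<Longrightarrow> p (x - y) \<le> p x + p y"
    "x \<in> V \<Longrightarrow> y \<in> V \<Longrightarrow> p (x - y) = p (y - x)"
proof -
  show "p 0 = 0"
    using seminormD(3)[OF assms(1), of 0 0] assms(2) by simp
  have neg: "p (- x) = p x" if "x \<in> V" for x
    using seminormD(3)[OF assms(1) that, of "-1"] by simp
  show "x \<in> V \<Longrightarrow> p (- x) = p x" by (rule neg)
  show "x \<in> V \<Longrightarrow> y \<in> V \<Longrightarrow> p (x - y) \<le> p x + p y"
    using seminormD(2)[OF assms(1), of x "- y"] neg[of y] assms(2) by simp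
  show "x \<in> V \<Longrightarrow> y \<in> V \<Longrightarrow> p (x - y) = p (y - x)"
    using neg[of "x - y"] assms(2) by simp
qed

lemma seminorm_triangle:
  assumes "seminorm_on V p" "csubspace V" "x \<in> V" "y \<in> V" "z \<in> V"
  shows "p (x - z) \<le> p (x - y) + p (y - z)"
  using seminormD(2)[OF assms(1), of "x - y" "y - z"] assms by simp

lemma seminorm_onI:
  assumes "\<And>x. x \<in> V \<Longrightarrow> 0 \<le> p x" "\<And>x y. x \<in> V \<Longrightarrow> y \<in> V \<Longrightarrow> p (x + y) \<le> p x + p y"
    and V: "csubspace V" and hom: "\<And>a x. x \<in> V \<Longrightarrow> p (a *\<^sub>C x) \<le> cmod a * p x"
  shows "seminorm_on V p"
  unfolding seminorm_on_def
proof (intro conjI ballI allI)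
  fix a x assume x: "x \<in> V"
  show "p (a *\<^sub>C x) = cmod a * p x"
  proof (cases "a = 0")
    case True
    then show ?thesis using hom[OF x, of a] assms(1)[of "a *\<^sub>C x"] V by simp
  next
    case False
    have "p x \<le> cmod (inverse a) * p (a *\<^sub>C x)"
      using hom[of "a *\<^sub>C x" "inverse a"] False x V by simp
    then show ?thesis using hom[OF x, of a] False by (simp add: norm_inverse norm_divide field_simps)
  qed
qed (use assms in auto)

lemma seminorm_scale:
  assumes p: "seminorm_on V p" and c: "0 \<le> c" shows "seminorm_on V (\<lambda>x. c * p x)"
  unfolding seminorm_on_def
proof (intro conjI ballI allI)
  show "c * p (x + y) \<le> c * p x + c * p y" if "x \<in> V" "y \<in> V" for x y
    unfolding distrib_left[symmetric] by (rule mult_left_mono[OF seminormD(2)[OF p that] c])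
qed (simp_all add: c seminormD(1,3)[OF p] mult.left_commute)

lemma seminorm_add:
  assumes p: "seminorm_on V p" and q: "seminorm_on V q" shows "seminorm_on V (\<lambda>x. p x + q x)"
  unfolding seminorm_on_def
proof (intro conjI ballI allI)
  show "p (x + y) + q (x + y) \<le> p x + q x + (p y + q y)" if "x \<in> V" "y \<in> V" for x y
    using seminormD(2)[OF p that] seminormD(2)[OF q that] by simp
qed (simp_all add: seminormD(1,3)[OF p] seminormD(1,3)[OF q] distrib_left)

lemma seminorm_subset: "seminorm_on V p \<Longrightarrow> W \<subseteq> V \<Longrightarrow> seminorm_on W p"
  unfolding seminorm_on_def by blast

lemma seminorm_sum_cmod: "seminorm_on V (\<lambda>\<phi>. \<Sum>i\<in>I. cmod (\<phi> i))"
  unfolding seminorm_on_def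
  by (auto simp: sum_nonneg norm_mult sum_distrib_left scaleC_fun_def scaleC_complex_def sum.distrib[symmetric]
      intro!: sum_mono norm_triangle_ineq)

lemma seminorm_imp_sublinear: "seminorm_on V p \<Longrightarrow> sublinear_on V p"
  by (simp add: seminorm_on_def sublinear_on_def)

lemma sublinear_zero:
  assumes "sublinear_on V p" "csubspace V" shows "p 0 = 0"
proof -
  have "p 0 \<le> t * p 0" if "t > 0" for t
    using assms that unfolding sublinear_on_def
    by (metis complex_vector.scale_zero_right complex_vector.subspace_0)
  from this[of 2] this[of "1/2"] show ?thesis by simp
qed

lemma sublinear_lower:
  assumes p: "sublinear_on V p" and V: "csubspace V" and v: "v \<in> V" shows "- p (- v) \<le> p v"
proof -
  have "p (v + (- v)) \<le> p v + p (- v)" using p v V unfolding sublinear_on_def by (metis csub_neg)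
  then show ?thesis using sublinear_zero[OF p V] by simp
qed

text \<open>
  Convex cones lying above the graph of \<open>v \<mapsto> - p (- v)\<close>; by the triangle inequality this is what bounds the infimum
  in the infimal convolution below.
\<close>
definition cone_above :: "'a::complex_vector set \<Rightarrow> ('a \<Rightarrow> real) \<Rightarrow> ('a \<times> real) set \<Rightarrow> bool" where
  "cone_above V p K \<longleftrightarrow> (0, 0) \<in> K \<and> (\<forall>m s. (m, s) \<in> K \<longrightarrow> m \<in> V \<and> 0 \<le> p (- m) + s) \<and>
     (\<forall>m s n t. (m, s) \<in> K \<longrightarrow> (n, t) \<in> K \<longrightarrow> (m + n, s + t) \<in> K) \<and>
     (\<forall>m s t. (m, s) \<in> K \<longrightarrow> 0 < t \<longrightarrow> (t *\<^sub>r m, t * s) \<in> K)"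

lemma cone_aboveI:
  assumes "(0, 0) \<in> K" "\<And>m s. (m, s) \<in> K \<Longrightarrow> m \<in> V" "\<And>m s. (m, s) \<in> K \<Longrightarrow> 0 \<le> p (- m) + s"
    "\<And>m s n t. (m, s) \<in> K \<Longrightarrow> (n, t) \<in> K \<Longrightarrow> (m + n, s + t) \<in> K"
    "\<And>m s t. (m, s) \<in> K \<Longrightarrow> 0 < t \<Longrightarrow> (t *\<^sub>r m, t * s) \<in> K"
  shows "cone_above V p K"
  unfolding cone_above_def using assms by simp

text \<open>
  The cone \<^term>\<open>K\<close> plays the role of the epigraph of the second function. The perturbations in the proof of the
  Hahn-Banach theorem, the functional that yields its decomposition version and the gauges that separate points from
  absolutely convex sets are all of this form, so their sublinearity is proved once.
\<close>
definition inf_conv :: "('a::complex_vector \<Rightarrow> real) \<Rightarrow> ('a \<times> real) set \<Rightarrow> 'a \<Rightarrow> real" where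
  "inf_conv p K v = (INF z\<in>K. p (v - fst z) + snd z)"

context
  fixes V :: "'a::complex_vector set" and p and K
  assumes V: "csubspace V" and p: "sublinear_on V p" and K: "cone_above V p K"
begin

private lemma KV: "(m, s) \<in> K \<Longrightarrow> m \<in> V" and zero: "(0, 0) \<in> K"
  and add: "(m, s) \<in> K \<Longrightarrow> (n, t) \<in> K \<Longrightarrow> (m + n, s + t) \<in> K"
  and scale: "(m, s) \<in> K \<Longrightarrow> 0 < r \<Longrightarrow> (r *\<^sub>r m, r * s) \<in> K"
  and nonneg: "(m, s) \<in> K \<Longrightarrow> 0 \<le> p (- m) + s"
  using K unfolding cone_above_def by blast+

private lemma p_add: "x \<in> V \<Longrightarrow> y \<in> V \<Longrightarrow> p (x + y) \<le> p x + p y"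
  using p unfolding sublinear_on_def by blast

lemma inf_conv_le:
  assumes v: "v \<in> V" and m: "(m, s) \<in> K" shows "inf_conv p K v \<le> p (v - m) + s"
proof -
  have "bdd_below ((\<lambda>z. p (v - fst z) + snd z) ` K)"
  proof (rule bdd_belowI2[of _ "- p (- v)"])
    fix z assume "z \<in> K"
    then have z: "(fst z, snd z) \<in> K" by simp
    have "p ((v - fst z) + (- v)) \<le> p (v - fst z) + p (- v)"
      using v KV[OF z] V by (intro p_add) auto
    then show "- p (- v) \<le> p (v - fst z) + snd z" using nonneg[OF z] by simp
  qed
  from cINF_lower[OF this m] show ?thesis by (simp add: inf_conv_def)
qed

lemma inf_conv_ge:
  assumes "\<And>m s. (m, s) \<in> K \<Longrightarrow> b \<le> p (v - m) + s" shows "b \<le> inf_conv p K v"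
  unfolding inf_conv_def using zero assms by (intro cINF_greatest) auto

lemma sublinear_inf_conv: "sublinear_on V (inf_conv p K)" (is "sublinear_on V ?r")
  unfolding sublinear_on_def
proof (intro conjI ballI allI impI)
  fix x y assume xy: "x \<in> V" "y \<in> V"
  have "?r (x + y) - (p (x - m) + s) \<le> p (y - n) + t" if mn: "(m, s) \<in> K" "(n, t) \<in> K" for m s n t
  proof -
    have "?r (x + y) \<le> p ((x + y) - (m + n)) + (s + t)" using mn xy V add by (intro inf_conv_le) auto
    also have "(x + y) - (m + n) = (x - m) + (y - n)" by simp
    also have "p \<dots> \<le> p (x - m) + p (y - n)" using xy mn KV V by (intro p_add) auto
    finally show ?thesis by simp
  qed
  then have "?r (x + y) - (p (x - m) + s) \<le> ?r y" if "(m, s) \<in> K" for m s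
    using that inf_conv_ge by blast
  then have "?r (x + y) - ?r y \<le> p (x - m) + s" if "(m, s) \<in> K" for m s
    using that by fastforce
  then have "?r (x + y) - ?r y \<le> ?r x" by (rule inf_conv_ge)
  then show "?r (x + y) \<le> ?r x + ?r y" by simp
next
  fix t :: real and x assume t: "t > 0" and x: "x \<in> V"
  have "?r (t *\<^sub>r x) / t \<le> p (x - m) + s" if m: "(m, s) \<in> K" for m s
  proof -
    have "?r (t *\<^sub>r x) \<le> p (t *\<^sub>r x - t *\<^sub>r m) + t * s"
      using m x V t scale by (intro inf_conv_le) auto
    also have "t *\<^sub>r x - t *\<^sub>r m = t *\<^sub>r (x - m)" by (simp add: complex_vector.scale_right_diff_distrib)
    also have "p \<dots> \<le> t * p (x - m)"
      using p t x KV[OF m] V unfolding sublinear_on_def by auto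
    finally show ?thesis using t by (simp add: field_simps)
  qed
  then have "?r (t *\<^sub>r x) / t \<le> ?r x" by (rule inf_conv_ge)
  then show "?r (t *\<^sub>r x) \<le> t * ?r x" using t by (simp add: field_simps)
qed

end

section \<open>The Hahn-Banach theorem\<close>

text \<open>
  A sublinear functional that is minimal below \<^term>\<open>p\<close> is linear. Minimal ones exist by Zorn's lemma,
  since a chain of sublinear functionals below \<^term>\<open>p\<close> has the pointwise infimum as a lower bound. If
  \<^term>\<open>L\<close> is minimal, then for every \<^term>\<open>y\<close> the functional sending \<^term>\<open>v\<close> to the infimum of
  \<^term>\<open>L (v + t *\<^sub>r y) - t * L y\<close> over \<^term>\<open>t \<ge> 0\<close> is sublinear and at most \<^term>\<open>L\<close>, hence equal to
  \<^term>\<open>L\<close>; at \<^term>\<open>- y\<close> it is at most \<^term>\<open>- L y\<close>. Working with functionals defined on the whole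
  space avoids partial linear maps and their domains.
\<close>
lemma real_linear_below_sublinear:
  assumes V: "csubspace V" and p: "sublinear_on V p"
  obtains L where "\<And>x y. x \<in> V \<Longrightarrow> y \<in> V \<Longrightarrow> L (x + y) = L x + L y"
    "\<And>t x. x \<in> V \<Longrightarrow> L (t *\<^sub>r x) = t * L x" "\<And>x. x \<in> V \<Longrightarrow> L x \<le> p x"
proof -
  define A where "A = {q. sublinear_on V q \<and> (\<forall>v\<in>V. q v \<le> p v) \<and> (\<forall>v. v \<notin> V \<longrightarrow> q v = 0)}"
  define P where "P = (\<lambda>a b :: 'a \<Rightarrow> real. b \<le> a)"
  have V': "x \<in> V \<Longrightarrow> - x \<in> V" "x \<in> V \<Longrightarrow> y \<in> V \<Longrightarrow> x + y \<in> V" "x \<in> V \<Longrightarrow> a *\<^sub>C x \<in> V" "0 \<in> V"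
    for x y a using V by auto
  have lowerp: "- p (- v) \<le> q v" if "q \<in> A" "v \<in> V" for q v
    using sublinear_lower[of V q v] V that V'(1)[of v] unfolding A_def by fastforce
  have "\<exists>m\<in>A. \<forall>a\<in>A. P m a \<longrightarrow> a = m"
  proof (rule predicate_Zorn)
    show "partial_order_on A (relation_of P A)"
      unfolding partial_order_on_def preorder_on_def refl_on_def trans_def antisym_def relation_of_def P_def
      by auto
  next
    fix C assume C: "C \<in> Chains (relation_of P A)"
    have CA: "C \<subseteq> A" using C unfolding Chains_def relation_of_def by auto
    have chain: "a \<le> b \<or> b \<le> a" if "a \<in> C" "b \<in> C" for a b
      using C that unfolding Chains_def relation_of_def P_def by auto
    show "\<exists>u\<in>A. \<forall>a\<in>C. P a u"
    proof (cases "C = {}")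
      case True
      have "(\<lambda>v. if v \<in> V then p v else 0) \<in> A"
        using p V' unfolding A_def sublinear_on_def by auto
      then show ?thesis using True by auto
    next
      case False
      define u where "u = (\<lambda>v. if v \<in> V then (INF q\<in>C. q v) else 0)"
      have bdd: "bdd_below ((\<lambda>q. q v) ` C)" if "v \<in> V" for v
        by (rule bdd_belowI2[of _ "- p (- v)"]) (use lowerp that CA in auto)
      have ule: "u v \<le> q v" if "q \<in> C" "v \<in> V" for q v
        unfolding u_def using that bdd by (auto intro: cINF_lower)
      have uge: "m \<le> u v" if "v \<in> V" "\<And>q. q \<in> C \<Longrightarrow> m \<le> q v" for m v
        unfolding u_def using that False by (auto intro: cINF_greatest)
      have sub: "sublinear_on V u"
        unfolding sublinear_on_def
      proof (intro conjI ballI allI impI)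
        fix x y assume xy: "x \<in> V" "y \<in> V"
        have "u (x + y) - q1 x \<le> q2 y" if q: "q1 \<in> C" "q2 \<in> C" for q1 q2
        proof -
          obtain q where "q \<in> C" "q \<le> q1" "q \<le> q2" using chain[OF q] q by auto
          moreover have "q (x + y) \<le> q x + q y"
            using \<open>q \<in> C\<close> CA xy unfolding A_def sublinear_on_def by blast
          moreover have "u (x + y) \<le> q (x + y)" using ule \<open>q \<in> C\<close> xy V' by auto
          ultimately show ?thesis by (smt (verit, best) le_funD)
        qed
        then have "u (x + y) - q1 x \<le> u y" if "q1 \<in> C" for q1 using that uge xy by blast
        then have "u (x + y) - u y \<le> q1 x" if "q1 \<in> C" for q1 using that by fastforce
        then have "u (x + y) - u y \<le> u x" using uge xy by blast
        then show "u (x + y) \<le> u x + u y" by simp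
      next
        fix t :: real and x assume t: "t > 0" and x: "x \<in> V"
        have "u (t *\<^sub>r x) / t \<le> q x" if "q \<in> C" for q
        proof -
          have "u (t *\<^sub>r x) \<le> q (t *\<^sub>r x)" using ule that x V' by auto
          also have "\<dots> \<le> t * q x" using that CA x t unfolding A_def sublinear_on_def by blast
          finally show ?thesis using t by (simp add: field_simps)
        qed
        then have "u (t *\<^sub>r x) / t \<le> u x" using uge x by blast
        then show "u (t *\<^sub>r x) \<le> t * u x" using t by (simp add: field_simps)
      qed
      obtain q0 where "q0 \<in> C" using False by auto
      have "u v \<le> p v" if "v \<in> V" for v
        using ule[OF \<open>q0 \<in> C\<close> that] \<open>q0 \<in> C\<close> CA that unfolding A_def by fastforce
      then have "u \<in> A" unfolding A_def using sub by (auto simp: u_def)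
      moreover have "u \<le> q" if "q \<in> C" for q
      proof (rule le_funI)
        fix v show "u v \<le> q v"
        proof (cases "v \<in> V")
          case True then show ?thesis using ule that by auto
        next
          case False then show ?thesis using that CA unfolding u_def A_def by auto
        qed
      qed
      ultimately show ?thesis unfolding P_def by auto
    qed
  qed
  then obtain L where LA: "L \<in> A" and min: "\<And>a. a \<in> A \<Longrightarrow> a \<le> L \<Longrightarrow> a = L"
    unfolding P_def by blast
  have Lsub: "sublinear_on V L" using LA by (simp add: A_def)
  have Ladd: "L (x + y) \<le> L x + L y" if "x \<in> V" "y \<in> V" for x y
    using Lsub that unfolding sublinear_on_def by blast
  have Lhom: "L (t *\<^sub>r x) \<le> t * L x" if "x \<in> V" "t > 0" for x t
    using Lsub that unfolding sublinear_on_def by blast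
  have L0: "L 0 = 0" by (rule sublinear_zero[OF Lsub V])
  have Lhom0: "L (t *\<^sub>r x) \<le> t * L x" if "x \<in> V" "t \<ge> 0" for x t
    using Lhom[OF that(1), of t] L0 that(2) by (cases "t = 0") auto
  have Lneg: "L (- y) = - L y" if y: "y \<in> V" for y
  proof -
    define K where "K = (\<lambda>t. (- (t *\<^sub>r y), - (t * L y))) ` {0..}"
    have Ly: "L (t *\<^sub>r y) = t * L y" if "t \<ge> 0" for t
    proof (cases "t = 0")
      case False
      then have t: "t > 0" using that by simp
      have "L y = L ((1/t) *\<^sub>r (t *\<^sub>r y))" using t by (simp flip: of_real_mult)
      also have "\<dots> \<le> (1/t) * L (t *\<^sub>r y)" using t y V' by (intro Lhom) auto
      finally show ?thesis using Lhom[OF y t] t by (simp add: field_simps)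
    qed (simp add: L0)
    have "cone_above V L K"
    proof (rule cone_aboveI)
      show "(m + n, s + t) \<in> K" if ms: "(m, s) \<in> K" and nt: "(n, t) \<in> K" for m s n t
      proof -
        obtain a where a: "a \<ge> 0" "m = - (a *\<^sub>r y)" "s = - (a * L y)" using ms by (auto simp: K_def)
        obtain b where "b \<ge> 0" "n = - (b *\<^sub>r y)" "t = - (b * L y)" using nt by (auto simp: K_def)
        with a show ?thesis unfolding K_def by (intro image_eqI[of _ _ "a + b"]) (auto simp: scaleC_add_left algebra_simps)
      qed
      show "(t *\<^sub>r m, t * s) \<in> K" if ms: "(m, s) \<in> K" and t: "0 < t" for m s t
      proof -
        obtain a where "a \<ge> 0" "m = - (a *\<^sub>r y)" "s = - (a * L y)" using ms by (auto simp: K_def)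
        then show ?thesis unfolding K_def using t by (intro image_eqI[of _ _ "t * a"]) auto
      qed
    qed (use V' y Ly in \<open>auto simp: K_def image_iff intro!: bexI[of _ 0]\<close>)
    note K = V Lsub this
    define u where "u = (\<lambda>v. if v \<in> V then inf_conv L K v else 0)"
    have ule: "u v \<le> L (v + t *\<^sub>r y) - t * L y" if "t \<ge> 0" "v \<in> V" for t v
    proof -
      have "(- (t *\<^sub>r y), - (t * L y)) \<in> K" unfolding K_def by (rule image_eqI[of _ _ t]) (use that in simp_all)
      from inf_conv_le[OF K that(2) this] show ?thesis using that by (simp add: u_def)
    qed
    have sub: "sublinear_on V u"
      using sublinear_inf_conv[OF K] V' unfolding sublinear_on_def by (simp add: u_def)
    have uL: "u v \<le> L v" if "v \<in> V" for v using ule[of 0 v] that by simp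
    have "u \<le> L" using uL LA unfolding A_def u_def by (auto intro!: le_funI)
    moreover have "u \<in> A" using sub uL LA unfolding A_def u_def by (smt (verit) mem_Collect_eq)
    ultimately have "u = L" using min by blast
    then have "L (- y) \<le> - L y" using ule[of 1 "- y"] y V' L0 by simp
    then show ?thesis using sublinear_lower[OF Lsub V y] by simp
  qed
  show ?thesis
  proof
    fix x y assume xy: "x \<in> V" "y \<in> V"
    have "L x = L ((x + y) + (- y))" by simp
    also have "\<dots> \<le> L (x + y) + L (- y)" using xy V' by (intro Ladd) auto
    finally show "L (x + y) = L x + L y" using Ladd[OF xy] Lneg[OF xy(2)] by simp
  next
    fix t :: real and x assume x: "x \<in> V"
    have *: "L (t *\<^sub>r x) = t * L x" if "t \<ge> 0" for t
      using Lhom0[OF x that] Lhom0[OF V'(1)[OF x] that] Lneg[OF x] Lneg[of "t *\<^sub>r x"] V'(3)[OF x] by simp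
    show "L (t *\<^sub>r x) = t * L x"
      using *[of t] *[of "- t"] Lneg[of "t *\<^sub>r x"] V'(3)[OF x] by (cases "t \<ge> 0") auto
  next
    fix x assume "x \<in> V" then show "L x \<le> p x" using LA by (simp add: A_def)
  qed
qed

lemma rotate_to_norm:
  obtains c where "c * z = complex_of_real (cmod z)" "cmod c \<le> 1"
proof
  show "cnj (sgn z) * z = complex_of_real (cmod z)"
    unfolding sgn_eq by (simp add: divide_simps complex_norm_square power2_eq_square flip: of_real_mult)
      (metis complex_norm_square mult.commute power2_eq_square)
  show "cmod (cnj (sgn z)) \<le> 1" by (simp add: norm_sgn)
qed

lemma Re_bound_imp_cmod_bound:
  assumes "csubspace V" "clin V \<phi>" "seminorm_on V p" "\<And>v. v \<in> V \<Longrightarrow> Re (\<phi> v) \<le> p v" "v \<in> V"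
  shows "cmod (\<phi> v) \<le> p v"
proof -
  obtain c where c: "c * \<phi> v = complex_of_real (cmod (\<phi> v))" and "cmod c \<le> 1" by (rule rotate_to_norm)
  have "cmod (\<phi> v) = Re (\<phi> (c *\<^sub>C v))" using clinD(2)[OF assms(2,5)] c by simp
  also have "\<dots> \<le> p (c *\<^sub>C v)" using assms by auto
  also have "\<dots> = cmod c * p v" using assms by (auto simp: seminorm_on_def)
  also have "\<dots> \<le> p v" using \<open>cmod c \<le> 1\<close> seminormD(1)[OF assms(3,5)] mult_right_mono by fastforce
  finally show ?thesis .
qed

text \<open>
  A real-linear functional below the infimal convolution of \<^term>\<open>p\<close> and \<open>q + Re \<psi>\<close> is the real part of the
  functional sought. With \<^term>\<open>q = (\<lambda>_. 0)\<close> this is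
  the usual extension theorem. With \<^term>\<open>q\<close> small it says that a functional is close to one that
  is dominated by \<^term>\<open>p\<close>, which is how functionals are approximated by evaluations and by restrictions.
\<close>
lemma Hahn_Banach_decomposition:
  assumes V: "csubspace V" and M: "csubspace M" "M \<subseteq> V"
    and p: "seminorm_on V p" and q: "seminorm_on M q"
    and \<psi>: "clin M \<psi>" and bound: "\<And>m. m \<in> M \<Longrightarrow> cmod (\<psi> m) \<le> p m + q m"
  obtains \<phi> where "clin V \<phi>" "\<And>v. v \<in> V \<Longrightarrow> cmod (\<phi> v) \<le> p v"
    "\<And>m. m \<in> M \<Longrightarrow> cmod (\<psi> m - \<phi> m) \<le> q m"
proof -
  have MV: "m \<in> M \<Longrightarrow> m \<in> V" for m using M by auto
  \<comment> \<open>A linear functional below this infimal convolution is at most \<open>p\<close> on \<open>V\<close> (take \<open>m = 0\<close>), and at most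
    \<open>Re \<psi> + q\<close> on \<open>M\<close> (take \<open>m = v\<close>).\<close>
  define K where "K = {(m, s). m \<in> M \<and> q m + Re (\<psi> m) \<le> s}"
  have lower: "0 \<le> p (- m) + (q m + Re (\<psi> m))" if "m \<in> M" for m
    using bound[OF that] abs_Re_le_cmod[of "\<psi> m"] seminorm_diff(2)[OF p V MV[OF that]] by linarith
  have "cone_above V p K"
  proof (rule cone_aboveI)
    show "(m + n, s + t) \<in> K" if "(m, s) \<in> K" "(n, t) \<in> K" for m s n t
      using that M(1) seminormD(2)[OF q, of m n] clinD(1)[OF \<psi>, of m n] by (auto simp: K_def)
    show "(t *\<^sub>r m, t * s) \<in> K" if "(m, s) \<in> K" "0 < t" for m s t
      using that M(1) seminormD(3)[OF q, of m "complex_of_real t"] clinD(2)[OF \<psi>, of m "complex_of_real t"]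
        mult_left_mono[of "q m + Re (\<psi> m)" s t] by (auto simp: K_def distrib_left)
    show "0 \<le> p (- m) + s" if "(m, s) \<in> K" for m s using that lower[of m] by (auto simp: K_def)
  qed (use M MV seminorm_diff(1)[OF q] clin_diff_zero(2)[OF \<psi>] in \<open>auto simp: K_def\<close>)
  note K = V seminorm_imp_sublinear[OF p] this
  define r where "r = inf_conv p K"
  have sub: "sublinear_on V r" unfolding r_def by (rule sublinear_inf_conv[OF K])
  have rle: "r v \<le> p (v - m) + q m + Re (\<psi> m)" if "m \<in> M" "v \<in> V" for v m
  proof -
    have "(m, q m + Re (\<psi> m)) \<in> K" using that by (simp add: K_def)
    from inf_conv_le[OF K that(2) this] show ?thesis by (simp add: r_def)
  qed
  have M0: "0 \<in> M" using M by simp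
  obtain L where Ladd: "\<And>x y. x \<in> V \<Longrightarrow> y \<in> V \<Longrightarrow> L (x + y) = L x + L y"
    and Lhom: "\<And>t x. x \<in> V \<Longrightarrow> L (t *\<^sub>r x) = t * L x" and Lle: "\<And>x. x \<in> V \<Longrightarrow> L x \<le> r x"
    using real_linear_below_sublinear[OF V sub] by blast
  have Lp: "L v \<le> p v" if "v \<in> V" for v
    using Lle[OF that] rle[OF M0 that] seminorm_diff(1)[OF q M(1)] clin_diff_zero(2)[OF \<psi> M(1)] by simp
  have Lq: "L m - Re (\<psi> m) \<le> q m" if "m \<in> M" for m
    using Lle[OF MV[OF that]] rle[OF that MV[OF that]] seminorm_diff(1)[OF p V] by simp
  define \<phi> where "\<phi> v = Complex (L v) (- L (\<i> *\<^sub>C v))" for v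
  have \<phi>: "clin V \<phi>"
    unfolding clin_def
  proof (intro conjI ballI allI)
    fix x y assume "x \<in> V" "y \<in> V"
    then show "\<phi> (x + y) = \<phi> x + \<phi> y" using V
      by (simp add: \<phi>_def Ladd scaleC_add_right complex_eq_iff)
  next
    fix a x assume x: "x \<in> V"
    have split: "L (a *\<^sub>C x) = Re a * L x + Im a * L (\<i> *\<^sub>C x)" if "x \<in> V" for x a
    proof -
      have "a *\<^sub>C x = Re a *\<^sub>r x + Im a *\<^sub>r (\<i> *\<^sub>C x)"
        by (metis complex_eq mult.commute scaleC_add_left scaleC_scaleC)
      then show ?thesis using that V by (simp add: Ladd Lhom del: scaleC_scaleC)
    qed
    have "L (\<i> *\<^sub>C a *\<^sub>C x) = Re a * L (\<i> *\<^sub>C x) - Im a * L x"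
      using split[OF x, of "\<i> * a"] by simp
    then show "\<phi> (a *\<^sub>C x) = a * \<phi> x"
      using split[OF x, of a] by (simp add: \<phi>_def complex_eq_iff del: scaleC_scaleC)
  qed
  show ?thesis
  proof
    show "clin V \<phi>" by (rule \<phi>)
    show "cmod (\<phi> v) \<le> p v" if "v \<in> V" for v
      by (rule Re_bound_imp_cmod_bound[OF V \<phi> p _ that]) (simp add: \<phi>_def Lp)
    show "cmod (\<psi> m - \<phi> m) \<le> q m" if "m \<in> M" for m
    proof -
      have "clin M (\<lambda>m. \<phi> m - \<psi> m)"
        using clinD[OF \<phi>] clinD[OF \<psi>] MV by (auto simp: clin_def algebra_simps)
      then have "cmod (\<phi> m - \<psi> m) \<le> q m"
        by (rule Re_bound_imp_cmod_bound[OF M(1) _ q _ that]) (simp add: \<phi>_def Lq)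
      then show ?thesis by (simp add: norm_minus_commute)
    qed
  qed
qed

lemma Hahn_Banach_norming:
  assumes V: "csubspace V" and p: "seminorm_on V p" and x0: "x0 \<in> V"
  obtains \<phi> where "clin V \<phi>" "\<And>v. v \<in> V \<Longrightarrow> cmod (\<phi> v) \<le> p v" "\<phi> x0 = complex_of_real (p x0)"
proof (cases "p x0 = 0")
  case True
  show ?thesis
    by (rule that[of "\<lambda>_. 0"]) (use True seminormD(1)[OF p] in \<open>auto simp: clin_def\<close>)
next
  case False
  then have ne: "x0 \<noteq> 0" using seminorm_diff(1)[OF p V] by auto
  define \<psi> where "\<psi> v = (THE a. v = a *\<^sub>C x0) * complex_of_real (p x0)" for v
  have \<psi>: "\<psi> (a *\<^sub>C x0) = a * complex_of_real (p x0)" for a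
    unfolding \<psi>_def using ne by simp
  define M where "M = range (\<lambda>a. a *\<^sub>C x0)"
  have M: "csubspace M"
    unfolding complex_vector.subspace_def M_def
    by (auto simp flip: scaleC_add_left)
  have lin: "clin M \<psi>"
    unfolding clin_def M_def by (auto simp: \<psi> algebra_simps simp flip: scaleC_add_left)
  obtain \<phi> where "clin V \<phi>" "\<And>v. v \<in> V \<Longrightarrow> cmod (\<phi> v) \<le> p v"
    "\<And>m. m \<in> M \<Longrightarrow> cmod (\<psi> m - \<phi> m) \<le> 0"
  proof (rule Hahn_Banach_decomposition[OF V M _ p _ lin, of "\<lambda>_. 0"])
    show "M \<subseteq> V" using x0 V by (auto simp: M_def)
    show "seminorm_on M (\<lambda>_. 0)" by (simp add: seminorm_on_def)
    show "cmod (\<psi> m) \<le> p m + 0" if "m \<in> M" for m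
      using that seminormD[OF p x0] by (auto simp: M_def \<psi> norm_mult)
  qed blast
  moreover have "x0 \<in> M" unfolding M_def by (metis rangeI scaleC_one)
  ultimately show ?thesis using that \<psi>[of 1] by (metis eq_iff_diff_eq_0 mult_1 norm_le_zero_iff scaleC_one)
qed

text \<open>
  Induction on the number of forms: on the kernel of one of them the others suffice, and a form that vanishes on a kernel is
  a multiple of the form defining it.
\<close>
lemma clin_finite_combination:
  fixes s :: "'i \<Rightarrow> 'a::complex_vector \<Rightarrow> complex"
  assumes "finite I" "csubspace V" "\<And>i. i \<in> I \<Longrightarrow> clin V (s i)" "clin V \<Theta>"
    and "\<And>v. v \<in> V \<Longrightarrow> (\<And>i. i \<in> I \<Longrightarrow> s i v = 0) \<Longrightarrow> \<Theta> v = 0"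
  shows "\<exists>c. \<forall>v\<in>V. \<Theta> v = (\<Sum>i\<in>I. c i * s i v)"
  using assms
proof (induction I arbitrary: V rule: finite_induct)
  case empty then show ?case by auto
next
  case (insert k I)
  let ?W = "{v \<in> V. s k v = 0}"
  have k: "clin V (s k)" using insert by auto
  have W: "csubspace ?W"
    using insert.prems(1) clinD[OF k] clin_diff_zero[OF k] unfolding complex_vector.subspace_def by auto
  have "\<exists>c. \<forall>v\<in>?W. \<Theta> v = (\<Sum>i\<in>I. c i * s i v)"
  proof (rule insert.IH[OF W])
    show "clin ?W (s i)" if "i \<in> I" for i using insert.prems(2)[of i] that clin_subset[of V _ ?W] by auto
    show "clin ?W \<Theta>" using insert.prems(3) clin_subset[of V _ ?W] by auto
    show "\<Theta> v = 0" if "v \<in> ?W" "\<And>i. i \<in> I \<Longrightarrow> s i v = 0" for v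
      using insert.prems(4)[of v] that by auto
  qed
  then obtain c where c: "\<And>v. v \<in> V \<Longrightarrow> s k v = 0 \<Longrightarrow> \<Theta> v = (\<Sum>i\<in>I. c i * s i v)" by auto
  show ?case
  proof (cases "\<exists>v\<in>V. s k v \<noteq> 0")
    case False
    then have "\<forall>v\<in>V. \<Theta> v = (\<Sum>i\<in>insert k I. c i * s i v)" using c insert.hyps by auto
    then show ?thesis by blast
  next
    case True
    then obtain v0 where v0: "v0 \<in> V" "s k v0 \<noteq> 0" by auto
    define d where "d = (\<Theta> v0 - (\<Sum>i\<in>I. c i * s i v0)) / s k v0"
    have "\<Theta> v = (\<Sum>i\<in>insert k I. (c(k := d)) i * s i v)" if v: "v \<in> V" for v
    proof -
      define a where "a = s k v / s k v0"
      let ?w = "v - a *\<^sub>C v0"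
      have w: "?w \<in> V" using v v0 insert.prems(1) by auto
      have lin: "g ?w = g v - a * g v0" if "clin V g" for g
        using clinD[OF that] clin_diff_zero[OF that insert.prems(1)] v v0 insert.prems(1) by auto
      have "s k ?w = 0" using lin[OF k] v0 by (simp add: a_def)
      then have "\<Theta> ?w = (\<Sum>i\<in>I. c i * s i ?w)" using c w by auto
      also have "\<dots> = (\<Sum>i\<in>I. c i * s i v) - a * (\<Sum>i\<in>I. c i * s i v0)"
        using insert.prems(2) by (simp add: lin algebra_simps sum_subtractf sum_distrib_left)
      finally have "\<Theta> v = (\<Sum>i\<in>I. c i * s i v) + a * (\<Theta> v0 - (\<Sum>i\<in>I. c i * s i v0))"
        using lin[OF insert.prems(3)] by (simp add: algebra_simps)
      also have "a * (\<Theta> v0 - (\<Sum>i\<in>I. c i * s i v0)) = d * s k v"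
        using v0 by (simp add: a_def d_def field_simps)
      also have "(\<Sum>i\<in>I. c i * s i v) = (\<Sum>i\<in>I. (c(k := d)) i * s i v)"
        using insert.hyps by (intro sum.cong) auto
      finally show ?thesis using insert.hyps by simp
    qed
    then show ?thesis by blast
  qed
qed

section \<open>Separation of absolutely convex sets\<close>
definition absconvex :: "'a::complex_vector set \<Rightarrow> bool" where
  "absconvex C \<longleftrightarrow> C \<noteq> {} \<and>
     (\<forall>x\<in>C. \<forall>y\<in>C. \<forall>a b. cmod a + cmod b \<le> 1 \<longrightarrow> a *\<^sub>C x + b *\<^sub>C y \<in> C)"

lemma absconvexD:
  assumes "absconvex C"
  shows "x \<in> C \<Longrightarrow> y \<in> C \<Longrightarrow> cmod a + cmod b \<le> 1 \<Longrightarrow> a *\<^sub>C x + b *\<^sub>C y \<in> C"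
    "0 \<in> C" "x \<in> C \<Longrightarrow> cmod a \<le> 1 \<Longrightarrow> a *\<^sub>C x \<in> C"
proof -
  have *: "\<And>x y a b. x \<in> C \<Longrightarrow> y \<in> C \<Longrightarrow> cmod a + cmod b \<le> 1 \<Longrightarrow> a *\<^sub>C x + b *\<^sub>C y \<in> C"
    using assms unfolding absconvex_def by blast
  obtain x0 where "x0 \<in> C" using assms unfolding absconvex_def by blast
  show "x \<in> C \<Longrightarrow> y \<in> C \<Longrightarrow> cmod a + cmod b \<le> 1 \<Longrightarrow> a *\<^sub>C x + b *\<^sub>C y \<in> C" by (rule *)
  show "0 \<in> C" using *[OF \<open>x0 \<in> C\<close> \<open>x0 \<in> C\<close>, of 0 0] by simp
  show "x \<in> C \<Longrightarrow> cmod a \<le> 1 \<Longrightarrow> a *\<^sub>C x \<in> C" using *[of x x a 0] by simp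
qed

text \<open>
  For \<^term>\<open>C\<close> the unit ball of a second norm this is the K-functional of real interpolation theory.
  It mixes the gauge of \<^term>\<open>C\<close>, weighted by \<^term>\<open>a\<close>, with the seminorm \<^term>\<open>p\<close>, weighted
  by \<^term>\<open>b\<close>, and is equivalent to the gauge of the sum of a multiple of \<^term>\<open>C\<close> and a ball.
\<close>
definition gauge_conv :: "('a::complex_vector \<Rightarrow> real) \<Rightarrow> 'a set \<Rightarrow> real \<Rightarrow> real \<Rightarrow> 'a \<Rightarrow> real" where
  "gauge_conv p C a b = inf_conv (\<lambda>v. b * p v) {(s *\<^sub>r c, a * s) | s c. 0 \<le> s \<and> c \<in> C}"

context
  fixes V :: "'a::complex_vector set" and p C and a b :: real
  assumes V: "csubspace V" and p: "seminorm_on V p" and CV: "C \<subseteq> V" and C: "absconvex C"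
    and a: "a \<ge> 0" and b: "b \<ge> 0"
begin

private abbreviation (input) "K \<equiv> {(s *\<^sub>r c, a * s) | s c. 0 \<le> s \<and> c \<in> C}"

private lemmas weighted = seminorm_scale[OF p b]

private lemma cone: "cone_above V (\<lambda>v. b * p v) K"
proof (rule cone_aboveI)
  show m: "m \<in> V" if "(m, s) \<in> K" for m s using that V CV by auto
  show "0 \<le> b * p (- m) + s" if "(m, s) \<in> K" for m s
    using that seminormD(1)[OF weighted, of "- m"] m[OF that] V a by auto
  show "(0, 0) \<in> K" using absconvexD(2)[OF C] by force
  show "(t *\<^sub>r m, t * s) \<in> K" if ms: "(m, s) \<in> K" and t: "0 < t" for m s t
  proof -
    obtain r c where "m = r *\<^sub>r c" "s = a * r" "0 \<le> r" "c \<in> C" using ms by blast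
    then show ?thesis using t by (intro CollectI exI[of _ "t * r"] exI[of _ c]) simp
  qed
  show "(m + n, u + v) \<in> K" if mn: "(m, u) \<in> K" "(n, v) \<in> K" for m n u v
  proof -
    obtain s c where s: "m = s *\<^sub>r c" "u = a * s" "0 \<le> s" "c \<in> C" using mn by blast
    obtain t d where t: "n = t *\<^sub>r d" "v = a * t" "0 \<le> t" "d \<in> C" using mn by blast
    obtain e where e: "e \<in> C" "(s + t) *\<^sub>r e = s *\<^sub>r c + t *\<^sub>r d"
    proof (cases "s + t = 0")
      case True
      then have "s = 0" "t = 0" using s t by auto
      then show ?thesis using that[OF s(4)] by simp
    next
      case False
      then have "s + t > 0" using s t by simp
      then have "(s / (s + t)) *\<^sub>r c + (t / (s + t)) *\<^sub>r d \<in> C"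
        using s t by (intro absconvexD(1)[OF C]) (auto simp: norm_divide add_divide_distrib[symmetric] simp flip: of_real_add)
      moreover have "(s + t) *\<^sub>r ((s / (s + t)) *\<^sub>r c + (t / (s + t)) *\<^sub>r d) = s *\<^sub>r c + t *\<^sub>r d"
        using False by (simp add: scaleC_add_right flip: of_real_add of_real_mult of_real_divide)
      ultimately show ?thesis by (rule that)
    qed
    show ?thesis
      by (rule CollectI, rule exI[of _ "s + t"], rule exI[of _ e]) (use e s t in \<open>simp add: distrib_left\<close>)
  qed
qed

lemma gauge_conv_le:
  assumes "v \<in> V" "s \<ge> 0" "c \<in> C"
  shows "gauge_conv p C a b v \<le> a * s + b * p (v - s *\<^sub>r c)"
proof -
  have "(s *\<^sub>r c, a * s) \<in> K" using assms by blast
  from inf_conv_le[OF V seminorm_imp_sublinear[OF weighted] cone assms(1) this] show ?thesis by (simp add: gauge_conv_def)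
qed

lemma gauge_conv_ge:
  assumes "\<And>s c. s \<ge> 0 \<Longrightarrow> c \<in> C \<Longrightarrow> m \<le> a * s + b * p (v - s *\<^sub>r c)"
  shows "m \<le> gauge_conv p C a b v"
  unfolding gauge_conv_def
proof (rule inf_conv_ge[OF V seminorm_imp_sublinear[OF weighted] cone])
  fix w r assume "(w, r) \<in> K"
  then obtain s c where "w = s *\<^sub>r c" "r = a * s" "0 \<le> s" "c \<in> C" by blast
  then show "m \<le> b * p (v - w) + r" using assms[of s c] by simp
qed

lemma gauge_conv_less:
  assumes "gauge_conv p C a b v < e"
  obtains s c where "s \<ge> 0" "c \<in> C" "a * s + b * p (v - s *\<^sub>r c) < e"
  using assms gauge_conv_ge[of e v] by fastforce

lemma gauge_conv_le_norm: "v \<in> V \<Longrightarrow> gauge_conv p C a b v \<le> b * p v"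
  using gauge_conv_le[of v 0 0] absconvexD(2)[OF C] by simp

lemma gauge_conv_le_on_set: "c \<in> C \<Longrightarrow> gauge_conv p C a b c \<le> a"
  using gauge_conv_le[of c 1 c] CV seminorm_diff(1)[OF p V] by auto

lemma gauge_conv_seminorm: "seminorm_on V (gauge_conv p C a b)" (is "seminorm_on V ?q")
proof (rule seminorm_onI[OF _ _ V])
  note sub = sublinear_inf_conv[OF V seminorm_imp_sublinear[OF weighted] cone, folded gauge_conv_def]
  show "0 \<le> ?q x" if "x \<in> V" for x
  proof (rule gauge_conv_ge)
    show "0 \<le> a * s + b * p (x - s *\<^sub>r c)" if "s \<ge> 0" "c \<in> C" for s c
      using that \<open>x \<in> V\<close> a b V CV seminormD(1)[OF p, of "x - s *\<^sub>r c"] by auto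
  qed
  show "?q (x + y) \<le> ?q x + ?q y" if "x \<in> V" "y \<in> V" for x y
    using sub that unfolding sublinear_on_def by blast
  fix \<alpha> x assume "x \<in> V"
  show "?q (\<alpha> *\<^sub>C x) \<le> cmod \<alpha> * ?q x"
  proof (cases "\<alpha> = 0")
    case True
    then show ?thesis using sublinear_zero[OF sub V] by simp
  next
    case False
    then have "\<alpha> \<noteq> 0" .
    have "?q (\<alpha> *\<^sub>C x) / cmod \<alpha> \<le> a * s + b * p (x - s *\<^sub>r c)" if sc: "s \<ge> 0" "c \<in> C" for s c
    proof -
      have eq: "complex_of_real (cmod \<alpha>) * sgn \<alpha> = \<alpha>"
        using \<open>\<alpha> \<noteq> 0\<close> by (simp add: sgn_eq)
      have "?q (\<alpha> *\<^sub>C x) \<le> a * (cmod \<alpha> * s) + b * p (\<alpha> *\<^sub>C x - (cmod \<alpha> * s) *\<^sub>r (sgn \<alpha> *\<^sub>C c))"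
        using sc \<open>x \<in> V\<close> V by (intro gauge_conv_le absconvexD(3)[OF C]) (auto simp: norm_sgn)
      also have "(cmod \<alpha> * s) *\<^sub>r (sgn \<alpha> *\<^sub>C c) = (s * (cmod \<alpha> * sgn \<alpha>)) *\<^sub>C c"
        by (simp add: mult_ac)
      also have "\<alpha> *\<^sub>C x - \<dots> = \<alpha> *\<^sub>C (x - s *\<^sub>r c)"
        unfolding eq by (simp add: complex_vector.scale_right_diff_distrib mult.commute)
      also have "p \<dots> = cmod \<alpha> * p (x - s *\<^sub>r c)"
        using \<open>x \<in> V\<close> sc CV V by (intro seminormD(3)[OF p]) auto
      finally show ?thesis using \<open>\<alpha> \<noteq> 0\<close> by (simp add: field_simps)
    qed
    then have "?q (\<alpha> *\<^sub>C x) / cmod \<alpha> \<le> ?q x" by (rule gauge_conv_ge)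
    then show ?thesis using \<open>\<alpha> \<noteq> 0\<close> by (simp add: field_simps)
  qed
qed

end

text \<open>
  The functional norms \<^term>\<open>x0\<close> for the K-functional with weights \<open>1\<close> and \<open>2 / e\<close>, which is at most \<open>1\<close> on
  \<^term>\<open>C\<close> and at most a multiple of \<^term>\<open>p\<close>. At \<^term>\<open>x0\<close> it is at least \<open>1 + \<eta>\<close> for some
  \<open>\<eta> > 0\<close>, which makes the separation strict.
\<close>
lemma separation:
  assumes V: "csubspace V" and p: "seminorm_on V p" and CV: "C \<subseteq> V" and C: "absconvex C"
    and x0: "x0 \<in> V" and e: "e > 0" and far: "\<And>c. c \<in> C \<Longrightarrow> e \<le> p (x0 - c)"
  obtains \<phi> K where "clin V \<phi>" "\<And>v. v \<in> V \<Longrightarrow> cmod (\<phi> v) \<le> K * p v"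
    "\<And>c. c \<in> C \<Longrightarrow> cmod (\<phi> c) \<le> 1" "1 < cmod (\<phi> x0)"
proof -
  define q where "q = gauge_conv p C 1 (2/e)"
  have b: "0 \<le> 2/e" "0 \<le> (1::real)" using e by auto
  note facts = V p CV C b(2) b(1)
  have q: "seminorm_on V q" unfolding q_def by (rule gauge_conv_seminorm[OF facts])
  have p0: "0 \<le> p x0" using seminormD(1)[OF p x0] .
  \<comment> \<open>For \<open>s\<close> between \<open>1\<close> and \<open>1 + \<eta>\<close> the point \<open>x0\<close> still has distance at least \<open>e / 2\<close> from \<open>s C\<close>.\<close>
  define \<eta> where "\<eta> = min 1 (e / (2 * (p x0 + 1)))"
  have "\<eta> > 0" using e p0 by (simp add: \<eta>_def)
  have "\<eta> * p x0 \<le> (e / (2 * (p x0 + 1))) * p x0" using p0 by (intro mult_right_mono) (auto simp: \<eta>_def)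
  also have "\<dots> \<le> e / 2" using p0 e by (simp add: field_simps)
  finally have \<eta>p: "\<eta> * p x0 \<le> e / 2" .
  have "1 + \<eta> \<le> q x0"
    unfolding q_def
  proof (rule gauge_conv_ge[OF facts])
    fix s :: real and c assume s: "s \<ge> 0" and c: "c \<in> C"
    have cV: "c \<in> V" using c CV by auto
    let ?r = "p (x0 - s *\<^sub>r c)"
    have r0: "0 \<le> ?r" using cV x0 V by (intro seminormD(1)[OF p]) auto
    show "1 + \<eta> \<le> 1 * s + 2 / e * ?r"
    proof (cases "s \<le> 1")
      case True
      then have "e \<le> ?r" using s c by (intro far absconvexD(3)[OF C]) auto
      then have "2 \<le> 2 / e * ?r" using e by (simp add: field_simps)
      then show ?thesis using s by (simp add: \<eta>_def)
    next
      case False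
      show ?thesis
      proof (cases "s \<le> 1 + \<eta>")
        case True
        have "s *\<^sub>r (x0 - c) = (x0 - s *\<^sub>r c) + (s - 1) *\<^sub>r x0"
          by (simp add: complex_vector.scale_right_diff_distrib complex_vector.scale_left_diff_distrib)
        then have "p (s *\<^sub>r (x0 - c)) \<le> ?r + p ((s - 1) *\<^sub>r x0)"
          using x0 cV V seminormD(2)[OF p, of "x0 - s *\<^sub>r c" "(s - 1) *\<^sub>r x0"] by simp
        then have "s * p (x0 - c) \<le> ?r + (s - 1) * p x0"
          using seminormD(3)[OF p, of "x0 - c" s] seminormD(3)[OF p x0, of "complex_of_real (s - 1)"] False x0 cV V
          by (simp flip: of_real_diff)
        moreover have "e \<le> s * p (x0 - c)"
          using far[OF c] False e mult_mono[of 1 s e "p (x0 - c)"] by simp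
        moreover have "(s - 1) * p x0 \<le> \<eta> * p x0" using True p0 by (intro mult_right_mono) auto
        ultimately have "e / 2 \<le> ?r" using \<eta>p by linarith
        then have "1 \<le> 2 / e * ?r" using e by (simp add: field_simps)
        then show ?thesis using False by (simp add: \<eta>_def)
      next
        case False
        then show ?thesis using r0 e by (simp add: add_increasing2)
      qed
    qed
  qed
  moreover obtain \<phi> where \<phi>: "clin V \<phi>" "\<And>v. v \<in> V \<Longrightarrow> cmod (\<phi> v) \<le> q v" "\<phi> x0 = complex_of_real (q x0)"
    using Hahn_Banach_norming[OF V q x0] by blast
  ultimately have "1 < cmod (\<phi> x0)" using \<open>\<eta> > 0\<close> by simp
  moreover have "cmod (\<phi> v) \<le> 2/e * p v" if "v \<in> V" for v
    using \<phi>(2)[OF that] gauge_conv_le_norm[OF facts that] unfolding q_def by linarith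
  moreover have "cmod (\<phi> c) \<le> 1" if "c \<in> C" for c
    using \<phi>(2)[of c] gauge_conv_le_on_set[OF facts that] that CV unfolding q_def by force
  ultimately show ?thesis using that \<phi>(1) by blast
qed

section \<open>Normed spaces and their duals\<close>

lemma cnormedD:
  assumes "cnormed V"
  shows "csubspace (vecs V)" "seminorm_on (vecs V) (vnorm V)"
    "x \<in> vecs V \<Longrightarrow> vnorm V x = 0 \<longleftrightarrow> x = 0"
  using assms by (auto simp: cnormed_def seminorm_on_def)

lemma cnormedI:
  assumes "csubspace (vecs V)" "seminorm_on (vecs V) (vnorm V)"
    "\<And>x. x \<in> vecs V \<Longrightarrow> vnorm V x = 0 \<Longrightarrow> x = 0"
  shows "cnormed V"
  using assms seminorm_diff(1)[OF assms(2,1)] unfolding cnormed_def seminorm_on_def by auto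

lemma scalars_simps [simp]: "vecs scalars = UNIV" "vnorm scalars = cmod"
  by (simp_all add: scalars_def)

lemma mem_dual:
  "\<phi> \<in> vecs (dual V) \<longleftrightarrow> clin (vecs V) \<phi> \<and> (\<forall>x. x \<notin> vecs V \<longrightarrow> \<phi> x = 0) \<and>
     (\<exists>K. \<forall>x\<in>vecs V. cmod (\<phi> x) \<le> K * vnorm V x)"
  by (auto simp: dual_def bounded_ops_def clin_def scaleC_complex_def)

lemma dualD:
  assumes "\<phi> \<in> vecs (dual V)"
  shows "clin (vecs V) \<phi>" "x \<notin> vecs V \<Longrightarrow> \<phi> x = 0"
  using assms by (auto simp: mem_dual)

lemma dualI:
  assumes "clin (vecs V) \<phi>" "\<And>x. x \<notin> vecs V \<Longrightarrow> \<phi> x = 0"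
    "\<And>x. x \<in> vecs V \<Longrightarrow> cmod (\<phi> x) \<le> K * vnorm V x"
  shows "\<phi> \<in> vecs (dual V)"
  using assms unfolding mem_dual by blast

lemma dual_restrict:
  assumes "cnormed V" "clin (vecs V) \<phi>" "\<And>x. x \<in> vecs V \<Longrightarrow> cmod (\<phi> x) \<le> K * vnorm V x"
  shows "(\<lambda>x. if x \<in> vecs V then \<phi> x else 0) \<in> vecs (dual V)"
  by (rule dualI[of _ _ K]) (use assms cnormedD(1)[OF assms(1)] in \<open>auto simp: clin_def\<close>)

lemma vnorm_dual: "vnorm (dual V) \<phi> = (SUP x\<in>closed_unit_ball V. cmod (\<phi> x))"
  by (simp add: dual_def op_norm_def)

lemma zero_in_ball: "cnormed V \<Longrightarrow> 0 \<in> closed_unit_ball V" "cnormed V \<Longrightarrow> 0 \<in> open_unit_ball V"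
  using cnormedD(1)[of V] seminorm_diff(1)[OF cnormedD(2) cnormedD(1), of V]
  by (simp_all add: closed_unit_ball_def open_unit_ball_def)

lemma dual_bdd:
  assumes "cnormed V" "\<phi> \<in> vecs (dual V)"
  shows "bdd_above ((\<lambda>x. cmod (\<phi> x)) ` closed_unit_ball V)"
proof -
  obtain K where K: "\<And>x. x \<in> vecs V \<Longrightarrow> cmod (\<phi> x) \<le> K * vnorm V x"
    using assms by (auto simp: mem_dual)
  show ?thesis
  proof (rule bdd_aboveI2[of _ _ "\<bar>K\<bar>"])
    fix x assume "x \<in> closed_unit_ball V"
    then have x: "x \<in> vecs V" "vnorm V x \<le> 1" by (auto simp: closed_unit_ball_def)
    have "K * vnorm V x \<le> \<bar>K\<bar> * 1"
      using x seminormD(1)[OF cnormedD(2)[OF assms(1)]] by (intro mult_mono) auto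
    then show "cmod (\<phi> x) \<le> \<bar>K\<bar>" using K[OF x(1)] by simp
  qed
qed

lemma dual_norm_nonneg: "cnormed V \<Longrightarrow> \<phi> \<in> vecs (dual V) \<Longrightarrow> 0 \<le> vnorm (dual V) \<phi>"
  unfolding vnorm_dual by (rule cSUP_upper2[OF dual_bdd zero_in_ball(1)]) auto

lemma dual_bound:
  assumes V: "cnormed V" and \<phi>: "\<phi> \<in> vecs (dual V)" and x: "x \<in> vecs V"
  shows "cmod (\<phi> x) \<le> vnorm (dual V) \<phi> * vnorm V x"
proof (cases "vnorm V x = 0")
  case True
  then show ?thesis using cnormedD(3)[OF V x] clin_diff_zero(2)[OF dualD(1)[OF \<phi>] cnormedD(1)[OF V]] by simp
next
  case False
  then have pos: "vnorm V x > 0" using seminormD(1)[OF cnormedD(2)[OF V] x] by simp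
  let ?y = "(1 / vnorm V x) *\<^sub>r x"
  have "?y \<in> closed_unit_ball V"
    using x pos cnormedD(1)[OF V] seminormD(3)[OF cnormedD(2)[OF V] x]
    by (simp add: closed_unit_ball_def norm_divide)
  then have "cmod (\<phi> ?y) \<le> vnorm (dual V) \<phi>"
    unfolding vnorm_dual by (rule cSUP_upper[OF _ dual_bdd[OF V \<phi>]])
  moreover have "cmod (\<phi> ?y) = cmod (\<phi> x) / vnorm V x"
    unfolding clinD(2)[OF dualD(1)[OF \<phi>] x] using pos by (simp add: norm_mult norm_divide)
  ultimately have "cmod (\<phi> x) / vnorm V x \<le> vnorm (dual V) \<phi>" by (simp only:)
  then show ?thesis using pos by (simp add: pos_divide_le_eq)
qed

lemma dual_norm_le:
  assumes "cnormed V" "B \<ge> 0" "\<And>x. x \<in> vecs V \<Longrightarrow> cmod (\<phi> x) \<le> B * vnorm V x"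
  shows "vnorm (dual V) \<phi> \<le> B"
  unfolding vnorm_dual
proof (rule cSUP_least)
  show "closed_unit_ball V \<noteq> {}" using zero_in_ball(1)[OF assms(1)] by auto
  fix x assume "x \<in> closed_unit_ball V"
  then have x: "x \<in> vecs V" "vnorm V x \<le> 1" by (auto simp: closed_unit_ball_def)
  show "cmod (\<phi> x) \<le> B"
    using assms(3)[OF x(1)] mult_left_mono[OF x(2) assms(2)] by simp
qed

lemma fun_simps [simp]:
  "((\<phi> :: 'a \<Rightarrow> 'b::complex_vector) + \<psi>) x = \<phi> x + \<psi> x" "(a *\<^sub>C \<phi>) x = a *\<^sub>C \<phi> x" "(0 :: 'a \<Rightarrow> 'b) x = 0"
  "(\<phi> - \<psi>) x = \<phi> x - \<psi> x" "(- \<phi>) x = - \<phi> x"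
  by (auto simp: scaleC_fun_def)

lemma scaleC_complex [simp]: "a *\<^sub>C (x::complex) = a * x"
  by (simp add: scaleC_complex_def)

lemma cnormed_dual:
  assumes V: "cnormed V" shows "cnormed (dual V)"
proof (rule cnormedI)
  note nn = seminormD(1)[OF cnormedD(2)[OF V]] and [simp] = cnormedD(1)[OF V]
  have add: "\<phi> + \<psi> \<in> vecs (dual V)" "vnorm (dual V) (\<phi> + \<psi>) \<le> vnorm (dual V) \<phi> + vnorm (dual V) \<psi>"
    if "\<phi> \<in> vecs (dual V)" "\<psi> \<in> vecs (dual V)" for \<phi> \<psi>
  proof -
    have b: "cmod ((\<phi> + \<psi>) x) \<le> (vnorm (dual V) \<phi> + vnorm (dual V) \<psi>) * vnorm V x" if "x \<in> vecs V" for x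
      using norm_triangle_ineq[of "\<phi> x" "\<psi> x"] dual_bound[OF V \<open>\<phi> \<in> _\<close> that] dual_bound[OF V \<open>\<psi> \<in> _\<close> that]
      by (simp add: algebra_simps)
    show "\<phi> + \<psi> \<in> vecs (dual V)"
      by (rule dualI[OF _ _ b]) (use that in \<open>auto simp: mem_dual clin_def algebra_simps\<close>)
    show "vnorm (dual V) (\<phi> + \<psi>) \<le> vnorm (dual V) \<phi> + vnorm (dual V) \<psi>"
      using that by (intro dual_norm_le[OF V _ b] add_nonneg_nonneg dual_norm_nonneg[OF V])
  qed
  have sc: "a *\<^sub>C \<phi> \<in> vecs (dual V)" "vnorm (dual V) (a *\<^sub>C \<phi>) \<le> cmod a * vnorm (dual V) \<phi>"
    if "\<phi> \<in> vecs (dual V)" for \<phi> a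
  proof -
    have b: "cmod ((a *\<^sub>C \<phi>) x) \<le> (cmod a * vnorm (dual V) \<phi>) * vnorm V x" if "x \<in> vecs V" for x
      using mult_left_mono[OF dual_bound[OF V \<open>\<phi> \<in> _\<close> that], of "cmod a"] by (simp add: norm_mult mult.assoc)
    show "a *\<^sub>C \<phi> \<in> vecs (dual V)"
      by (rule dualI[OF _ _ b]) (use that in \<open>auto simp: mem_dual clin_def algebra_simps\<close>)
    show "vnorm (dual V) (a *\<^sub>C \<phi>) \<le> cmod a * vnorm (dual V) \<phi>"
      using that by (intro dual_norm_le[OF V _ b] mult_nonneg_nonneg dual_norm_nonneg[OF V]) auto
  qed
  have zero: "0 \<in> vecs (dual V)"
    by (rule dualI[of _ _ 0]) (auto simp: clin_def)
  show sub: "csubspace (vecs (dual V))"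
    unfolding complex_vector.subspace_def using add sc zero by auto
  show "seminorm_on (vecs (dual V)) (vnorm (dual V))"
    by (rule seminorm_onI, rule dual_norm_nonneg[OF V], assumption, rule add(2), assumption+, rule sub, rule sc(2))
  show "\<phi> = 0" if "\<phi> \<in> vecs (dual V)" "vnorm (dual V) \<phi> = 0" for \<phi>
  proof
    fix x show "\<phi> x = 0 x"
      using dual_bound[OF V that(1), of x] that dualD(2)[OF that(1), of x] by (cases "x \<in> vecs V") auto
  qed
qed

lemma norming_functional:
  assumes V: "cnormed V" and x: "x \<in> vecs V"
  obtains \<phi> where "\<phi> \<in> closed_unit_ball (dual V)" "\<phi> x = complex_of_real (vnorm V x)"
proof -
  obtain \<phi> where \<phi>: "clin (vecs V) \<phi>" "\<And>v. v \<in> vecs V \<Longrightarrow> cmod (\<phi> v) \<le> vnorm V v" "\<phi> x = vnorm V x"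
    using Hahn_Banach_norming[OF cnormedD(1,2)[OF V] x] by blast
  let ?\<phi> = "\<lambda>x. if x \<in> vecs V then \<phi> x else 0"
  show ?thesis
  proof
    show "?\<phi> \<in> closed_unit_ball (dual V)"
      unfolding closed_unit_ball_def using dual_restrict[OF V \<phi>(1), of 1] dual_norm_le[OF V, of 1 ?\<phi>] \<phi>(2) by auto
  qed (use \<phi> x in auto)
qed

lemma norm_le_by_dual:
  assumes V: "cnormed V" and x: "x \<in> vecs V"
    and B: "\<And>\<phi>. \<phi> \<in> closed_unit_ball (dual V) \<Longrightarrow> cmod (\<phi> x) \<le> B"
  shows "vnorm V x \<le> B"
proof -
  obtain \<phi> where \<phi>: "\<phi> \<in> closed_unit_ball (dual V)" "\<phi> x = complex_of_real (vnorm V x)"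
    using norming_functional[OF V x] by blast
  then show ?thesis using B[OF \<phi>(1)] by simp
qed

lemma dual_separates:
  assumes V: "cnormed V" and xy: "x \<in> vecs V" "y \<in> vecs V"
    and eq: "\<And>\<phi>. \<phi> \<in> vecs (dual V) \<Longrightarrow> \<phi> x = \<phi> y"
  shows "x = y"
proof -
  note [simp] = cnormedD(1)[OF V]
  have "vnorm V (x - y) \<le> 0"
  proof (rule norm_le_by_dual[OF V])
    fix \<phi> assume "\<phi> \<in> closed_unit_ball (dual V)"
    then have \<phi>: "\<phi> \<in> vecs (dual V)" by (simp add: closed_unit_ball_def)
    show "cmod (\<phi> (x - y)) \<le> 0"
      unfolding clin_diff_zero(1)[OF dualD(1)[OF \<phi>] cnormedD(1)[OF V] xy] eq[OF \<phi>] by simp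
  qed (use xy in simp)
  then show ?thesis
    using cnormedD(3)[OF V, of "x - y"] seminormD(1)[OF cnormedD(2)[OF V], of "x - y"] xy by simp
qed

lemma Metric_space_cnormed:
  assumes V: "cnormed V" shows "Metric_space (vecs V) (ndist V)"
proof
  note [simp] = cnormedD(1)[OF V] and nn = seminormD(1)[OF cnormedD(2)[OF V]]
  show "0 \<le> ndist V x y" for x y using nn by (simp add: ndist_def)
  show "ndist V x y = ndist V y x" for x y
    using seminorm_diff(4)[OF cnormedD(2,1)[OF V], of x y] by (simp add: ndist_def)
  show "(ndist V x y = 0) = (x = y)" if "x \<in> vecs V" "y \<in> vecs V" for x y
    using that cnormedD(3)[OF V, of "x - y"] by (simp add: ndist_def)
  show "ndist V x z \<le> ndist V x y + ndist V y z" if "x \<in> vecs V" "y \<in> vecs V" "z \<in> vecs V" for x y z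
    using that seminorm_triangle[OF cnormedD(2,1)[OF V], of x y z] by (simp add: ndist_def)
qed

lemma cbanach_iff:
  "cbanach V \<longleftrightarrow> cnormed V \<and>
     (\<forall>\<sigma> :: nat \<Rightarrow> _. (\<forall>n. \<sigma> n \<in> vecs V) \<and> (\<forall>e>0. \<exists>N. \<forall>m\<ge>N. \<forall>n\<ge>N. vnorm V (\<sigma> m - \<sigma> n) < e) \<longrightarrow>
        (\<exists>l\<in>vecs V. \<forall>e>0. \<exists>N. \<forall>n\<ge>N. vnorm V (\<sigma> n - l) < e))"
  (is "_ \<longleftrightarrow> _ \<and> ?R")
proof (cases "cnormed V")
  case True
  note M = Metric_space_cnormed[OF True]
  have C: "Metric_space.MCauchy (vecs V) (ndist V) \<sigma> \<longleftrightarrow>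
      (\<forall>n. \<sigma> n \<in> vecs V) \<and> (\<forall>e>0. \<exists>N. \<forall>m\<ge>N. \<forall>n\<ge>N. vnorm V (\<sigma> m - \<sigma> n) < e)" for \<sigma>
  proof (cases "\<forall>n. \<sigma> n \<in> vecs V")
    case True
    then show ?thesis unfolding Metric_space.MCauchy_def[OF M] by (auto simp: ndist_def) 
  next
    case False
    then show ?thesis unfolding Metric_space.MCauchy_def[OF M] by auto
  qed
  have L: "limitin (Metric_space.mtopology (vecs V) (ndist V)) \<sigma> l sequentially \<longleftrightarrow>
      l \<in> vecs V \<and> (\<forall>e>0. \<exists>N. \<forall>n\<ge>N. vnorm V (\<sigma> n - l) < e)" if "\<And>n. \<sigma> n \<in> vecs V" for \<sigma> l
    unfolding Metric_space.limitin_metric[OF M] eventually_sequentially using that by (auto simp: ndist_def)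
  have "Metric_space.mcomplete (vecs V) (ndist V) \<longleftrightarrow> ?R"
    unfolding Metric_space.mcomplete_def[OF M] C by (rule arg_cong[where f = All], rule ext, rule imp_cong[OF refl]) (use L in blast)
  then show ?thesis using True by (simp add: cbanach_def)
qed (simp add: cbanach_def)

lemma cbanach_cnormed: "cbanach V \<Longrightarrow> cnormed V"
  by (simp add: cbanach_def)

text \<open>
  Evaluations that approximate \<^term>\<open>F\<close> uniformly on the dual ball come from a Cauchy sequence of points, because the norm
  of a point is the norm of its evaluation. Completeness therefore turns approximate representation by points into
  exact representation; the linearization, the weak-star continuity criterion and the reflexivity of the
  interpolation space all rest on this.
\<close>
lemma evaluations_closed:
  assumes Y: "cbanach Y"
    and approx: "\<And>e. e > 0 \<Longrightarrow> \<exists>y\<in>vecs Y. \<forall>\<phi>\<in>vecs (dual Y). cmod (F \<phi> - \<phi> y) \<le> e * vnorm (dual Y) \<phi>"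
  shows "\<exists>y\<in>vecs Y. \<forall>\<phi>\<in>vecs (dual Y). F \<phi> = \<phi> y"
proof -
  note N = cbanach_cnormed[OF Y]
  note [simp] = cnormedD(1)[OF N]
  have "\<forall>n::nat. \<exists>y\<in>vecs Y. \<forall>\<phi>\<in>vecs (dual Y). cmod (F \<phi> - \<phi> y) \<le> (1 / Suc n) * vnorm (dual Y) \<phi>"
    by (intro allI approx) simp
  then obtain \<sigma> where \<sigma>: "\<And>n::nat. \<sigma> n \<in> vecs Y"
    and F: "\<And>n \<phi>. \<phi> \<in> vecs (dual Y) \<Longrightarrow> cmod (F \<phi> - \<phi> (\<sigma> n)) \<le> (1 / Suc n) * vnorm (dual Y) \<phi>"
    by metis
  have d: "vnorm Y (\<sigma> m - \<sigma> n) \<le> 1 / Suc m + 1 / Suc n" for m n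
  proof (rule norm_le_by_dual[OF N])
    fix \<phi> assume "\<phi> \<in> closed_unit_ball (dual Y)"
    then have \<phi>: "\<phi> \<in> vecs (dual Y)" "vnorm (dual Y) \<phi> \<le> 1" by (auto simp: closed_unit_ball_def)
    have b: "cmod (F \<phi> - \<phi> (\<sigma> n)) \<le> 1 / Suc n" for n
      using F[OF \<phi>(1), of n] mult_left_mono[OF \<phi>(2), of "1 / Suc n"] by simp
    have "\<phi> (\<sigma> m - \<sigma> n) = (F \<phi> - \<phi> (\<sigma> n)) - (F \<phi> - \<phi> (\<sigma> m))"
      using clin_diff_zero(1)[OF dualD(1)[OF \<phi>(1)] cnormedD(1)[OF N]] \<sigma> by simp
    then show "cmod (\<phi> (\<sigma> m - \<sigma> n)) \<le> 1 / Suc m + 1 / Suc n"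
      using norm_triangle_ineq4[of "F \<phi> - \<phi> (\<sigma> n)" "F \<phi> - \<phi> (\<sigma> m)"] b[of m] b[of n] by simp
  qed (use \<sigma> in simp)
  have small: "\<exists>N::nat. \<forall>n\<ge>N. 1 / Suc n < e" if e: "e > 0" for e :: real
  proof -
    obtain N where "inverse (real (Suc N)) < e" using reals_Archimedean[OF e] by blast
    moreover have "1 / Suc n \<le> inverse (real (Suc N))" if "n \<ge> N" for n
      using that by (simp add: field_simps)
    ultimately have "1 / Suc n < e" if "n \<ge> N" for n using that by fastforce
    then show ?thesis by blast
  qed
  have "\<exists>N. \<forall>m\<ge>N. \<forall>n\<ge>N. vnorm Y (\<sigma> m - \<sigma> n) < e" if "e > 0" for e
  proof -
    obtain N where N: "\<forall>n\<ge>N. 1 / Suc n < e / 2" using small[of "e/2"] \<open>e > 0\<close> half_gt_zero by blast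
    then have "vnorm Y (\<sigma> m - \<sigma> n) < e" if "m \<ge> N" "n \<ge> N" for m n
      using d[of m n] N[rule_format, OF that(1)] N[rule_format, OF that(2)] by linarith
    then show ?thesis by blast
  qed
  then obtain l where l: "l \<in> vecs Y" "\<And>e. e > 0 \<Longrightarrow> \<exists>N. \<forall>n\<ge>N. vnorm Y (\<sigma> n - l) < e"
    using Y \<sigma> unfolding cbanach_iff by blast
  have "F \<phi> = \<phi> l" if \<phi>: "\<phi> \<in> vecs (dual Y)" for \<phi>
  proof -
    let ?B = "vnorm (dual Y) \<phi>"
    have B: "?B \<ge> 0" by (rule dual_norm_nonneg[OF N \<phi>])
    have "cmod (F \<phi> - \<phi> l) \<le> e * (2 * ?B)" if e: "e > 0" for e
    proof -
      obtain N1 where N1: "\<forall>n\<ge>N1. 1 / Suc n < e" using small[OF e] by blast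
      obtain N2 where N2: "\<forall>n\<ge>N2. vnorm Y (\<sigma> n - l) < e" using l(2)[OF e] by blast
      define n where "n = max N1 N2"
      have n: "1 / Suc n \<le> e" "vnorm Y (\<sigma> n - l) \<le> e"
        using N1 N2 by (auto simp: n_def less_imp_le)
      have "cmod (F \<phi> - \<phi> (\<sigma> n)) \<le> e * ?B"
        using F[OF \<phi>, of n] mult_right_mono[OF n(1) B] by linarith
      moreover have "cmod (\<phi> (\<sigma> n - l)) \<le> ?B * vnorm Y (\<sigma> n - l)"
        using \<sigma> l(1) by (intro dual_bound[OF N \<phi>]) simp
      then have "cmod (\<phi> (\<sigma> n - l)) \<le> e * ?B"
        using mult_left_mono[OF n(2) B] by (simp add: mult.commute)
      moreover have eq: "F \<phi> - \<phi> l = (F \<phi> - \<phi> (\<sigma> n)) + \<phi> (\<sigma> n - l)"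
        using clin_diff_zero(1)[OF dualD(1)[OF \<phi>] cnormedD(1)[OF N]] \<sigma> l(1) by simp
      ultimately show ?thesis
        using norm_triangle_ineq[of "F \<phi> - \<phi> (\<sigma> n)" "\<phi> (\<sigma> n - l)"] unfolding eq by linarith
    qed
    note key = this
    have "cmod (F \<phi> - \<phi> l) \<le> 0"
    proof (rule field_le_epsilon)
      fix x :: real assume x: "x > 0"
      have "cmod (F \<phi> - \<phi> l) \<le> x / (2 * ?B + 1) * (2 * ?B)"
        using key[of "x / (2 * ?B + 1)"] x B by simp
      also have "\<dots> \<le> x" using x B by (simp add: field_simps)
      finally show "cmod (F \<phi> - \<phi> l) \<le> 0 + x" by simp
    qed
    then show ?thesis by simp
  qed
  then show ?thesis using l(1) by blast
qed

section \<open>Weak and weak-star compactness\<close>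
lemma dual_zero_mem: "cnormed V \<Longrightarrow> 0 \<in> vecs (dual V)"
  by (rule csub_0[OF cnormedD(1)[OF cnormed_dual]])

lemma openin_weak_topology:
  "\<phi> \<in> vecs (dual V) \<Longrightarrow> open U \<Longrightarrow> openin (weak_topology V) {x \<in> vecs V. \<phi> x \<in> U}"
  unfolding weak_topology_def
  by (rule topology_generated_by_Basis, rule CollectI, (rule exI)+, rule conjI, rule refl, rule conjI)

lemma topspace_weak_topology:
  assumes "cnormed V" shows "topspace (weak_topology V) = vecs V"
proof (rule equalityI)
  show "topspace (weak_topology V) \<subseteq> vecs V"
    unfolding weak_topology_def topology_generated_by_topspace by (rule Union_least, erule CollectE, (erule exE conjE)+, hypsubst, rule Collect_restrict)
  show "vecs V \<subseteq> topspace (weak_topology V)"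
    using openin_subset[OF openin_weak_topology[OF dual_zero_mem[OF assms] open_UNIV]] by simp
qed

lemma closedin_weak_topology:
  assumes "cnormed V" "\<phi> \<in> vecs (dual V)" "closed U"
  shows "closedin (weak_topology V) {x \<in> vecs V. \<phi> x \<in> U}"
proof -
  have "vecs V - {x \<in> vecs V. \<phi> x \<in> U} = {x \<in> vecs V. \<phi> x \<in> - U}" by auto
  then show ?thesis
    using openin_weak_topology[OF assms(2), of "- U"] assms
    by (auto simp: closedin_def topspace_weak_topology)
qed

lemma continuous_map_weak_topology:
  assumes "cnormed W" "\<And>x. x \<in> topspace T \<Longrightarrow> g x \<in> vecs W"
    and "\<And>\<psi> U. \<psi> \<in> vecs (dual W) \<Longrightarrow> open U \<Longrightarrow> openin T {x \<in> topspace T. \<psi> (g x) \<in> U}"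
  shows "continuous_map T (weak_topology W) g"
  unfolding weak_topology_def
proof (rule continuous_on_generated_topo)
  show "g ` topspace T \<subseteq> \<Union> {{x \<in> vecs W. \<phi> x \<in> U} |\<phi> U. \<phi> \<in> vecs (dual W) \<and> open U}"
    using assms(2)
    unfolding topology_generated_by_topspace[symmetric] weak_topology_def[symmetric]
      topspace_weak_topology[OF assms(1)] by (rule image_subsetI)
  fix A assume "A \<in> {{x \<in> vecs W. \<phi> x \<in> U} |\<phi> U. \<phi> \<in> vecs (dual W) \<and> open U}"
  then obtain \<phi> U where *: "A = {x \<in> vecs W. \<phi> x \<in> U}" "\<phi> \<in> vecs (dual W)" "open U" by blast
  then have "g -` A \<inter> topspace T = {x \<in> topspace T. \<phi> (g x) \<in> U}" using assms(2) by auto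
  then show "openin T (g -` A \<inter> topspace T)" using assms(3) * by simp
qed

lemma Hausdorff_weak_topology:
  assumes V: "cnormed V" shows "Hausdorff_space (weak_topology V)"
  unfolding Hausdorff_space_def topspace_weak_topology[OF V]
proof (intro allI impI)
  fix x y assume xy: "x \<in> vecs V \<and> y \<in> vecs V \<and> x \<noteq> y"
  have "\<not> (\<forall>\<phi>\<in>vecs (dual V). \<phi> x = \<phi> y)"
  proof
    assume "\<forall>\<phi>\<in>vecs (dual V). \<phi> x = \<phi> y"
    then have "x = y" by (intro dual_separates[OF V]) (use xy in \<open>simp_all\<close>)
    then show False using xy by simp
  qed
  then obtain \<phi> where \<phi>: "\<phi> \<in> vecs (dual V)" "\<phi> x \<noteq> \<phi> y"
    unfolding Ball_def not_all not_imp by (elim exE conjE)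
  obtain U W where "open U" "open W" "\<phi> x \<in> U" "\<phi> y \<in> W" "U \<inter> W = {}"
    using hausdorff[OF \<phi>(2)] by (elim exE conjE)
  then show "\<exists>A B. openin (weak_topology V) A \<and> openin (weak_topology V) B \<and> x \<in> A \<and> y \<in> B \<and> disjnt A B"
    using openin_weak_topology[OF \<phi>(1), of U] openin_weak_topology[OF \<phi>(1), of W] xy
    by (intro exI[of _ "{x \<in> vecs V. \<phi> x \<in> U}"] exI[of _ "{x \<in> vecs V. \<phi> x \<in> W}"])
       (auto simp: disjnt_def)
qed

text \<open>
  Equivalent to compactness of the weak closure, since the weak topology is Hausdorff, but visibly inherited by
  subsets.
\<close>
definition rel_weakly_compact :: "'a::complex_vector cspace \<Rightarrow> 'a set \<Rightarrow> bool" where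
  "rel_weakly_compact V A \<longleftrightarrow> (\<exists>Q. compactin (weak_topology V) Q \<and> A \<subseteq> Q)"

lemma rel_weakly_compact_iff_closure:
  assumes V: "cnormed V" and "A \<subseteq> vecs V"
  shows "rel_weakly_compact V A \<longleftrightarrow> compactin (weak_topology V) (weak_topology V closure_of A)"
proof (rule iffI)
  assume "rel_weakly_compact V A"
  then obtain Q where Q: "compactin (weak_topology V) Q" "A \<subseteq> Q" by (auto simp: rel_weakly_compact_def)
  then have "weak_topology V closure_of A \<subseteq> Q"
    using closure_of_minimal compactin_imp_closedin[OF Hausdorff_weak_topology[OF V]] by blast
  then show "compactin (weak_topology V) (weak_topology V closure_of A)"
    using closed_compactin[OF Q(1)] closedin_closure_of by blast
next
  assume "compactin (weak_topology V) (weak_topology V closure_of A)"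
  then show "rel_weakly_compact V A"
    using closure_of_subset[of A "weak_topology V"] assms
    unfolding rel_weakly_compact_def topspace_weak_topology[OF V] by blast
qed

lemma weakly_compact_op_iff:
  assumes "cnormed W"
  shows "weakly_compact_op V W T \<longleftrightarrow> T \<in> bounded_ops V W \<and> rel_weakly_compact W (T ` closed_unit_ball V)"
proof (cases "T \<in> bounded_ops V W")
  case True
  then have "T ` closed_unit_ball V \<subseteq> vecs W" by (auto simp: bounded_ops_def closed_unit_ball_def)
  then show ?thesis
    using True rel_weakly_compact_iff_closure[OF assms] by (simp add: weakly_compact_op_def)
qed (simp add: weakly_compact_op_def)

lemma openin_weak_star:
  "x \<in> vecs V \<Longrightarrow> open U \<Longrightarrow> openin (weak_star_topology V) {\<phi> \<in> vecs (dual V). \<phi> x \<in> U}"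
  unfolding weak_star_topology_def
  by (rule topology_generated_by_Basis, rule CollectI, (rule exI)+, rule conjI, rule refl, rule conjI)

lemma topspace_weak_star:
  assumes "cnormed V" shows "topspace (weak_star_topology V) = vecs (dual V)"
proof (rule equalityI)
  show "topspace (weak_star_topology V) \<subseteq> vecs (dual V)"
    unfolding weak_star_topology_def topology_generated_by_topspace by (rule Union_least, erule CollectE, (erule exE conjE)+, hypsubst, rule Collect_restrict)
  show "vecs (dual V) \<subseteq> topspace (weak_star_topology V)"
    using openin_subset[OF openin_weak_star[OF csub_0[OF cnormedD(1)[OF assms]] open_UNIV]] by simp
qed

text \<open>
  In the product topology on all functions, the dual ball is a closed subset of a product of discs, hence compact by
  Tychonoff's theorem; on it the identity is continuous into the weak-star topology, whose generators are preimages under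
  coordinates.
\<close>
theorem Banach_Alaoglu:
  assumes V: "cnormed V"
  shows "compactin (weak_star_topology V) (closed_unit_ball (dual V))"
proof -
  note N = cnormedD[OF V] and nn = seminormD(1)[OF cnormedD(2)[OF V]]
  let ?V = "vecs V"
  define P where "P = PiE UNIV (\<lambda>x. if x \<in> ?V then cball (0::complex) (vnorm V x) else {0})"
  define D where "D = closed_unit_ball (dual V)"
  have "compactin (product_topology (\<lambda>i. euclidean) UNIV) P"
    unfolding P_def compactin_PiE by auto
  then have P: "compact P" by (simp add: euclidean_product_topology)
  have D_eq: "D = P \<inter> (\<Inter>x\<in>?V. \<Inter>y\<in>?V. {\<phi>. \<phi> (x + y) = \<phi> x + \<phi> y}) \<inter> (\<Inter>a. \<Inter>x\<in>?V. {\<phi>. \<phi> (a *\<^sub>C x) = a * \<phi> x})"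
    (is "_ = ?R")
  proof (intro set_eqI iffI)
    fix \<phi> assume "\<phi> \<in> D"
    then have \<phi>: "\<phi> \<in> vecs (dual V)" "vnorm (dual V) \<phi> \<le> 1" by (auto simp: D_def closed_unit_ball_def)
    have "cmod (\<phi> x) \<le> vnorm V x" if "x \<in> ?V" for x
      using dual_bound[OF V \<phi>(1) that] mult_right_mono[OF \<phi>(2) nn[OF that]] by simp
    then show "\<phi> \<in> ?R" using \<phi>(1) by (auto simp: P_def mem_dual clin_def)
  next
    fix \<phi> assume R: "\<phi> \<in> ?R"
    have b: "cmod (\<phi> x) \<le> 1 * vnorm V x" if "x \<in> ?V" for x
    proof -
      have "\<phi> x \<in> (if x \<in> ?V then cball 0 (vnorm V x) else {0})" using R unfolding P_def by blast
      then show ?thesis using that by simp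
    qed
    have z: "\<phi> x = 0" if "x \<notin> ?V" for x
    proof -
      have "\<phi> x \<in> (if x \<in> ?V then cball 0 (vnorm V x) else {0})" using R unfolding P_def by blast
      then show ?thesis using that by simp
    qed
    have "clin ?V \<phi>" using R unfolding clin_def by blast
    then have "\<phi> \<in> vecs (dual V)" by (rule dualI[OF _ z b])
    moreover have "vnorm (dual V) \<phi> \<le> 1" by (rule dual_norm_le[OF V _ b]) auto
    ultimately show "\<phi> \<in> D" by (simp add: D_def closed_unit_ball_def)
  qed
  have coord: "continuous_on UNIV (\<lambda>\<phi> :: 'a \<Rightarrow> complex. \<phi> x)" for x
    by simp
  have "closed (\<Inter>x\<in>?V. \<Inter>y\<in>?V. {\<phi> :: 'a \<Rightarrow> complex. \<phi> (x + y) = \<phi> x + \<phi> y})"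
    by (intro closed_INT ballI closed_Collect_eq continuous_intros coord)
  moreover have "closed (\<Inter>a. \<Inter>x\<in>?V. {\<phi> :: 'a \<Rightarrow> complex. \<phi> (a *\<^sub>C x) = a * \<phi> x})"
    by (intro closed_INT ballI closed_Collect_eq continuous_intros coord)
  ultimately have "compact D" unfolding D_eq using P by (intro compact_Int_closed)
  then have "compactin (subtopology euclidean D) D"
    by (simp add: compactin_subtopology)
  moreover have "continuous_map (subtopology euclidean D) (weak_star_topology V) (\<lambda>\<phi>. \<phi>)"
    unfolding weak_star_topology_def
  proof (rule continuous_on_generated_topo)
    show "(\<lambda>\<phi>. \<phi>) ` topspace (subtopology euclidean D) \<subseteq> \<Union> {{\<phi> \<in> vecs (dual V). \<phi> x \<in> U} |x U. x \<in> vecs V \<and> open U}"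
      unfolding topology_generated_by_topspace[symmetric] weak_star_topology_def[symmetric]
        topspace_weak_star[OF V] by (auto simp: D_def closed_unit_ball_def)
    fix A assume "A \<in> {{\<phi> \<in> vecs (dual V). \<phi> x \<in> U} |x U. x \<in> vecs V \<and> open U}"
    then obtain x U where *: "A = {\<phi> \<in> vecs (dual V). \<phi> x \<in> U}" "open U" by blast
    have "open ((\<lambda>\<phi> :: 'a \<Rightarrow> complex. \<phi> x) -` U)" by (rule open_vimage[OF *(2) coord])
    moreover have "(\<lambda>\<phi>. \<phi>) -` A \<inter> topspace (subtopology euclidean D) = D \<inter> ((\<lambda>\<phi>. \<phi> x) -` U)"
      unfolding * by (auto simp: D_def closed_unit_ball_def)
    ultimately show "openin (subtopology euclidean D) ((\<lambda>\<phi>. \<phi>) -` A \<inter> topspace (subtopology euclidean D))"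
      by (auto simp: openin_subtopology)
  qed
  ultimately have "compactin (weak_star_topology V) ((\<lambda>\<phi>. \<phi>) ` D)" by (rule image_compactin)
  then show ?thesis by (simp add: D_def)
qed

text \<open>
  If composing \<^term>\<open>y\<close> with a functional always gives an evaluation, then \<^term>\<open>y\<close> is weak-star-to-weak continuous on the
  dual ball, so that the Banach-Alaoglu theorem produces weakly compact sets.
\<close>
lemma compactin_image_of_dual_ball:
  assumes V: "cnormed V" and W: "cnormed W"
    and y: "\<And>\<Phi>. \<Phi> \<in> closed_unit_ball (dual V) \<Longrightarrow> y \<Phi> \<in> vecs W"
    and adj: "\<And>\<psi>. \<psi> \<in> vecs (dual W) \<Longrightarrow> \<exists>v\<in>vecs V. \<forall>\<Phi>\<in>closed_unit_ball (dual V). \<psi> (y \<Phi>) = \<Phi> v"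
  shows "compactin (weak_topology W) (y ` closed_unit_ball (dual V))"
proof -
  let ?B = "closed_unit_ball (dual V)" and ?T = "subtopology (weak_star_topology V) (closed_unit_ball (dual V))"
  have BV: "?B \<subseteq> vecs (dual V)" by (auto simp: closed_unit_ball_def)
  then have top: "topspace ?T = ?B" using topspace_weak_star[OF V] by auto
  have "continuous_map ?T (weak_topology W) y"
  proof (rule continuous_map_weak_topology[OF W], unfold top)
    fix \<psi> U assume "\<psi> \<in> vecs (dual W)" and U: "open (U :: complex set)"
    then obtain v where v: "v \<in> vecs V" "\<And>\<Phi>. \<Phi> \<in> ?B \<Longrightarrow> \<psi> (y \<Phi>) = \<Phi> v" using adj by blast
    have "{\<Phi> \<in> ?B. \<psi> (y \<Phi>) \<in> U} = {\<Phi> \<in> vecs (dual V). \<Phi> v \<in> U} \<inter> ?B" using v BV by auto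
    then show "openin ?T {\<Phi> \<in> ?B. \<psi> (y \<Phi>) \<in> U}"
      using openin_weak_star[OF v(1) U] by (auto simp: openin_subtopology)
  qed (rule y)
  moreover have "compactin ?T ?B" using Banach_Alaoglu[OF V] by (simp add: compactin_subtopology)
  ultimately show ?thesis using image_compactin by blast
qed

section \<open>Functionals on a dual space that are evaluations\<close>
lemma dual_combination:
  assumes Y: "cnormed Y" and S: "S \<subseteq> vecs (dual Y)"
  shows "(\<Sum>\<phi>\<in>S. c \<phi> *\<^sub>C \<phi>) \<in> vecs (dual Y)" "(\<Sum>\<phi>\<in>S. c \<phi> *\<^sub>C \<phi>) y = (\<Sum>\<phi>\<in>S. c \<phi> * \<phi> y)"
proof -
  show "(\<Sum>\<phi>\<in>S. c \<phi> *\<^sub>C \<phi>) \<in> vecs (dual Y)"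
    using cnormedD(1)[OF cnormed_dual[OF Y]] S by (intro complex_vector.subspace_sum) auto
  show "(\<Sum>\<phi>\<in>S. c \<phi> *\<^sub>C \<phi>) y = (\<Sum>\<phi>\<in>S. c \<phi> * \<phi> y)"
    by (induction S rule: infinite_finite_induct) auto
qed

text \<open>
  Helly's theorem. If the conclusion fails, \<^term>\<open>F\<close> is separated from the evaluations at points of \<^term>\<open>C\<close> in the space of
  all functions on the dual, with respect to the coordinates in \<^term>\<open>S\<close>. The separating functional is a linear
  combination of those coordinates, hence is given by a single functional on \<^term>\<open>Y\<close>, which violates the domination
  hypothesis.
\<close>
lemma evaluations_dense:
  assumes Y: "cnormed Y" and C: "absconvex C" and CY: "C \<subseteq> vecs Y"
    and F: "clin (vecs (dual Y)) F"
    and dom: "\<And>\<phi>. \<phi> \<in> vecs (dual Y) \<Longrightarrow> (\<And>c. c \<in> C \<Longrightarrow> cmod (\<phi> c) \<le> 1) \<Longrightarrow> cmod (F \<phi>) \<le> 1"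
    and S: "finite S" "S \<subseteq> vecs (dual Y)" and e: "e > 0"
  shows "\<exists>c\<in>C. (\<Sum>\<phi>\<in>S. cmod (F \<phi> - \<phi> c)) < e"
proof (rule ccontr)
  assume "\<not> ?thesis"
  then have far: "e \<le> (\<Sum>\<phi>\<in>S. cmod (F \<phi> - \<phi> c))" if "c \<in> C" for c using that by (meson not_less)
  let ?J = "bidual_embedding Y"
  let ?p = "\<lambda>v :: ('a \<Rightarrow> complex) \<Rightarrow> complex. \<Sum>\<phi>\<in>S. cmod (v \<phi>)"
  have U: "csubspace (UNIV :: (('a \<Rightarrow> complex) \<Rightarrow> complex) set)" by simp
  have p: "seminorm_on UNIV ?p" by (rule seminorm_sum_cmod)
  have J: "?J c \<phi> = \<phi> c" if "\<phi> \<in> vecs (dual Y)" for c \<phi> using that by (simp add: bidual_embedding_def)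
  have JC: "absconvex (?J ` C)"
    unfolding absconvex_def
  proof (intro conjI ballI allI impI)
    show "?J ` C \<noteq> {}" using absconvexD(2)[OF C] by auto
    fix u v a b assume "u \<in> ?J ` C" "v \<in> ?J ` C" and ab: "cmod a + cmod b \<le> 1"
    then obtain x y where xy: "x \<in> C" "y \<in> C" "u = ?J x" "v = ?J y" by auto
    have "a *\<^sub>C u + b *\<^sub>C v = ?J (a *\<^sub>C x + b *\<^sub>C y)"
    proof
      fix \<phi>
      have mem: "x \<in> vecs Y" "y \<in> vecs Y" "a *\<^sub>C x \<in> vecs Y" "b *\<^sub>C y \<in> vecs Y"
        using xy CY cnormedD(1)[OF Y] by auto
      show "(a *\<^sub>C u + b *\<^sub>C v) \<phi> = ?J (a *\<^sub>C x + b *\<^sub>C y) \<phi>"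
      proof (cases "\<phi> \<in> vecs (dual Y)")
        case True
        note lin = clinD[OF dualD(1)[OF True]]
        show ?thesis using True mem by (simp add: xy J lin)
      qed (simp add: xy bidual_embedding_def)
    qed
    then show "a *\<^sub>C u + b *\<^sub>C v \<in> ?J ` C" using absconvexD(1)[OF C xy(1,2) ab] by auto
  qed
  have far': "e \<le> ?p (F - v)" if "v \<in> ?J ` C" for v
  proof -
    obtain c where c: "c \<in> C" "v = ?J c" using \<open>v \<in> ?J ` C\<close> by blast
    have "?p (F - v) = (\<Sum>\<phi>\<in>S. cmod (F \<phi> - \<phi> c))"
      using S(2) unfolding c by (intro sum.cong) (auto simp: J subset_iff)
    then show ?thesis using far[OF c(1)] by simp
  qed
  obtain \<Theta> K where \<Theta>: "clin UNIV \<Theta>" "\<And>v. v \<in> UNIV \<Longrightarrow> cmod (\<Theta> v) \<le> K * ?p v" "\<And>v. v \<in> ?J ` C \<Longrightarrow> cmod (\<Theta> v) \<le> 1"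
    "1 < cmod (\<Theta> F)"
    using separation[of UNIV ?p "?J ` C" F e, OF U p subset_UNIV JC UNIV_I e far'] by blast
  have "\<exists>a. \<forall>v\<in>UNIV. \<Theta> v = (\<Sum>\<phi>\<in>S. a \<phi> * v \<phi>)"
  proof (rule clin_finite_combination[OF S(1) U _ \<Theta>(1)])
    show "clin UNIV (\<lambda>v :: ('a \<Rightarrow> complex) \<Rightarrow> complex. v \<phi>)" for \<phi> by (simp add: clin_def)
    show "\<Theta> v = 0" if "\<And>\<phi>. \<phi> \<in> S \<Longrightarrow> v \<phi> = 0" for v
      using \<Theta>(2)[of v] that by simp
  qed
  then obtain a where a: "\<And>v. \<Theta> v = (\<Sum>\<phi>\<in>S. a \<phi> * v \<phi>)" by blast
  define \<psi> where "\<psi> = (\<Sum>\<phi>\<in>S. a \<phi> *\<^sub>C \<phi>)"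
  have \<psi>: "\<psi> \<in> vecs (dual Y)" unfolding \<psi>_def by (rule dual_combination[OF Y S(2)])
  have "cmod (\<psi> c) \<le> 1" if "c \<in> C" for c
  proof -
    have "\<psi> c = (\<Sum>\<phi>\<in>S. a \<phi> * \<phi> c)" unfolding \<psi>_def by (rule dual_combination[OF Y S(2)])
    also have "\<dots> = \<Theta> (?J c)" unfolding a using S(2) by (intro sum.cong) (auto simp: J subset_iff)
    finally show ?thesis using \<Theta>(3) that by auto
  qed
  then have "cmod (F \<psi>) \<le> 1" by (rule dom[OF \<psi>])
  moreover have "F \<psi> = \<Theta> F"
    unfolding \<psi>_def a using S(2) cnormedD(1)[OF cnormed_dual[OF Y]]
    by (subst clin_sum[OF F]) (auto simp: subset_iff clinD(2)[OF F] intro!: sum.cong)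
  ultimately show False using \<Theta>(4) by simp
qed

text \<open>
  The closed sets of points at which the evaluation agrees with \<^term>\<open>F\<close> up to a given error at a given functional have the
  finite intersection property by Helly's theorem; a point common to all of them exists by compactness.
\<close>
lemma dominated_imp_evaluation:
  assumes Y: "cnormed Y" and C: "absconvex C" and CY: "C \<subseteq> vecs Y"
    and Q: "compactin (weak_topology Y) Q" and CQ: "C \<subseteq> Q"
    and F: "clin (vecs (dual Y)) F"
    and dom: "\<And>\<phi>. \<phi> \<in> vecs (dual Y) \<Longrightarrow> (\<And>c. c \<in> C \<Longrightarrow> cmod (\<phi> c) \<le> 1) \<Longrightarrow> cmod (F \<phi>) \<le> 1"
  shows "\<exists>y\<in>Q. \<forall>\<phi>\<in>vecs (dual Y). F \<phi> = \<phi> y"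
proof -
  define A where "A = (\<lambda>(\<phi>, e). {y \<in> vecs Y. \<phi> y \<in> cball (F \<phi>) e})"
  define I where "I = vecs (dual Y) \<times> {0::real<..}"
  have "Q \<inter> \<Inter> (A ` I) \<noteq> {}"
  proof (rule compactin_fip[THEN iffD1, OF Q, THEN conjunct2, rule_format], intro conjI ballI allI impI)
    fix X assume "X \<in> A ` I"
    then obtain i where i: "i \<in> I" "X = A i" by (rule imageE)
    then have X: "X = {y \<in> vecs Y. fst i y \<in> cball (F (fst i)) (snd i)}" and \<phi>: "fst i \<in> vecs (dual Y)"
      by (simp_all add: A_def I_def split_beta mem_Times_iff)
    show "closedin (weak_topology Y) X"
      unfolding X by (rule closedin_weak_topology[OF Y \<phi> closed_cball])
  next
    fix \<F> assume \<F>: "finite \<F> \<and> \<F> \<subseteq> A ` I"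
    then obtain J where J: "J \<subseteq> I" "finite J" "\<F> = A ` J" by (meson finite_subset_image)
    define e where "e = Min (insert 1 (snd ` J))"
    have e: "e > 0" unfolding e_def using J by (subst Min_gr_iff) (auto simp: I_def)
    have S: "finite (fst ` J)" "fst ` J \<subseteq> vecs (dual Y)" using J by (auto simp: I_def)
    then obtain c where c: "c \<in> C" "(\<Sum>\<phi>\<in>fst ` J. cmod (F \<phi> - \<phi> c)) < e"
      using evaluations_dense[OF Y C CY F dom S e] by blast
    have "c \<in> A j" if j: "j \<in> J" for j
    proof -
      have "cmod (F (fst j) - fst j c) \<le> (\<Sum>\<phi>\<in>fst ` J. cmod (F \<phi> - \<phi> c))"
        using S j by (intro member_le_sum) auto
      moreover have "e \<le> snd j" unfolding e_def using J j by (intro Min_le) auto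
      ultimately have "cmod (F (fst j) - fst j c) \<le> snd j" using c by linarith
      then show ?thesis using c CY by (auto simp: A_def dist_norm split: prod.splits)
    qed
    then show "Q \<inter> \<Inter> \<F> \<noteq> {}" using c CQ J by blast
  qed
  then obtain y where y: "y \<in> Q" "\<And>\<phi> e. \<phi> \<in> vecs (dual Y) \<Longrightarrow> e > 0 \<Longrightarrow> cmod (F \<phi> - \<phi> y) \<le> e"
    unfolding A_def I_def by (fastforce simp: dist_norm)
  have "F \<phi> = \<phi> y" if "\<phi> \<in> vecs (dual Y)" for \<phi>
    using field_le_epsilon[of "cmod (F \<phi> - \<phi> y)" 0] y(2)[OF that] by simp
  then show ?thesis using y(1) by blast
qed

text \<open>
  Grothendieck's completeness argument: by homogeneity \<^term>\<open>F\<close> is dominated by \<^term>\<open>e\<close> times the sum of the dual norm and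
  finitely many absolute values of evaluations. The decomposition theorem splits \<^term>\<open>F\<close> into a functional controlled by
  these evaluations, which is itself an evaluation, and an error of norm at most \<^term>\<open>e\<close>.
\<close>
lemma weak_star_continuous_on_ball_imp_evaluation:
  assumes Y: "cbanach Y" and F: "clin (vecs (dual Y)) F"
    and cont: "\<And>e. e > 0 \<Longrightarrow> \<exists>S. finite S \<and> S \<subseteq> vecs Y \<and>
       (\<forall>\<phi>\<in>closed_unit_ball (dual Y). (\<forall>y\<in>S. cmod (\<phi> y) \<le> 1) \<longrightarrow> cmod (F \<phi>) \<le> e)"
  shows "\<exists>y\<in>vecs Y. \<forall>\<phi>\<in>vecs (dual Y). F \<phi> = \<phi> y"
proof (rule evaluations_closed[OF Y])
  note N = cbanach_cnormed[OF Y]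
  note D = cnormedD[OF cnormed_dual[OF N]]
  fix e :: real assume e: "e > 0"
  obtain S where S: "finite S" "S \<subseteq> vecs Y"
    and small: "\<forall>\<phi>\<in>closed_unit_ball (dual Y). (\<forall>y\<in>S. cmod (\<phi> y) \<le> 1) \<longrightarrow> cmod (F \<phi>) \<le> e"
    using cont[OF e] by (elim exE conjE)
  define q where "q \<phi> = e * (\<Sum>y\<in>S. cmod (\<phi> y))" for \<phi> :: "'a \<Rightarrow> complex"
  define p where "p \<phi> = e * vnorm (dual Y) \<phi>" for \<phi>
  have q: "seminorm_on (vecs (dual Y)) q" and p: "seminorm_on (vecs (dual Y)) p"
    unfolding q_def p_def using e by (intro seminorm_scale seminorm_sum_cmod D(2); simp)+
  have "cmod (F \<phi>) \<le> p \<phi> + q \<phi>" if \<phi>: "\<phi> \<in> vecs (dual Y)" for \<phi>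
  proof -
    define t where "t = vnorm (dual Y) \<phi> + (\<Sum>y\<in>S. cmod (\<phi> y))"
    have nn: "0 \<le> vnorm (dual Y) \<phi>" "0 \<le> (\<Sum>y\<in>S. cmod (\<phi> y))"
      using dual_norm_nonneg[OF N \<phi>] by (auto simp: sum_nonneg)
    show ?thesis
    proof (cases "t = 0")
      case True
      then have "vnorm (dual Y) \<phi> = 0" using nn by (simp add: t_def)
      then have "\<phi> = 0" using D(3)[OF \<phi>] by simp
      then show ?thesis
        using clin_diff_zero(2)[OF F D(1)] seminorm_diff(1)[OF p D(1)] seminorm_diff(1)[OF q D(1)] by simp
    next
      case False
      then have t: "t > 0" using nn by (simp add: t_def)
      let ?\<psi> = "(1 / t) *\<^sub>r \<phi>"
      have "?\<psi> \<in> closed_unit_ball (dual Y)"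
        using \<phi> D(1) t nn seminormD(3)[OF D(2) \<phi>, of "1/t"]
        by (auto simp: closed_unit_ball_def norm_divide) (simp add: t_def)
      moreover have "cmod (?\<psi> y) \<le> 1" if "y \<in> S" for y
      proof -
        have "cmod (\<phi> y) \<le> (\<Sum>y\<in>S. cmod (\<phi> y))" using S that by (intro member_le_sum) auto
        then show ?thesis using t nn by (simp add: norm_divide norm_mult divide_simps) (simp add: t_def)
      qed
      ultimately have "cmod (F ?\<psi>) \<le> e" using small by simp
      moreover have "cmod (F ?\<psi>) = cmod (F \<phi>) / t"
        unfolding clinD(2)[OF F \<phi>] using t by (simp add: norm_mult norm_divide)
      ultimately have "cmod (F \<phi>) \<le> e * t" using t by (simp add: pos_divide_le_eq)
      then show ?thesis by (simp add: p_def q_def t_def algebra_simps)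
    qed
  qed
  then obtain G where G: "clin (vecs (dual Y)) G" "\<And>\<phi>. \<phi> \<in> vecs (dual Y) \<Longrightarrow> cmod (G \<phi>) \<le> q \<phi>"
    "\<And>\<phi>. \<phi> \<in> vecs (dual Y) \<Longrightarrow> cmod (F \<phi> - G \<phi>) \<le> p \<phi>"
    using Hahn_Banach_decomposition[OF D(1) D(1) order_refl q p F] by (metis add.commute)
  have "\<exists>a. \<forall>\<phi>\<in>vecs (dual Y). G \<phi> = (\<Sum>y\<in>S. a y * \<phi> y)"
  proof (rule clin_finite_combination[OF S(1) D(1) _ G(1)])
    show "clin (vecs (dual Y)) (\<lambda>\<phi>. \<phi> y)" for y by (simp add: clin_def)
    show "G \<phi> = 0" if "\<phi> \<in> vecs (dual Y)" "\<And>y. y \<in> S \<Longrightarrow> \<phi> y = 0" for \<phi>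
      using G(2)[OF that(1)] that by (simp add: q_def)
  qed
  then obtain a where a: "\<And>\<phi>. \<phi> \<in> vecs (dual Y) \<Longrightarrow> G \<phi> = (\<Sum>y\<in>S. a y * \<phi> y)" by blast
  let ?y = "\<Sum>y\<in>S. a y *\<^sub>C y"
  have y: "?y \<in> vecs Y" using S(2) cnormedD(1)[OF N] by (intro complex_vector.subspace_sum) auto
  have eq: "G \<phi> = \<phi> ?y" if "\<phi> \<in> vecs (dual Y)" for \<phi>
    unfolding a[OF that] using S(2) cnormedD(1)[OF N]
    by (subst clin_sum[OF dualD(1)[OF that]]) (auto simp: subset_iff clinD(2)[OF dualD(1)[OF that]])
  show "\<exists>y\<in>vecs Y. \<forall>\<phi>\<in>vecs (dual Y). cmod (F \<phi> - \<phi> y) \<le> e * vnorm (dual Y) \<phi>"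
  proof (rule bexI[OF ballI y])
    fix \<phi> assume \<phi>: "\<phi> \<in> vecs (dual Y)"
    show "cmod (F \<phi> - \<phi> ?y) \<le> e * vnorm (dual Y) \<phi>"
      using G(3)[OF \<phi>] unfolding eq[OF \<phi>] p_def .
  qed
qed

section \<open>Bounded operators and holomorphic Lipschitz maps\<close>
lemma bounded_opsD:
  assumes "T \<in> bounded_ops V W"
  shows "x \<in> vecs V \<Longrightarrow> T x \<in> vecs W" "x \<notin> vecs V \<Longrightarrow> T x = 0"
    "x \<in> vecs V \<Longrightarrow> y \<in> vecs V \<Longrightarrow> T (x + y) = T x + T y"
    "x \<in> vecs V \<Longrightarrow> T (a *\<^sub>C x) = a *\<^sub>C T x"
  using assms by (simp_all add: bounded_ops_def)

lemma bounded_ops_bound: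
  assumes "cnormed V" "T \<in> bounded_ops V W"
  obtains K where "K > 0" "\<And>x. x \<in> vecs V \<Longrightarrow> vnorm W (T x) \<le> K * vnorm V x"
proof -
  obtain K where K: "\<forall>x\<in>vecs V. vnorm W (T x) \<le> K * vnorm V x"
    using assms(2) unfolding bounded_ops_def by blast
  have "vnorm W (T x) \<le> (\<bar>K\<bar> + 1) * vnorm V x" if x: "x \<in> vecs V" for x
    using K[rule_format, OF x] mult_right_mono[of K "\<bar>K\<bar> + 1" "vnorm V x"]
      seminormD(1)[OF cnormedD(2)[OF assms(1)] x] by linarith
  then show ?thesis using that[of "\<bar>K\<bar> + 1"] by simp
qed

lemma bounded_opsI:
  assumes "\<And>x. x \<in> vecs V \<Longrightarrow> T x \<in> vecs W" "\<And>x. x \<notin> vecs V \<Longrightarrow> T x = 0"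
    "\<And>x y. x \<in> vecs V \<Longrightarrow> y \<in> vecs V \<Longrightarrow> T (x + y) = T x + T y"
    "\<And>a x. x \<in> vecs V \<Longrightarrow> T (a *\<^sub>C x) = a *\<^sub>C T x"
    "\<And>x. x \<in> vecs V \<Longrightarrow> vnorm W (T x) \<le> K * vnorm V x"
  shows "T \<in> bounded_ops V W"
  using assms unfolding bounded_ops_def by (intro CollectI conjI ballI allI impI exI[of _ K]) simp_all

lemma bounded_ops_diff_zero:
  assumes "cnormed V" "T \<in> bounded_ops V W"
  shows "T 0 = 0" "x \<in> vecs V \<Longrightarrow> y \<in> vecs V \<Longrightarrow> T (x - y) = T x - T y"
proof -
  note [simp] = cnormedD(1)[OF assms(1)]
  have neg: "T (- x) = - T x" if "x \<in> vecs V" for x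
    using bounded_opsD(4)[OF assms(2) that, of "-1"] by simp
  show "T 0 = 0" using bounded_opsD(4)[OF assms(2), of 0 0] by simp
  show "T (x - y) = T x - T y" if "x \<in> vecs V" "y \<in> vecs V"
    using bounded_opsD(3)[OF assms(2), of x "- y"] that neg[of y] by simp
qed

lemma bounded_ops_compose:
  assumes "cnormed V" "cnormed W" "S \<in> bounded_ops V W" "T \<in> bounded_ops W Z"
  shows "T \<circ> S \<in> bounded_ops V Z"
proof -
  obtain K where K: "K > 0" "\<And>x. x \<in> vecs V \<Longrightarrow> vnorm W (S x) \<le> K * vnorm V x"
    using bounded_ops_bound[OF assms(1,3)] by blast
  obtain M where M: "M > 0" "\<And>x. x \<in> vecs W \<Longrightarrow> vnorm Z (T x) \<le> M * vnorm W x"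
    using bounded_ops_bound[OF assms(2,4)] by blast
  note S = bounded_opsD[OF assms(3)] and T = bounded_opsD[OF assms(4)]
  show ?thesis
  proof (rule bounded_opsI)
    fix x assume x: "x \<in> vecs V"
    have "vnorm Z (T (S x)) \<le> M * vnorm W (S x)" by (rule M(2)[OF S(1)[OF x]])
    also have "\<dots> \<le> M * (K * vnorm V x)" using M(1) K(2)[OF x] by (intro mult_left_mono) auto
    finally show "vnorm Z ((T \<circ> S) x) \<le> (M * K) * vnorm V x" by (simp add: mult.assoc)
  qed (simp_all add: S T bounded_ops_diff_zero(1)[OF assms(2,4)])
qed

lemma bounded_ops_add_scale:
  assumes "cnormed V" "cnormed W" "S \<in> bounded_ops V W" "T \<in> bounded_ops V W"
  shows "S + T \<in> bounded_ops V W" "a *\<^sub>C S \<in> bounded_ops V W"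
proof -
  obtain K where K: "K > 0" "\<And>x. x \<in> vecs V \<Longrightarrow> vnorm W (S x) \<le> K * vnorm V x"
    using bounded_ops_bound[OF assms(1,3)] by blast
  obtain M where M: "M > 0" "\<And>x. x \<in> vecs V \<Longrightarrow> vnorm W (T x) \<le> M * vnorm V x"
    using bounded_ops_bound[OF assms(1,4)] by blast
  note S = bounded_opsD[OF assms(3)] and T = bounded_opsD[OF assms(4)]
    and W = cnormedD(1)[OF assms(2)]
  show "S + T \<in> bounded_ops V W"
  proof (rule bounded_opsI)
    fix x assume x: "x \<in> vecs V"
    have "vnorm W (S x + T x) \<le> vnorm W (S x) + vnorm W (T x)"
      by (rule seminormD(2)[OF cnormedD(2)[OF assms(2)] S(1)[OF x] T(1)[OF x]])
    then show "vnorm W ((S + T) x) \<le> (K + M) * vnorm V x"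
      using K(2)[OF x] M(2)[OF x] by (simp add: distrib_right)
  qed (simp_all add: S T W scaleC_add_right)
  show "a *\<^sub>C S \<in> bounded_ops V W"
  proof (rule bounded_opsI)
    fix x assume x: "x \<in> vecs V"
    show "vnorm W ((a *\<^sub>C S) x) \<le> (cmod a * K) * vnorm V x"
      using mult_left_mono[OF K(2)[OF x], of "cmod a"] seminormD(3)[OF cnormedD(2)[OF assms(2)] S(1)[OF x], of a]
      by (simp add: mult.assoc)
  qed (simp_all add: S T W scaleC_add_right mult.commute)
qed

lemma dual_eq_bounded_ops: "vecs (dual V) = bounded_ops V scalars"
  by (simp add: dual_def)

lemma cnormed_scalars: "cnormed scalars"
  by (auto simp: cnormed_def norm_mult norm_triangle_ineq)

text \<open>
  The limit in the definition of holomorphy written without division and with weak inequalities, so that \<^term>\<open>x = a\<close> needs no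
  exception.
\<close>
definition has_deriv_on_ball ::
    "'a::complex_vector cspace \<Rightarrow> 'b::complex_vector cspace \<Rightarrow> ('a \<Rightarrow> 'b) \<Rightarrow> 'a \<Rightarrow> ('a \<Rightarrow> 'b) \<Rightarrow> bool" where
  "has_deriv_on_ball X Y f a D \<longleftrightarrow> D \<in> bounded_ops X Y \<and>
     (\<forall>e>0. \<exists>d>0. \<forall>x\<in>vecs X. vnorm X (x - a) < d \<longrightarrow>
        vnorm Y (f x - f a - D (x - a)) \<le> e * vnorm X (x - a))"

lemma has_derivD:
  assumes "has_deriv_on_ball X Y f a D" "e > 0"
  obtains d where "d > 0"
    "\<And>x. x \<in> vecs X \<Longrightarrow> vnorm X (x - a) < d \<Longrightarrow> vnorm Y (f x - f a - D (x - a)) \<le> e * vnorm X (x - a)"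
  using assms unfolding has_deriv_on_ball_def by blast

lemma has_deriv_iff_tendsto:
  assumes X: "cnormed X" and Y: "cnormed Y" and f: "\<And>x. f x \<in> vecs Y" and a: "a \<in> vecs X"
    and D: "D \<in> bounded_ops X Y"
  shows "((\<lambda>x. vnorm Y (f x - f a - D (x - a)) / vnorm X (x - a)) \<longlongrightarrow> 0) (atin (norm_topology X) a)
     \<longleftrightarrow> has_deriv_on_ball X Y f a D" (is "(?q \<longlongrightarrow> 0) ?F \<longleftrightarrow> _")
proof -
  note M = Metric_space_cnormed[OF X]
  note nX = seminormD(1)[OF cnormedD(2)[OF X]] and nY = seminormD(1)[OF cnormedD(2)[OF Y]]
  note [simp] = cnormedD(1)[OF X] cnormedD(1)[OF Y] f a
  have ev: "eventually P ?F \<longleftrightarrow> (\<exists>d>0. \<forall>x\<in>vecs X. x \<noteq> a \<longrightarrow> vnorm X (x - a) < d \<longrightarrow> P x)" for P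
    unfolding norm_topology_def Metric_space.eventually_atin_metric[OF M]
    using nX cnormedD(3)[OF X] by (simp add: ndist_def) (metis a cnormedD(1) csub_diff eq_iff_diff_eq_0 less_le X)
  have num: "0 \<le> vnorm Y (f x - f a - D (x - a))" if "x \<in> vecs X" for x
    using that bounded_opsD(1)[OF D] by (intro nY) simp
  have D0: "D 0 = 0" by (rule bounded_ops_diff_zero(1)[OF X D])
  have Y0: "vnorm Y 0 = 0" using seminorm_diff(1)[OF cnormedD(2,1)[OF Y]] .
  have X0: "vnorm X 0 = 0" using seminorm_diff(1)[OF cnormedD(2,1)[OF X]] .
  have q: "\<bar>?q x\<bar> = ?q x" "?q x \<le> e \<longleftrightarrow> vnorm Y (f x - f a - D (x - a)) \<le> e * vnorm X (x - a)"
    if "x \<in> vecs X" "x \<noteq> a" for x e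
  proof -
    have "0 < vnorm X (x - a)"
      using nX[of "x - a"] cnormedD(3)[OF X, of "x - a"] that by (simp add: less_le)
    then show "\<bar>?q x\<bar> = ?q x" "?q x \<le> e \<longleftrightarrow> vnorm Y (f x - f a - D (x - a)) \<le> e * vnorm X (x - a)"
      using num[OF that(1)] by (auto simp: pos_divide_le_eq)
  qed
  show ?thesis
  proof
    assume lim: "(?q \<longlongrightarrow> 0) ?F"
    show "has_deriv_on_ball X Y f a D"
      unfolding has_deriv_on_ball_def
    proof (intro conjI allI impI)
      fix e :: real assume "e > 0"
      then have "eventually (\<lambda>x. dist (?q x) 0 < e) ?F" using lim by (rule tendstoD[rotated])
      then obtain d where d: "d > 0" "\<forall>x\<in>vecs X. x \<noteq> a \<longrightarrow> vnorm X (x - a) < d \<longrightarrow> \<bar>?q x\<bar> < e"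
        unfolding ev dist_real_def by auto
      show "\<exists>d>0. \<forall>x\<in>vecs X. vnorm X (x - a) < d \<longrightarrow> vnorm Y (f x - f a - D (x - a)) \<le> e * vnorm X (x - a)"
      proof (intro exI[of _ d] conjI d(1) ballI impI)
        fix x assume x: "x \<in> vecs X" "vnorm X (x - a) < d"
        show "vnorm Y (f x - f a - D (x - a)) \<le> e * vnorm X (x - a)"
        proof (cases "x = a")
          case True then show ?thesis by (simp add: D0 Y0 X0)
        next
          case False
          then have "\<bar>?q x\<bar> < e" using d(2) x by blast
          then show ?thesis using q[OF x(1) False] by (metis less_imp_le)
        qed
      qed
    qed (rule D)
  next
    assume R: "has_deriv_on_ball X Y f a D"
    show "(?q \<longlongrightarrow> 0) ?F"
    proof (rule tendstoI)
      fix e :: real assume "e > 0"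
      then obtain d where d: "d > 0"
        "\<And>x. x \<in> vecs X \<Longrightarrow> vnorm X (x - a) < d \<Longrightarrow> vnorm Y (f x - f a - D (x - a)) \<le> (e/2) * vnorm X (x - a)"
        using has_derivD[OF R, of "e/2"] by auto
      show "eventually (\<lambda>x. dist (?q x) 0 < e) ?F"
        unfolding ev
      proof (intro exI[of _ d] conjI d(1) ballI impI)
        fix x assume x: "x \<in> vecs X" "x \<noteq> a" "vnorm X (x - a) < d"
        have "?q x \<le> e/2" using q(2)[OF x(1,2)] d(2)[OF x(1,3)] by blast
        then have "\<bar>?q x\<bar> < e" using q(1)[OF x(1,2)] \<open>e > 0\<close> by linarith
        then show "dist (?q x) 0 < e" by (simp add: dist_real_def)
      qed
    qed
  qed
qed

lemma open_ball_subset: "x \<in> open_unit_ball X \<Longrightarrow> x \<in> vecs X"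
  by (simp add: open_unit_ball_def)

lemma ball_diff:
  assumes X: "cnormed X" and xy: "x \<in> open_unit_ball X" "y \<in> open_unit_ball X"
  shows "x - y \<in> vecs X" "0 \<le> vnorm X (x - y)" "x \<noteq> y \<Longrightarrow> 0 < vnorm X (x - y)"
proof -
  show d: "x - y \<in> vecs X" using xy[THEN open_ball_subset] cnormedD(1)[OF X] by simp
  show "0 \<le> vnorm X (x - y)" by (rule seminormD(1)[OF cnormedD(2)[OF X] d])
  then show "0 < vnorm X (x - y)" if "x \<noteq> y" using cnormedD(3)[OF X d] that by (simp add: less_le)
qed

lemma mem_HL0:
  assumes X: "cnormed X" and Y: "cnormed Y"
  shows "f \<in> vecs (HL0 X Y) \<longleftrightarrow>
    (\<forall>x. f x \<in> vecs Y) \<and> (\<forall>x. x \<notin> open_unit_ball X \<longrightarrow> f x = 0) \<and> f 0 = 0 \<and>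
    (\<forall>a\<in>open_unit_ball X. \<exists>D. has_deriv_on_ball X Y f a D) \<and> lipschitz_on_ball X Y f"
proof -
  have Y0: "0 \<in> vecs Y" by (rule csub_0[OF cnormedD(1)[OF Y]])
  have hol: "holomorphic_on_ball X Y f \<longleftrightarrow> (\<forall>a\<in>open_unit_ball X. \<exists>D. has_deriv_on_ball X Y f a D)"
    if f: "\<And>x. f x \<in> vecs Y"
    unfolding holomorphic_on_ball_def
  proof (intro ball_cong refl)
    fix a assume a: "a \<in> open_unit_ball X"
    note iff = has_deriv_iff_tendsto[OF X Y f open_ball_subset[OF a]]
    show "(\<exists>D\<in>bounded_ops X Y. ((\<lambda>x. vnorm Y (f x - f a - D (x - a)) / vnorm X (x - a)) \<longlongrightarrow> 0)
        (atin (norm_topology X) a)) \<longleftrightarrow> (\<exists>D. has_deriv_on_ball X Y f a D)" (is "?l \<longleftrightarrow> ?r")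
    proof
      assume ?l then obtain D where D: "D \<in> bounded_ops X Y"
        "((\<lambda>x. vnorm Y (f x - f a - D (x - a)) / vnorm X (x - a)) \<longlongrightarrow> 0) (atin (norm_topology X) a)"
        by (rule bexE)
      show ?r by (rule exI) (rule iffD1[OF iff[OF D(1)] D(2)])
    next
      assume ?r then obtain D where D: "has_deriv_on_ball X Y f a D" by (rule exE)
      then have D': "D \<in> bounded_ops X Y" by (simp add: has_deriv_on_ball_def)
      show ?l by (rule bexI[OF _ D']) (rule iffD2[OF iff[OF D'] D])
    qed
  qed
  show ?thesis
  proof
    assume f: "f \<in> vecs (HL0 X Y)"
    then have all: "f x \<in> vecs Y" for x
      using Y0 by (cases "x \<in> open_unit_ball X") (simp_all add: HL0_def)
    show "(\<forall>x. f x \<in> vecs Y) \<and> (\<forall>x. x \<notin> open_unit_ball X \<longrightarrow> f x = 0) \<and> f 0 = 0 \<and>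
    (\<forall>a\<in>open_unit_ball X. \<exists>D. has_deriv_on_ball X Y f a D) \<and> lipschitz_on_ball X Y f"
      using f all hol[OF all] by (simp add: HL0_def)
  next
    assume R: "(\<forall>x. f x \<in> vecs Y) \<and> (\<forall>x. x \<notin> open_unit_ball X \<longrightarrow> f x = 0) \<and> f 0 = 0 \<and>
    (\<forall>a\<in>open_unit_ball X. \<exists>D. has_deriv_on_ball X Y f a D) \<and> lipschitz_on_ball X Y f"
    then show "f \<in> vecs (HL0 X Y)" using hol by (simp add: HL0_def)
  qed
qed

lemma HL0D:
  assumes "cnormed X" "cnormed Y" "f \<in> vecs (HL0 X Y)"
  shows "f x \<in> vecs Y" "x \<notin> open_unit_ball X \<Longrightarrow> f x = 0" "f 0 = 0"
    "a \<in> open_unit_ball X \<Longrightarrow> \<exists>D. has_deriv_on_ball X Y f a D"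
  using assms(3) unfolding mem_HL0[OF assms(1,2)] by simp_all

lemma vnorm_HL0: "vnorm (HL0 X Y) = lipschitz_norm X Y"
  by (simp add: HL0_def)

lemma lipschitz_norm_set:
  assumes X: "cnormed X" and Y: "cnormed Y" and f: "f \<in> vecs (HL0 X Y)"
    and B: "B \<ge> 0"
    "\<And>x y. x \<in> open_unit_ball X \<Longrightarrow> y \<in> open_unit_ball X \<Longrightarrow> vnorm Y (f x - f y) \<le> B * vnorm X (x - y)"
    and r: "r \<in> insert 0 {vnorm Y (f x - f y) / vnorm X (x - y) | x y.
       x \<in> open_unit_ball X \<and> y \<in> open_unit_ball X \<and> x \<noteq> y}"
  shows "r \<le> B"
  using r
proof
  assume "r \<in> {vnorm Y (f x - f y) / vnorm X (x - y) | x y.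
       x \<in> open_unit_ball X \<and> y \<in> open_unit_ball X \<and> x \<noteq> y}"
  then obtain x y where xy: "r = vnorm Y (f x - f y) / vnorm X (x - y)"
    "x \<in> open_unit_ball X" "y \<in> open_unit_ball X" "x \<noteq> y" by blast
  have "0 < vnorm X (x - y)" by (rule ball_diff(3)[OF X xy(2,3,4)])
  then show ?thesis using B(2)[OF xy(2,3)] by (simp add: xy(1) pos_divide_le_eq)
qed (use B in simp)

lemma lipschitz_norm_le:
  assumes "cnormed X" "cnormed Y" "f \<in> vecs (HL0 X Y)" "B \<ge> 0"
    "\<And>x y. x \<in> open_unit_ball X \<Longrightarrow> y \<in> open_unit_ball X \<Longrightarrow> vnorm Y (f x - f y) \<le> B * vnorm X (x - y)"
  shows "vnorm (HL0 X Y) f \<le> B"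
  unfolding vnorm_HL0 lipschitz_norm_def
  by (rule cSup_least) (use lipschitz_norm_set[OF assms] in auto)

lemma lipschitz_norm_bound:
  assumes X: "cnormed X" and Y: "cnormed Y" and f: "f \<in> vecs (HL0 X Y)"
  shows "0 \<le> vnorm (HL0 X Y) f"
    "x \<in> open_unit_ball X \<Longrightarrow> y \<in> open_unit_ball X \<Longrightarrow> vnorm Y (f x - f y) \<le> vnorm (HL0 X Y) f * vnorm X (x - y)"
proof -
  let ?S = "insert 0 {vnorm Y (f x - f y) / vnorm X (x - y) | x y.
       x \<in> open_unit_ball X \<and> y \<in> open_unit_ball X \<and> x \<noteq> y}"
  obtain K where K: "\<And>x y. x \<in> open_unit_ball X \<Longrightarrow> y \<in> open_unit_ball X \<Longrightarrow> vnorm Y (f x - f y) \<le> K * vnorm X (x - y)"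
    using f unfolding mem_HL0[OF X Y] lipschitz_on_ball_def by blast
  have K': "vnorm Y (f x - f y) \<le> \<bar>K\<bar> * vnorm X (x - y)" if "x \<in> open_unit_ball X" "y \<in> open_unit_ball X" for x y
    using K[OF that] mult_right_mono[OF abs_ge_self[of K] ball_diff(2)[OF X that]] by linarith
  have bdd: "bdd_above ?S"
    by (rule bdd_aboveI[of _ "\<bar>K\<bar>"]) (use lipschitz_norm_set[OF X Y f abs_ge_zero K'] in blast)
  show "0 \<le> vnorm (HL0 X Y) f"
    unfolding vnorm_HL0 lipschitz_norm_def by (rule cSup_upper[OF insertI1 bdd])
  show "vnorm Y (f x - f y) \<le> vnorm (HL0 X Y) f * vnorm X (x - y)"
    if xy: "x \<in> open_unit_ball X" "y \<in> open_unit_ball X"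
  proof (cases "x = y")
    case True
    then show ?thesis
      using seminorm_diff(1)[OF cnormedD(2,1)[OF X]] seminorm_diff(1)[OF cnormedD(2,1)[OF Y]] by simp
  next
    case False
    have pos: "0 < vnorm X (x - y)" by (rule ball_diff(3)[OF X xy False])
    have "vnorm Y (f x - f y) / vnorm X (x - y) \<in> ?S" using xy False by blast
    then have "vnorm Y (f x - f y) / vnorm X (x - y) \<le> vnorm (HL0 X Y) f"
      unfolding vnorm_HL0 lipschitz_norm_def by (rule cSup_upper[OF _ bdd])
    then show ?thesis using pos by (simp add: pos_divide_le_eq)
  qed
qed

lemma norm_HL0_value:
  assumes X: "cnormed X" and Y: "cnormed Y" and f: "f \<in> vecs (HL0 X Y)" and x: "x \<in> open_unit_ball X"
  shows "vnorm Y (f x) \<le> vnorm (HL0 X Y) f * vnorm X x"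
  using lipschitz_norm_bound(2)[OF X Y f x zero_in_ball(2)[OF X]] HL0D(3)[OF X Y f] by simp

lemma has_deriv_compose:
  assumes X: "cnormed X" and Y: "cnormed Y" and T: "T \<in> bounded_ops Y W"
    and f: "\<And>x. f x \<in> vecs Y" and a: "a \<in> open_unit_ball X" and D: "has_deriv_on_ball X Y f a D"
    and K: "K \<ge> 0" "\<And>y. y \<in> vecs Y \<Longrightarrow> vnorm W (T y) \<le> K * vnorm Y y"
  shows "has_deriv_on_ball X W (T \<circ> f) a (T \<circ> D)"
proof -
  note T0 = bounded_ops_diff_zero[OF Y T]
  have D': "D \<in> bounded_ops X Y" using D by (simp add: has_deriv_on_ball_def)
  show ?thesis
    unfolding has_deriv_on_ball_def
  proof (intro conjI allI impI bounded_ops_compose[OF X Y D' T])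
    fix e :: real assume e: "e > 0"
    then obtain d where d: "d > 0"
      "\<And>x. x \<in> vecs X \<Longrightarrow> vnorm X (x - a) < d \<Longrightarrow> vnorm Y (f x - f a - D (x - a)) \<le> (e / (K + 1)) * vnorm X (x - a)"
      using has_derivD[OF D, of "e / (K + 1)"] K(1) by auto
    show "\<exists>d>0. \<forall>x\<in>vecs X. vnorm X (x - a) < d \<longrightarrow>
        vnorm W ((T \<circ> f) x - (T \<circ> f) a - (T \<circ> D) (x - a)) \<le> e * vnorm X (x - a)"
    proof (intro exI[of _ d] conjI d(1) ballI impI)
      fix x assume x: "x \<in> vecs X" "vnorm X (x - a) < d"
      have xa: "x - a \<in> vecs X" using x open_ball_subset[OF a] cnormedD(1)[OF X] by simp
      have Dm: "D (x - a) \<in> vecs Y" by (rule bounded_opsD(1)[OF D' xa])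
      have m: "f x - f a \<in> vecs Y" "f x - f a - D (x - a) \<in> vecs Y" using f Dm cnormedD(1)[OF Y] by simp_all
      have "(T \<circ> f) x - (T \<circ> f) a - (T \<circ> D) (x - a) = T (f x - f a - D (x - a))"
        using T0(2)[OF m(1) Dm] T0(2)[OF f[of x] f[of a]] by simp
      moreover have "vnorm W (T (f x - f a - D (x - a))) \<le> K * vnorm Y (f x - f a - D (x - a))"
        by (rule K(2)[OF m(2)])
      moreover have "\<dots> \<le> K * ((e / (K + 1)) * vnorm X (x - a))"
        by (rule mult_left_mono[OF d(2)[OF x] K(1)])
      moreover have "\<dots> \<le> e * vnorm X (x - a)"
        using K(1) e seminormD(1)[OF cnormedD(2)[OF X] xa] by (simp add: field_simps)
      ultimately show "vnorm W ((T \<circ> f) x - (T \<circ> f) a - (T \<circ> D) (x - a)) \<le> e * vnorm X (x - a)" by simp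
    qed
  qed
qed

lemma HL0_compose:
  assumes X: "cnormed X" and Y: "cnormed Y" and W: "cnormed W"
    and f: "f \<in> vecs (HL0 X Y)" and T: "T \<in> bounded_ops Y W"
    and K: "K \<ge> 0" "\<And>y. y \<in> vecs Y \<Longrightarrow> vnorm W (T y) \<le> K * vnorm Y y"
  shows "T \<circ> f \<in> vecs (HL0 X W)" "vnorm (HL0 X W) (T \<circ> f) \<le> K * vnorm (HL0 X Y) f"
proof -
  note fD = HL0D[OF X Y f] and TD = bounded_opsD[OF T] and T0 = bounded_ops_diff_zero[OF Y T]
  have lip: "vnorm W ((T \<circ> f) x - (T \<circ> f) y) \<le> (K * vnorm (HL0 X Y) f) * vnorm X (x - y)"
    if xy: "x \<in> open_unit_ball X" "y \<in> open_unit_ball X" for x y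
  proof -
    have d: "f x - f y \<in> vecs Y" using fD(1) cnormedD(1)[OF Y] by simp
    have "(T \<circ> f) x - (T \<circ> f) y = T (f x - f y)" using T0(2)[OF fD(1) fD(1)] by simp
    moreover have "vnorm W (T (f x - f y)) \<le> K * vnorm Y (f x - f y)" by (rule K(2)[OF d])
    moreover have "\<dots> \<le> K * (vnorm (HL0 X Y) f * vnorm X (x - y))"
      by (rule mult_left_mono[OF lipschitz_norm_bound(2)[OF X Y f xy] K(1)])
    ultimately show ?thesis by (simp add: mult.assoc)
  qed
  have der: "\<exists>D. has_deriv_on_ball X W (T \<circ> f) a D" if a: "a \<in> open_unit_ball X" for a
  proof -
    obtain D where D: "has_deriv_on_ball X Y f a D" using fD(4)[OF a] by (rule exE)
    have "has_deriv_on_ball X W (T \<circ> f) a (T \<circ> D)"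
      by (rule has_deriv_compose[OF X Y T fD(1) a D K])
    then show ?thesis by (intro exI[of _ "T \<circ> D"])
  qed
  show mem: "T \<circ> f \<in> vecs (HL0 X W)"
    unfolding mem_HL0[OF X W] lipschitz_on_ball_def
  proof (intro conjI allI impI ballI der)
    show "\<exists>K. \<forall>x\<in>open_unit_ball X. \<forall>y\<in>open_unit_ball X. vnorm W ((T \<circ> f) x - (T \<circ> f) y) \<le> K * vnorm X (x - y)"
      using lip by (intro exI ballI)
  qed (simp_all add: TD(1) fD T0(1))
  show "vnorm (HL0 X W) (T \<circ> f) \<le> K * vnorm (HL0 X Y) f"
    by (rule lipschitz_norm_le[OF X W mem _ lip]) (simp add: K(1) lipschitz_norm_bound(1)[OF X Y f])
qed

lemma cnormed_HL0:
  assumes X: "cnormed X" and Y: "cnormed Y"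
  shows "cnormed (HL0 X Y)"
proof (rule cnormedI)
  note nX = seminormD(1)[OF cnormedD(2)[OF X]] and sY = cnormedD(1)[OF Y] and nY = cnormedD(2)[OF Y]
  let ?H = "HL0 X Y"
  have zero: "0 \<in> vecs ?H"
  proof -
    have Y0: "vnorm Y 0 = 0" by (rule seminorm_diff(1)[OF nY sY])
    have "0 \<in> bounded_ops X Y" by (rule bounded_opsI[of _ _ _ 0]) (simp_all add: sY Y0)
    moreover have "vnorm Y (0 x - 0 a - 0 (x - a)) \<le> e * vnorm X (x - a)"
      if "a \<in> open_unit_ball X" "e > 0" "x \<in> vecs X" for a x e
      using that open_ball_subset[OF that(1)] nX cnormedD(1)[OF X] by (simp add: Y0)
    ultimately have der: "has_deriv_on_ball X Y 0 a 0" if "a \<in> open_unit_ball X" for a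
      unfolding has_deriv_on_ball_def using that zero_less_one by blast
    have "vnorm Y (0 x - 0 y) \<le> 0 * vnorm X (x - y)" for x y by (simp add: Y0)
    then have "lipschitz_on_ball X Y 0" unfolding lipschitz_on_ball_def by blast
    then show ?thesis using der unfolding mem_HL0[OF X Y] by (auto simp: sY)
  qed
  have add: "f + g \<in> vecs ?H" "vnorm ?H (f + g) \<le> vnorm ?H f + vnorm ?H g"
    if f: "f \<in> vecs ?H" and g: "g \<in> vecs ?H" for f g
  proof -
    note fD = HL0D[OF X Y f] and gD = HL0D[OF X Y g]
    have lip: "vnorm Y ((f + g) x - (f + g) y) \<le> (vnorm ?H f + vnorm ?H g) * vnorm X (x - y)"
      if xy: "x \<in> open_unit_ball X" "y \<in> open_unit_ball X" for x y
    proof -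
      have eq: "(f + g) x - (f + g) y = (f x - f y) + (g x - g y)" by simp
      have "vnorm Y ((f + g) x - (f + g) y) \<le> vnorm Y (f x - f y) + vnorm Y (g x - g y)"
        unfolding eq by (rule seminormD(2)[OF nY]) (simp_all add: fD(1) gD(1) sY)
      then show ?thesis
        using lipschitz_norm_bound(2)[OF X Y f xy] lipschitz_norm_bound(2)[OF X Y g xy] by (simp add: distrib_right)
    qed
    have der: "\<exists>D. has_deriv_on_ball X Y (f + g) a D" if a: "a \<in> open_unit_ball X" for a
    proof -
      obtain D where D: "has_deriv_on_ball X Y f a D" using fD(4)[OF a] by (rule exE)
      then have D': "D \<in> bounded_ops X Y" by (simp add: has_deriv_on_ball_def)
      obtain E where E: "has_deriv_on_ball X Y g a E" using gD(4)[OF a] by (rule exE)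
      then have E': "E \<in> bounded_ops X Y" by (simp add: has_deriv_on_ball_def)
      have "has_deriv_on_ball X Y (f + g) a (D + E)"
        unfolding has_deriv_on_ball_def
      proof (intro conjI allI impI bounded_ops_add_scale(1)[OF X Y D' E'])
        fix e :: real assume e: "e > 0"
        then have e2: "e / 2 > 0" by simp
        obtain d where d: "d > 0"
          "\<And>x. x \<in> vecs X \<Longrightarrow> vnorm X (x - a) < d \<Longrightarrow> vnorm Y (f x - f a - D (x - a)) \<le> (e / 2) * vnorm X (x - a)"
          using has_derivD[OF D e2] by blast
        obtain d' where d': "d' > 0"
          "\<And>x. x \<in> vecs X \<Longrightarrow> vnorm X (x - a) < d' \<Longrightarrow> vnorm Y (g x - g a - E (x - a)) \<le> (e / 2) * vnorm X (x - a)"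
          using has_derivD[OF E e2] by blast
        show "\<exists>d>0. \<forall>x\<in>vecs X. vnorm X (x - a) < d \<longrightarrow>
            vnorm Y ((f + g) x - (f + g) a - (D + E) (x - a)) \<le> e * vnorm X (x - a)"
        proof (intro exI[of _ "min d d'"] conjI ballI impI)
          show "min d d' > 0" using d d' by simp
          fix x assume x: "x \<in> vecs X" "vnorm X (x - a) < min d d'"
          have xa: "x - a \<in> vecs X" using x open_ball_subset[OF a] cnormedD(1)[OF X] by simp
          note Dm = bounded_opsD(1)[OF D' xa] bounded_opsD(1)[OF E' xa]
          have eq: "(f + g) x - (f + g) a - (D + E) (x - a) = (f x - f a - D (x - a)) + (g x - g a - E (x - a))"
            by simp
          have "vnorm Y ((f + g) x - (f + g) a - (D + E) (x - a))
            \<le> vnorm Y (f x - f a - D (x - a)) + vnorm Y (g x - g a - E (x - a))"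
            unfolding eq by (rule seminormD(2)[OF nY]) (simp_all add: fD(1) gD(1) sY Dm)
          then show "vnorm Y ((f + g) x - (f + g) a - (D + E) (x - a)) \<le> e * vnorm X (x - a)"
            using d(2)[OF x(1)] d'(2)[OF x(1)] x(2) by simp
        qed
      qed
      then show ?thesis by (intro exI[of _ "D + E"])
    qed
    show mem: "f + g \<in> vecs ?H"
      unfolding mem_HL0[OF X Y] lipschitz_on_ball_def
    proof (intro conjI allI impI ballI der)
      show "\<exists>K. \<forall>x\<in>open_unit_ball X. \<forall>y\<in>open_unit_ball X. vnorm Y ((f + g) x - (f + g) y) \<le> K * vnorm X (x - y)"
        using lip by (intro exI ballI)
    qed (simp_all add: fD gD sY)
    show "vnorm ?H (f + g) \<le> vnorm ?H f + vnorm ?H g"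
      by (rule lipschitz_norm_le[OF X Y mem _ lip])
         (simp add: lipschitz_norm_bound(1)[OF X Y f] lipschitz_norm_bound(1)[OF X Y g])
  qed
  have sc: "a *\<^sub>C f \<in> vecs ?H" "vnorm ?H (a *\<^sub>C f) \<le> cmod a * vnorm ?H f" if f: "f \<in> vecs ?H" for f a
  proof -
    define T where "T = (\<lambda>y. if y \<in> vecs Y then a *\<^sub>C y else 0)"
    have T: "T \<in> bounded_ops Y Y" and K: "\<And>y. y \<in> vecs Y \<Longrightarrow> vnorm Y (T y) \<le> cmod a * vnorm Y y"
    proof -
      show K: "vnorm Y (T y) \<le> cmod a * vnorm Y y" if "y \<in> vecs Y" for y
        using that seminormD(3)[OF nY that] by (simp add: T_def)
      show "T \<in> bounded_ops Y Y"
        by (rule bounded_opsI[OF _ _ _ _ K]) (simp_all add: T_def sY scaleC_add_right mult.commute)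
    qed
    have "T \<circ> f = a *\<^sub>C f" using HL0D(1)[OF X Y f] by (simp add: fun_eq_iff T_def)
    then show "a *\<^sub>C f \<in> vecs ?H" "vnorm ?H (a *\<^sub>C f) \<le> cmod a * vnorm ?H f"
      using HL0_compose[OF X Y Y f T norm_ge_zero K] by simp_all
  qed
  show sub: "csubspace (vecs ?H)"
    unfolding complex_vector.subspace_def using add sc zero by simp
  show "seminorm_on (vecs ?H) (vnorm ?H)"
    by (rule seminorm_onI, rule lipschitz_norm_bound(1)[OF X Y], assumption, rule add(2), assumption+, rule sub, rule sc(2))
  show "f = 0" if f: "f \<in> vecs ?H" "vnorm ?H f = 0" for f
  proof
    fix x show "f x = 0 x"
    proof (cases "x \<in> open_unit_ball X")
      case True
      have "vnorm Y (f x) \<le> 0" using norm_HL0_value[OF X Y f(1) True] f(2) by simp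
      then show ?thesis
        using seminormD(1)[OF nY HL0D(1)[OF X Y f(1)], of x] cnormedD(3)[OF Y HL0D(1)[OF X Y f(1)], of x] by simp
    next
      case False then show ?thesis using HL0D(2)[OF X Y f(1)] by simp
    qed
  qed
qed

section \<open>The interpolation space of Davis, Figiel, Johnson and Pelczynski\<close>
lemma bidual_embedding_mem:
  assumes V: "cnormed V" and x: "x \<in> vecs V"
  shows "bidual_embedding V x \<in> vecs (dual (dual V))"
proof (rule dualI)
  note sD = cnormedD(1)[OF cnormed_dual[OF V]]
  show "clin (vecs (dual V)) (bidual_embedding V x)"
    unfolding clin_def
  proof (intro conjI ballI allI)
    fix \<phi> assume \<phi>: "\<phi> \<in> vecs (dual V)"
    show "bidual_embedding V x (a *\<^sub>C \<phi>) = a * bidual_embedding V x \<phi>" for a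
      using csub_scale[OF sD \<phi>, of a] \<phi> by (simp add: bidual_embedding_def)
    show "bidual_embedding V x (\<phi> + \<psi>) = bidual_embedding V x \<phi> + bidual_embedding V x \<psi>"
      if \<psi>: "\<psi> \<in> vecs (dual V)" for \<psi>
      using csub_add[OF sD \<phi> \<psi>] \<phi> \<psi> by (simp add: bidual_embedding_def)
  qed
  show "cmod (bidual_embedding V x \<phi>) \<le> vnorm V x * vnorm (dual V) \<phi>" if "\<phi> \<in> vecs (dual V)" for \<phi>
    using dual_bound[OF V that x] that by (simp add: bidual_embedding_def mult.commute)
qed (simp add: bidual_embedding_def)

text \<open>
  The gauges weigh \<^term>\<open>K\<close> by \<open>(1/2)\<^sup>n\<close> and the norm of \<^term>\<open>Y\<close> by \<open>2\<^sup>n\<close>, and the norm below is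
  their \<open>\<ell>\<^sup>2\<close>-sum. Elements of \<^term>\<open>K\<close> have summable gauges. Each single gauge is at most a multiple of the norm of \<^term>\<open>Y\<close>, so
  properties of finite partial sums are inherited from \<^term>\<open>Y\<close>; the norm is written as the supremum of these sums.
\<close>
definition interp_gauge :: "'a::complex_vector cspace \<Rightarrow> 'a set \<Rightarrow> nat \<Rightarrow> 'a \<Rightarrow> real" where
  "interp_gauge Y K n = gauge_conv (vnorm Y) K ((1/2) ^ n) (2 ^ n)"

definition partial_norm :: "'a::complex_vector cspace \<Rightarrow> 'a set \<Rightarrow> 'a \<Rightarrow> nat set \<Rightarrow> real" where
  "partial_norm Y K v A = L2_set (\<lambda>i. interp_gauge Y K i v) A"

definition interp_space :: "'a::complex_vector cspace \<Rightarrow> 'a set \<Rightarrow> 'a cspace" where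
  "interp_space Y K =
     \<lparr>vecs = {v \<in> vecs Y. bdd_above (range (\<lambda>n. partial_norm Y K v {..<n}))},
      vnorm = \<lambda>v. SUP n. partial_norm Y K v {..<n}\<rparr>"

lemma norm_approx_attained:
  assumes V: "cnormed V" and \<psi>: "\<psi> \<in> vecs (dual V)" and d: "d > 0"
  obtains z where "z \<in> vecs V" "vnorm V z \<le> 1" "\<psi> z \<in> \<real>" "vnorm (dual V) \<psi> - d \<le> Re (\<psi> z)"
proof -
  have "vnorm (dual V) \<psi> - d < (SUP x\<in>closed_unit_ball V. cmod (\<psi> x))"
    using d by (simp add: vnorm_dual)
  then obtain x where x: "x \<in> closed_unit_ball V" "vnorm (dual V) \<psi> - d < cmod (\<psi> x)"
    using less_cSUP_iff[OF _ dual_bdd[OF V \<psi>]] zero_in_ball(1)[OF V] by blast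
  then have xV: "x \<in> vecs V" "vnorm V x \<le> 1" by (simp_all add: closed_unit_ball_def)
  obtain c where c: "c * \<psi> x = complex_of_real (cmod (\<psi> x))" and c1: "cmod c \<le> 1" by (rule rotate_to_norm)
  have \<psi>c: "\<psi> (c *\<^sub>C x) = complex_of_real (cmod (\<psi> x))"
    unfolding clinD(2)[OF dualD(1)[OF \<psi>] xV(1)] by (rule c)
  show ?thesis
  proof (rule that[of "c *\<^sub>C x"])
    show "c *\<^sub>C x \<in> vecs V" using xV cnormedD(1)[OF V] by simp
    have "cmod c * vnorm V x \<le> 1 * 1"
      using c1 xV seminormD(1)[OF cnormedD(2)[OF V] xV(1)] by (intro mult_mono) auto
    then show "vnorm V (c *\<^sub>C x) \<le> 1" by (simp add: seminormD(3)[OF cnormedD(2)[OF V] xV(1)])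
  qed (use x in \<open>simp_all add: \<psi>c\<close>)
qed

context
  fixes Y :: "'a::complex_vector cspace" and K :: "'a set" and M :: real
  assumes Y: "cnormed Y" and K: "absconvex K" and KY: "K \<subseteq> vecs Y"
    and M: "\<forall>k\<in>K. vnorm Y k \<le> M"
begin

private abbreviation (input) "G \<equiv> interp_gauge Y K"
private abbreviation (input) "N \<equiv> partial_norm Y K"
private abbreviation (input) "Z \<equiv> interp_space Y K"

private lemmas subY = cnormedD(1)[OF Y] and normY = cnormedD(2)[OF Y]
private lemmas gauge_facts = subY normY KY K

lemma gauge_pos: "0 \<le> (1/2 :: real) ^ n" "0 \<le> (2 :: real) ^ n"
  by simp_all

lemma interp_gauge_seminorm: "seminorm_on (vecs Y) (G n)"
  unfolding interp_gauge_def by (rule gauge_conv_seminorm[OF gauge_facts gauge_pos])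

lemma interp_gauge_le_norm: "v \<in> vecs Y \<Longrightarrow> G n v \<le> 2 ^ n * vnorm Y v"
  unfolding interp_gauge_def by (rule gauge_conv_le_norm[OF gauge_facts gauge_pos])

lemma interp_gauge_le_on_set: "k \<in> K \<Longrightarrow> G n k \<le> (1/2) ^ n"
  unfolding interp_gauge_def by (rule gauge_conv_le_on_set[OF gauge_facts gauge_pos])

lemma norm_le_interp_gauge:
  assumes v: "v \<in> vecs Y" shows "vnorm Y v \<le> max M 1 * G 0 v"
proof -
  have "vnorm Y v / max M 1 \<le> G 0 v"
    unfolding interp_gauge_def
  proof (rule gauge_conv_ge[OF gauge_facts gauge_pos])
    fix s :: real and k assume s: "s \<ge> 0" and k: "k \<in> K"
    have kY: "s *\<^sub>r k \<in> vecs Y" "k \<in> vecs Y" using k KY subY by auto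
    have "vnorm Y ((v - s *\<^sub>r k) + s *\<^sub>r k) \<le> vnorm Y (v - s *\<^sub>r k) + vnorm Y (s *\<^sub>r k)"
      using v kY subY by (intro seminormD(2)[OF normY]) auto
    then have "vnorm Y v \<le> vnorm Y (v - s *\<^sub>r k) + s * vnorm Y k"
      using seminormD(3)[OF normY kY(2), of "complex_of_real s"] s by simp
    also have "\<dots> \<le> max M 1 * vnorm Y (v - s *\<^sub>r k) + s * max M 1"
    proof (rule add_mono)
      show "vnorm Y (v - s *\<^sub>r k) \<le> max M 1 * vnorm Y (v - s *\<^sub>r k)"
        using mult_right_mono[of 1 "max M 1" "vnorm Y (v - s *\<^sub>r k)"] seminormD(1)[OF normY, of "v - s *\<^sub>r k"] v kY subY by simp
      show "s * vnorm Y k \<le> s * max M 1" using M[rule_format, OF k] s by (intro mult_left_mono) auto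
    qed
    also have "\<dots> = (s + vnorm Y (v - s *\<^sub>r k)) * max M 1" by (simp add: algebra_simps)
    finally have "vnorm Y v / max M 1 \<le> s + vnorm Y (v - s *\<^sub>r k)" by (subst pos_divide_le_eq) simp_all
    then show "vnorm Y v / max M 1 \<le> (1/2) ^ 0 * s + 2 ^ 0 * vnorm Y (v - s *\<^sub>r k)" by simp
  qed
  then show ?thesis by (simp add: pos_divide_le_eq mult.commute)
qed

lemma interp_gauge_nonneg: "v \<in> vecs Y \<Longrightarrow> 0 \<le> G n v"
  by (rule seminormD(1)[OF interp_gauge_seminorm])

lemma partial_norm_nonneg: "0 \<le> N v A"
  by (simp add: partial_norm_def)

lemma partial_norm_triangle:
  assumes "x \<in> vecs Y" "y \<in> vecs Y" shows "N (x + y) A \<le> N x A + N y A"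
proof -
  have "N (x + y) A \<le> L2_set (\<lambda>i. G i x + G i y) A"
    unfolding partial_norm_def
    by (rule L2_set_mono) (use assms subY seminormD(2)[OF interp_gauge_seminorm] in \<open>auto intro: interp_gauge_nonneg\<close>)
  also have "\<dots> \<le> N x A + N y A" unfolding partial_norm_def by (rule L2_set_triangle_ineq)
  finally show ?thesis .
qed

lemma partial_norm_scale: "x \<in> vecs Y \<Longrightarrow> N (a *\<^sub>C x) A = cmod a * N x A"
  unfolding partial_norm_def
  by (simp add: seminormD(3)[OF interp_gauge_seminorm] L2_set_right_distrib)

lemma partial_norm_mono: "finite B \<Longrightarrow> A \<subseteq> B \<Longrightarrow> N v A \<le> N v B"
  unfolding partial_norm_def L2_set_def by (intro real_sqrt_le_mono sum_mono2) auto

lemma partial_norm_le: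
  assumes v: "v \<in> vecs Y" shows "N v {..<n} \<le> 2 ^ n * vnorm Y v"
proof -
  have "N v {..<n} \<le> (\<Sum>i<n. G i v)"
    unfolding partial_norm_def by (rule L2_set_le_sum) (rule interp_gauge_nonneg[OF v])
  also have "\<dots> \<le> (\<Sum>i<n. 2 ^ i * vnorm Y v)" by (intro sum_mono interp_gauge_le_norm v)
  also have "\<dots> = (\<Sum>i<n. 2 ^ i) * vnorm Y v" by (simp add: sum_distrib_right)
  also have "(\<Sum>i<n. 2 ^ i) = (2 ^ n - 1 :: real)" by (induction n) auto
  also have "(2 ^ n - 1) * vnorm Y v \<le> 2 ^ n * vnorm Y v"
    by (intro mult_right_mono seminormD(1)[OF normY v]) simp
  finally show ?thesis .
qed

lemma interp_spaceD:
  assumes "v \<in> vecs Z"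
  shows "v \<in> vecs Y" "N v {..<n} \<le> vnorm Z v"
  using assms by (auto simp: interp_space_def intro!: cSUP_upper)

lemma interp_spaceI:
  assumes "v \<in> vecs Y" "\<And>n. N v {..<n} \<le> B"
  shows "v \<in> vecs Z" "vnorm Z v \<le> B"
  using assms by (auto simp: interp_space_def intro!: bdd_aboveI2 cSUP_least)

lemma interp_norm_nonneg: "v \<in> vecs Z \<Longrightarrow> 0 \<le> vnorm Z v"
  using interp_spaceD(2)[of v 0] partial_norm_nonneg[of v "{..<0}"] by linarith

lemma norm_le_interp_norm:
  assumes v: "v \<in> vecs Z" shows "vnorm Y v \<le> max M 1 * vnorm Z v"
proof -
  have "G 0 v = N v {..<1}"
    using interp_gauge_nonneg[OF interp_spaceD(1)[OF v], of 0] by (simp add: partial_norm_def lessThan_Suc)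
  then have "G 0 v \<le> vnorm Z v" using interp_spaceD(2)[OF v, of 1] by simp
  then have "max M 1 * G 0 v \<le> max M 1 * vnorm Z v" by (intro mult_left_mono) auto
  then show ?thesis using norm_le_interp_gauge[OF interp_spaceD(1)[OF v]] by linarith
qed

lemma cnormed_interp_space: "cnormed Z"
proof (rule cnormedI)
  have add: "x + y \<in> vecs Z" "vnorm Z (x + y) \<le> vnorm Z x + vnorm Z y" if "x \<in> vecs Z" "y \<in> vecs Z" for x y
  proof -
    have b: "N (x + y) {..<n} \<le> vnorm Z x + vnorm Z y" for n
      using partial_norm_triangle[OF interp_spaceD(1)[OF that(1)] interp_spaceD(1)[OF that(2)], of "{..<n}"]
        interp_spaceD(2)[OF that(1), of n] interp_spaceD(2)[OF that(2), of n] by linarith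
    have "x + y \<in> vecs Y" using interp_spaceD(1) that subY by simp
    then show "x + y \<in> vecs Z" "vnorm Z (x + y) \<le> vnorm Z x + vnorm Z y"
      by (rule interp_spaceI[OF _ b])+
  qed
  have sc: "a *\<^sub>C x \<in> vecs Z" "vnorm Z (a *\<^sub>C x) \<le> cmod a * vnorm Z x" if "x \<in> vecs Z" for x a
  proof -
    have b: "N (a *\<^sub>C x) {..<n} \<le> cmod a * vnorm Z x" for n
      unfolding partial_norm_scale[OF interp_spaceD(1)[OF that]]
      by (intro mult_left_mono interp_spaceD(2)[OF that]) simp
    show "a *\<^sub>C x \<in> vecs Z" "vnorm Z (a *\<^sub>C x) \<le> cmod a * vnorm Z x"
      by (rule interp_spaceI[OF csub_scale[OF subY interp_spaceD(1)[OF that]] b])+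
  qed
  have zero: "0 \<in> vecs Z"
    by (rule interp_spaceI(1)[where B = 0])
       (use subY partial_norm_scale[of 0 0] csub_0[OF subY] in auto)
  show sub: "csubspace (vecs Z)" unfolding complex_vector.subspace_def using add sc zero by blast
  show "seminorm_on (vecs Z) (vnorm Z)"
    by (rule seminorm_onI, rule interp_norm_nonneg, assumption, rule add(2), assumption+, rule sub, rule sc(2))
  show "x = 0" if "x \<in> vecs Z" "vnorm Z x = 0" for x
    using norm_le_interp_norm[OF that(1)] that(2) seminormD(1)[OF normY interp_spaceD(1)[OF that(1)]]
      cnormedD(3)[OF Y interp_spaceD(1)[OF that(1)]] by simp
qed

text \<open>
  The interpolation norm is a supremum of partial sums that are continuous for the norm of \<^term>\<open>Y\<close>, hence its balls are
  closed in \<^term>\<open>Y\<close>. Completeness follows from this, and so does the fact that points outside the space can be separated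
  from its balls by functionals on \<^term>\<open>Y\<close>.
\<close>
lemma interp_ball_closed:
  assumes v: "v \<in> vecs Y" and approx: "\<And>e. e > 0 \<Longrightarrow> \<exists>z\<in>vecs Z. vnorm Z z \<le> r \<and> vnorm Y (v - z) < e"
  shows "v \<in> vecs Z" "vnorm Z v \<le> r"
proof -
  have b: "N v {..<n} \<le> r" for n
  proof (rule field_le_epsilon)
    fix e :: real assume e: "e > 0"
    then obtain z where z: "z \<in> vecs Z" "vnorm Z z \<le> r" "vnorm Y (v - z) < e / 2 ^ n"
      using approx[of "e / 2 ^ n"] by auto
    note zY = interp_spaceD(1)[OF z(1)]
    have vz: "v - z \<in> vecs Y" using v zY subY by simp
    have "N v {..<n} \<le> N z {..<n} + N (v - z) {..<n}"
      using partial_norm_triangle[OF zY vz, of "{..<n}"] by simp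
    also have "N z {..<n} \<le> r" using interp_spaceD(2)[OF z(1), of n] z(2) by linarith
    also have "N (v - z) {..<n} \<le> 2 ^ n * vnorm Y (v - z)" by (rule partial_norm_le[OF vz])
    also have "\<dots> \<le> e" using z(3) by (simp add: field_simps)
    finally show "N v {..<n} \<le> r + e" by simp
  qed
  show "v \<in> vecs Z" "vnorm Z v \<le> r" by (rule interp_spaceI[OF v b])+
qed

lemma set_in_interp_ball:
  assumes k: "k \<in> K" shows "k \<in> vecs Z" "vnorm Z k \<le> 2"
proof -
  have kY: "k \<in> vecs Y" using k KY by auto
  have b: "N k {..<n} \<le> 2" for n
  proof -
    have "N k {..<n} \<le> (\<Sum>i<n. G i k)"
      unfolding partial_norm_def by (rule L2_set_le_sum) (rule interp_gauge_nonneg[OF kY])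
    also have "\<dots> \<le> (\<Sum>i<n. (1/2) ^ i)" by (intro sum_mono interp_gauge_le_on_set k)
    also have "\<dots> = 2 - 2 * (1/2) ^ n" by (induction n) auto
    also have "\<dots> \<le> 2" by simp
    finally show ?thesis .
  qed
  show "k \<in> vecs Z" "vnorm Z k \<le> 2" by (rule interp_spaceI[OF kY b])+
qed

lemma cbanach_interp_space:
  assumes B: "cbanach Y" shows "cbanach Z"
  unfolding cbanach_iff
proof (intro conjI cnormed_interp_space allI impI)
  note sZ = cnormedD(1)[OF cnormed_interp_space] and nZ = cnormedD(2)[OF cnormed_interp_space]
  fix \<sigma> :: "nat \<Rightarrow> 'a"
  assume "(\<forall>n. \<sigma> n \<in> vecs Z) \<and> (\<forall>e>0. \<exists>N. \<forall>m\<ge>N. \<forall>n\<ge>N. vnorm Z (\<sigma> m - \<sigma> n) < e)"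
  then have \<sigma>: "\<And>n. \<sigma> n \<in> vecs Z" and C: "\<And>e. e > 0 \<Longrightarrow> \<exists>N. \<forall>m\<ge>N. \<forall>n\<ge>N. vnorm Z (\<sigma> m - \<sigma> n) < e"
    by blast+
  let ?c = "max M 1"
  have dZ: "\<sigma> m - \<sigma> n \<in> vecs Z" for m n using \<sigma> sZ by simp
  have \<sigma>Y: "\<sigma> n \<in> vecs Y" for n by (rule interp_spaceD(1)[OF \<sigma>])
  have "\<exists>N. \<forall>m\<ge>N. \<forall>n\<ge>N. vnorm Y (\<sigma> m - \<sigma> n) < e" if e: "e > 0" for e
  proof -
    obtain N where N: "\<forall>m\<ge>N. \<forall>n\<ge>N. vnorm Z (\<sigma> m - \<sigma> n) < e / ?c" using C[of "e / ?c"] e by auto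
    have "vnorm Y (\<sigma> m - \<sigma> n) < e" if "m \<ge> N" "n \<ge> N" for m n
    proof -
      have "?c * vnorm Z (\<sigma> m - \<sigma> n) < e" using N that by (simp add: pos_less_divide_eq mult.commute)
      then show ?thesis using norm_le_interp_norm[OF dZ, of m n] by linarith
    qed
    then show ?thesis by blast
  qed
  then obtain l where l: "l \<in> vecs Y" "\<And>e. e > 0 \<Longrightarrow> \<exists>N. \<forall>n\<ge>N. vnorm Y (\<sigma> n - l) < e"
    using B \<sigma>Y unfolding cbanach_iff by blast
  have close: "\<exists>N. \<forall>n\<ge>N. \<sigma> n - l \<in> vecs Z \<and> vnorm Z (\<sigma> n - l) < e" if e: "e > 0" for e
  proof -
    obtain N where N: "\<forall>m\<ge>N. \<forall>n\<ge>N. vnorm Z (\<sigma> m - \<sigma> n) < e / 2" using C[of "e / 2"] e by auto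
    have "\<sigma> n - l \<in> vecs Z \<and> vnorm Z (\<sigma> n - l) < e" if n: "n \<ge> N" for n
    proof -
      have "\<exists>z\<in>vecs Z. vnorm Z z \<le> e / 2 \<and> vnorm Y ((\<sigma> n - l) - z) < d" if d: "d > 0" for d
      proof -
        obtain N' where N': "\<forall>n\<ge>N'. vnorm Y (\<sigma> n - l) < d" using l(2)[OF d] by blast
        let ?m = "max N N'"
        have "vnorm Z (\<sigma> n - \<sigma> ?m) \<le> e / 2" using N n by (simp add: less_imp_le)
        moreover have "vnorm Y ((\<sigma> n - l) - (\<sigma> n - \<sigma> ?m)) < d" using N' by simp
        ultimately show ?thesis using dZ by blast
      qed
      then have "\<sigma> n - l \<in> vecs Z" "vnorm Z (\<sigma> n - l) \<le> e / 2"
        using interp_ball_closed[of "\<sigma> n - l" "e / 2"] \<sigma>Y l(1) subY by simp_all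
      then show ?thesis using e by simp
    qed
    then show ?thesis by blast
  qed
  obtain n where "\<sigma> n - l \<in> vecs Z" using close[of 1] by auto
  then have "\<sigma> n - (\<sigma> n - l) \<in> vecs Z" by (rule csub_diff[OF sZ \<sigma>])
  then have "l \<in> vecs Z" by simp
  then show "\<exists>l\<in>vecs Z. \<forall>e>0. \<exists>N. \<forall>n\<ge>N. vnorm Z (\<sigma> n - l) < e"
    using close by (intro bexI[of _ l]) blast+
qed

lemma partial_norm_split:
  assumes "n \<le> m" shows "(N v {..<m})\<^sup>2 = (N v {..<n})\<^sup>2 + (N v {n..<m})\<^sup>2"
proof -
  have sq: "(N v A)\<^sup>2 = (\<Sum>i\<in>A. (G i v)\<^sup>2)" for A
    unfolding partial_norm_def L2_set_def by (simp add: sum_nonneg)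
  have "{..<m} = {..<n} \<union> {n..<m}" using assms by auto
  then show ?thesis unfolding sq by (simp add: sum.union_disjoint ivl_disj_int)
qed

lemma interp_tail:
  assumes z: "z \<in> vecs Z" and d: "d > 0"
  obtains n where "\<And>m. N z {n..<m} \<le> d"
proof -
  have sq: "(N z A)\<^sup>2 = (\<Sum>i\<in>A. (G i z)\<^sup>2)" for A
    unfolding partial_norm_def L2_set_def by (simp add: sum_nonneg)
  have "summable (\<lambda>i. (G i z)\<^sup>2)"
  proof (rule summableI_nonneg_bounded)
    fix n show "(\<Sum>i<n. (G i z)\<^sup>2) \<le> (vnorm Z z)\<^sup>2"
      unfolding sq[symmetric] by (rule power_mono[OF interp_spaceD(2)[OF z] partial_norm_nonneg])
  qed simp
  then obtain n where n: "\<forall>m\<ge>n. \<forall>k. norm (\<Sum>i = m..<k. (G i z)\<^sup>2) < d\<^sup>2"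
    unfolding summable_Cauchy using d zero_less_power by blast
  have "N z {n..<m} \<le> d" for m
  proof -
    have "(N z {n..<m})\<^sup>2 \<le> d\<^sup>2"
      unfolding sq using n[rule_format, of n m] by (simp add: sum_nonneg)
    then show ?thesis by (rule power2_le_imp_le[OF _ less_imp_le[OF d]])
  qed
  then show ?thesis by (rule that)
qed

text \<open>
  This is where the \<open>\<ell>\<^sup>2\<close>-sum matters. If \<^term>\<open>z\<close> is small in \<^term>\<open>Y\<close>, its first \<^term>\<open>n\<close> coordinates are negligible, and for
  \<^term>\<open>z0\<close> the coordinates from \<^term>\<open>n\<close> on are. Hence \<^term>\<open>z0\<close> and \<^term>\<open>z\<close> are almost orthogonal, and adding \<^term>\<open>t *\<^sub>r z\<close>
  increases the norm only by a quantity of order \<^term>\<open>t\<^sup>2\<close>.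
\<close>
lemma interp_norm_perturb:
  assumes z0: "z0 \<in> vecs Z" "vnorm Z z0 \<le> 1" and t: "0 < t" "t \<le> 1"
  obtains n where "\<And>z. z \<in> vecs Z \<Longrightarrow> vnorm Z z \<le> 1 \<Longrightarrow> 2 ^ n * vnorm Y z \<le> t\<^sup>2 \<Longrightarrow>
    vnorm Z (z0 + t *\<^sub>r z) \<le> 1 + 4 * t\<^sup>2"
proof -
  have "t\<^sup>2 > 0" using t by simp
  then obtain n where n: "\<And>m. N z0 {n..<m} \<le> t\<^sup>2" using interp_tail[OF z0(1)] by blast
  note z0Y = interp_spaceD(1)[OF z0(1)]
  show ?thesis
  proof (rule that)
    fix z assume z: "z \<in> vecs Z" "vnorm Z z \<le> 1" "2 ^ n * vnorm Y z \<le> t\<^sup>2"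
    note zY = interp_spaceD(1)[OF z(1)]
    let ?w = "z0 + t *\<^sub>r z"
    have tz: "t *\<^sub>r z \<in> vecs Y" using zY subY by simp
    have tri: "N ?w A \<le> N z0 A + t * N z A" for A
      using partial_norm_triangle[OF z0Y tz, of A] partial_norm_scale[OF zY, of "complex_of_real t" A] t by simp
    have large: "N ?w {..<m} \<le> 1 + 4 * t\<^sup>2" if m: "n \<le> m" for m
    proof -
      have "N ?w {..<n} \<le> 1 + t * t\<^sup>2"
      proof -
        have "N z {..<n} \<le> t\<^sup>2" using partial_norm_le[OF zY, of n] z(3) by linarith
        then have "t * N z {..<n} \<le> t * t\<^sup>2" using t by (intro mult_left_mono) auto
        moreover have "N z0 {..<n} \<le> 1" using interp_spaceD(2)[OF z0(1), of n] z0(2) by linarith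
        ultimately show ?thesis using tri[of "{..<n}"] by linarith
      qed
      then have h: "(N ?w {..<n})\<^sup>2 \<le> (1 + t * t\<^sup>2)\<^sup>2" by (rule power_mono[OF _ partial_norm_nonneg])
      have "N ?w {n..<m} \<le> t\<^sup>2 + t"
      proof -
        have "N z {n..<m} \<le> N z {..<m}" by (rule partial_norm_mono) auto
        then have "N z {n..<m} \<le> 1" using interp_spaceD(2)[OF z(1), of m] z(2) by linarith
        then have "t * N z {n..<m} \<le> t * 1" using t by (intro mult_left_mono) auto
        then show ?thesis using tri[of "{n..<m}"] n[of m] by linarith
      qed
      then have l: "(N ?w {n..<m})\<^sup>2 \<le> (t\<^sup>2 + t)\<^sup>2" by (rule power_mono[OF _ partial_norm_nonneg])
      have t3: "t ^ 3 \<le> t\<^sup>2" "t ^ 4 \<le> t\<^sup>2" "t ^ 6 \<le> t\<^sup>2" using t by (auto intro: power_decreasing)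
      have "(N ?w {..<m})\<^sup>2 \<le> (1 + t * t\<^sup>2)\<^sup>2 + (t\<^sup>2 + t)\<^sup>2"
        unfolding partial_norm_split[OF m] using h l by linarith
      also have "\<dots> = 1 + 2 * t ^ 3 + t ^ 6 + t ^ 4 + 2 * t ^ 3 + t\<^sup>2" by algebra
      also have "\<dots> \<le> 1 + 8 * t\<^sup>2" using t3 zero_le_power2[of t] by linarith
      also have "\<dots> \<le> 1 + 8 * t\<^sup>2 + 16 * t ^ 4" by simp
      also have "\<dots> = (1 + 4 * t\<^sup>2)\<^sup>2" by algebra
      finally show ?thesis by (rule power2_le_imp_le) simp
    qed
    have b: "N ?w {..<m} \<le> 1 + 4 * t\<^sup>2" for m
      using partial_norm_mono[of "{..<max n m}" "{..<m}" ?w] large[of "max n m"] by auto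
    show "vnorm Z ?w \<le> 1 + 4 * t\<^sup>2" by (rule interp_spaceI(2)[OF csub_add[OF subY z0Y tz] b])
  qed
qed

section \<open>Reflexivity of the interpolation space\<close>
private lemmas cZ = cnormed_interp_space
private lemmas sZ = cnormedD(1)[OF cZ] and nZ = cnormedD(2)[OF cZ]

text \<open>
  Choose \<^term>\<open>z0\<close> almost norming for \<^term>\<open>\<psi>\<close>. If \<^term>\<open>z\<close> lies in the unit ball and is small in \<^term>\<open>Y\<close>, then
  \<^term>\<open>\<psi> (z0 + t *\<^sub>r z)\<close> grows linearly in \<^term>\<open>t\<close> with slope \<^term>\<open>\<psi> z\<close> but is bounded by a norm that grows only
  quadratically, so \<^term>\<open>\<psi> z\<close> is small. This expresses that \<^term>\<open>\<psi>\<close> is almost continuous for the norm of \<^term>\<open>Y\<close>.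
\<close>
lemma interp_dual_bound:
  assumes \<psi>: "\<psi> \<in> vecs (dual Z)" and e: "e > 0"
  obtains C where "C \<ge> 0" "\<And>z. z \<in> vecs Z \<Longrightarrow> cmod (\<psi> z) \<le> C * vnorm Y z + e * vnorm Z z"
proof -
  define a where "a = vnorm (dual Z) \<psi>"
  have a0: "a \<ge> 0" unfolding a_def by (rule dual_norm_nonneg[OF cZ \<psi>])
  note lin = dualD(1)[OF \<psi>]
  have bound: "cmod (\<psi> z) \<le> a * vnorm Z z" if "z \<in> vecs Z" for z
    unfolding a_def by (rule dual_bound[OF cZ \<psi> that])
  \<comment> \<open>The perturbation estimate will give \<open>\<bar>\<psi> z\<bar> \<le> 5 a t\<close>.\<close>
  define t where "t = min 1 (e / (5 * a + 1))"
  have t: "0 < t" "t \<le> 1" using e a0 by (simp_all add: t_def)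
  have "5 * a * t \<le> 5 * a * (e / (5 * a + 1))" using a0 by (intro mult_left_mono) (auto simp: t_def)
  also have "\<dots> \<le> e" using a0 e by (simp add: field_simps)
  finally have ate: "5 * a * t \<le> e" .
  have at2: "a * t\<^sup>2 + a * 4 * t\<^sup>2 = t * (5 * a * t)" by algebra
  show ?thesis
  proof (cases "a = 0")
    case True
    show ?thesis
    proof (rule that[of 0])
      fix z assume z: "z \<in> vecs Z"
      have "cmod (\<psi> z) \<le> 0" using bound[OF z] True by simp
      also have "0 \<le> e * vnorm Z z" using e seminormD(1)[OF nZ z] by simp
      finally show "cmod (\<psi> z) \<le> 0 * vnorm Y z + e * vnorm Z z" by simp
    qed simp
  next
    case False
    then have a: "a > 0" using a0 by simp
    then have "a * t\<^sup>2 > 0" using t by simp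
    then obtain z0 where z0: "z0 \<in> vecs Z" "vnorm Z z0 \<le> 1" and "\<psi> z0 \<in> \<real>" and z0a: "a - a * t\<^sup>2 \<le> Re (\<psi> z0)"
      using norm_approx_attained[OF cZ \<psi>, of "a * t\<^sup>2"] unfolding a_def by blast
    obtain n where n: "\<And>z. z \<in> vecs Z \<Longrightarrow> vnorm Z z \<le> 1 \<Longrightarrow> 2 ^ n * vnorm Y z \<le> t\<^sup>2 \<Longrightarrow>
        vnorm Z (z0 + t *\<^sub>r z) \<le> 1 + 4 * t\<^sup>2"
      using interp_norm_perturb[OF z0 t] by blast
    have small: "Re (\<psi> z) \<le> e" if z: "z \<in> vecs Z" "vnorm Z z \<le> 1" "2 ^ n * vnorm Y z \<le> t\<^sup>2" for z
    proof -
      have tz: "t *\<^sub>r z \<in> vecs Z" using z(1) sZ by simp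
      have "\<psi> (z0 + t *\<^sub>r z) = \<psi> z0 + t * \<psi> z"
        by (simp only: clinD(1)[OF lin z0(1) tz] clinD(2)[OF lin z(1)])
      then have "Re (\<psi> z0) + t * Re (\<psi> z) = Re (\<psi> (z0 + t *\<^sub>r z))" by simp
      also have "\<dots> \<le> cmod (\<psi> (z0 + t *\<^sub>r z))" by (rule complex_Re_le_cmod)
      also have "\<dots> \<le> a * vnorm Z (z0 + t *\<^sub>r z)"
        by (rule bound[OF csub_add[OF sZ z0(1) tz]])
      also have "\<dots> \<le> a * (1 + 4 * t\<^sup>2)" by (rule mult_left_mono[OF n[OF z] a0])
      finally have "t * Re (\<psi> z) \<le> a * t\<^sup>2 + a * 4 * t\<^sup>2" using z0a by (simp add: algebra_simps)
      then have "Re (\<psi> z) \<le> 5 * a * t" unfolding at2 using t by simp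
      then show ?thesis using ate by simp
    qed
    define C where "C = a * (2 ^ n / t\<^sup>2)"
    have C0: "C \<ge> 0" using a0 by (simp add: C_def)
    have real_bound: "Re (\<psi> z) \<le> C * vnorm Y z + e * vnorm Z z" if z: "z \<in> vecs Z" for z
    proof (cases "vnorm Z z = 0")
      case True
      then show ?thesis
        using bound[OF z] complex_Re_le_cmod[of "\<psi> z"] mult_nonneg_nonneg[OF C0 seminormD(1)[OF normY interp_spaceD(1)[OF z]]]
        by simp
    next
      case False
      then have \<rho>: "vnorm Z z > 0" using seminormD(1)[OF nZ z] by simp
      show ?thesis
      proof (cases "2 ^ n * vnorm Y z \<le> t\<^sup>2 * vnorm Z z")
        case True
        let ?z = "(1 / vnorm Z z) *\<^sub>r z"
        note zY = interp_spaceD(1)[OF z]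
        have 1: "?z \<in> vecs Z" using z sZ by simp
        have 2: "vnorm Z ?z \<le> 1" using \<rho> by (simp add: seminormD(3)[OF nZ z] norm_divide)
        have 3: "2 ^ n * vnorm Y ?z \<le> t\<^sup>2"
          using True \<rho> by (simp add: seminormD(3)[OF normY zY] norm_divide pos_divide_le_eq)
        have "Re (\<psi> ?z) = Re (\<psi> z) / vnorm Z z" unfolding clinD(2)[OF lin z] by simp
        then have "Re (\<psi> z) \<le> e * vnorm Z z" using small[OF 1 2 3] \<rho> by (simp add: pos_divide_le_eq)
        then show ?thesis using mult_nonneg_nonneg[OF C0 seminormD(1)[OF normY zY]] by simp
      next
        case False
        then have "vnorm Z z \<le> 2 ^ n * vnorm Y z / t\<^sup>2" using t by (simp add: pos_le_divide_eq mult.commute)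
        then have "a * vnorm Z z \<le> C * vnorm Y z"
          using mult_left_mono[OF _ a0, of "vnorm Z z" "2 ^ n * vnorm Y z / t\<^sup>2"] by (simp add: C_def)
        then show ?thesis
          using bound[OF z] complex_Re_le_cmod[of "\<psi> z"] mult_pos_pos[OF e \<rho>] by simp
      qed
    qed
    have "seminorm_on (vecs Z) (vnorm Y)"
      by (rule seminorm_subset[OF normY]) (use interp_spaceD(1) in blast)
    then have p: "seminorm_on (vecs Z) (\<lambda>z. C * vnorm Y z + e * vnorm Z z)"
      using C0 e nZ by (intro seminorm_add seminorm_scale) auto
    show ?thesis
    proof (rule that[OF C0])
      show "cmod (\<psi> z) \<le> C * vnorm Y z + e * vnorm Z z" if z: "z \<in> vecs Z" for z
        using Re_bound_imp_cmod_bound[OF sZ lin p real_bound z] .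
    qed
  qed
qed

private definition restr :: "('a \<Rightarrow> complex) \<Rightarrow> 'a \<Rightarrow> complex" where
  "restr \<phi> = (\<lambda>z. if z \<in> vecs Z then \<phi> z else 0)"

lemma restr_mem: assumes \<phi>: "\<phi> \<in> vecs (dual Y)" shows "restr \<phi> \<in> vecs (dual Z)"
  unfolding restr_def
proof (rule dual_restrict[OF cZ])
  show "clin (vecs Z) \<phi>"
    by (rule clin_subset[OF dualD(1)[OF \<phi>]]) (use interp_spaceD(1) in blast)
  fix z assume z: "z \<in> vecs Z"
  have "cmod (\<phi> z) \<le> vnorm (dual Y) \<phi> * vnorm Y z" by (rule dual_bound[OF Y \<phi> interp_spaceD(1)[OF z]])
  also have "\<dots> \<le> vnorm (dual Y) \<phi> * (max M 1 * vnorm Z z)"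
    by (rule mult_left_mono[OF norm_le_interp_norm[OF z] dual_norm_nonneg[OF Y \<phi>]])
  finally show "cmod (\<phi> z) \<le> (vnorm (dual Y) \<phi> * max M 1) * vnorm Z z" by (simp add: mult.assoc)
qed

text \<open>
  Splitting \<^term>\<open>\<psi>\<close> according to the preceding bound shows that the functionals on \<^term>\<open>Y\<close> are norm dense in the dual of the
  interpolation space; an element of the bidual is therefore determined by its values on restrictions.
\<close>
lemma restr_dense:
  assumes \<psi>: "\<psi> \<in> vecs (dual Z)" and e: "e > 0"
  obtains \<phi> where "\<phi> \<in> vecs (dual Y)" "\<And>z. z \<in> vecs Z \<Longrightarrow> cmod (\<psi> z - \<phi> z) \<le> e * vnorm Z z"
proof -
  obtain C where C: "C \<ge> 0" "\<And>z. z \<in> vecs Z \<Longrightarrow> cmod (\<psi> z) \<le> C * vnorm Y z + e * vnorm Z z"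
    using interp_dual_bound[OF \<psi> e] by blast
  have ZY: "vecs Z \<subseteq> vecs Y" using interp_spaceD(1) by blast
  have p: "seminorm_on (vecs Y) (\<lambda>y. C * vnorm Y y)" by (rule seminorm_scale[OF normY C(1)])
  have q: "seminorm_on (vecs Z) (\<lambda>y. e * vnorm Z y)" by (rule seminorm_scale[OF nZ less_imp_le[OF e]])
  obtain \<phi> where \<phi>: "clin (vecs Y) \<phi>" "\<And>v. v \<in> vecs Y \<Longrightarrow> cmod (\<phi> v) \<le> C * vnorm Y v"
    "\<And>z. z \<in> vecs Z \<Longrightarrow> cmod (\<psi> z - \<phi> z) \<le> e * vnorm Z z"
    using Hahn_Banach_decomposition[OF subY sZ ZY p q dualD(1)[OF \<psi>] C(2)] by blast
  show ?thesis
  proof (rule that)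
    show "(\<lambda>y. if y \<in> vecs Y then \<phi> y else 0) \<in> vecs (dual Y)" by (rule dual_restrict[OF Y \<phi>(1,2)])
    show "cmod (\<psi> z - (if z \<in> vecs Y then \<phi> z else 0)) \<le> e * vnorm Z z" if "z \<in> vecs Z" for z
      using \<phi>(3)[OF that] ZY that by (simp add: subset_iff)
  qed
qed

private definition sup_on :: "('a \<Rightarrow> complex) \<Rightarrow> real" where
  "sup_on \<phi> = (SUP k\<in>K. cmod (\<phi> k))"

lemma sup_on_bdd: "\<phi> \<in> vecs (dual Y) \<Longrightarrow> bdd_above ((\<lambda>k. cmod (\<phi> k)) ` K)"
proof (rule bdd_aboveI2)
  fix k assume \<phi>: "\<phi> \<in> vecs (dual Y)" and k: "k \<in> K"
  have "cmod (\<phi> k) \<le> vnorm (dual Y) \<phi> * vnorm Y k" using dual_bound[OF Y \<phi>] k KY by blast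
  also have "\<dots> \<le> vnorm (dual Y) \<phi> * M" by (rule mult_left_mono[OF M[rule_format, OF k] dual_norm_nonneg[OF Y \<phi>]])
  finally show "cmod (\<phi> k) \<le> vnorm (dual Y) \<phi> * M" .
qed

lemma sup_on_upper: "\<phi> \<in> vecs (dual Y) \<Longrightarrow> k \<in> K \<Longrightarrow> cmod (\<phi> k) \<le> sup_on \<phi>"
  unfolding sup_on_def by (rule cSUP_upper[OF _ sup_on_bdd])

lemma sup_on_least: "(\<And>k. k \<in> K \<Longrightarrow> cmod (\<phi> k) \<le> B) \<Longrightarrow> sup_on \<phi> \<le> B"
  unfolding sup_on_def using absconvexD(2)[OF K] by (intro cSUP_least) auto

lemma sup_on_seminorm: "seminorm_on (vecs (dual Y)) sup_on"
proof (rule seminorm_onI[OF _ _ cnormedD(1)[OF cnormed_dual[OF Y]]])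
  show "0 \<le> sup_on \<phi>" if "\<phi> \<in> vecs (dual Y)" for \<phi>
    using sup_on_upper[OF that absconvexD(2)[OF K]] norm_ge_zero order_trans by blast
  show "sup_on (\<phi> + \<psi>) \<le> sup_on \<phi> + sup_on \<psi>" if "\<phi> \<in> vecs (dual Y)" "\<psi> \<in> vecs (dual Y)" for \<phi> \<psi>
  proof (rule sup_on_least)
    fix k assume k: "k \<in> K"
    show "cmod ((\<phi> + \<psi>) k) \<le> sup_on \<phi> + sup_on \<psi>"
      using norm_triangle_ineq[of "\<phi> k" "\<psi> k"] sup_on_upper[OF that(1) k] sup_on_upper[OF that(2) k] by simp
  qed
  show "sup_on (a *\<^sub>C \<phi>) \<le> cmod a * sup_on \<phi>" if "\<phi> \<in> vecs (dual Y)" for a \<phi>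
    by (rule sup_on_least) (simp add: norm_mult mult_left_mono sup_on_upper[OF that])
qed

text \<open>
  The \<^term>\<open>n\<close>-th gauge of a point of the unit ball is less than \<open>2\<close>, so that the unit ball is contained in the sum of
  \<open>2 \<cdot> 2\<^sup>n K\<close> and a ball of radius \<open>2 \<cdot> (1/2)\<^sup>n\<close> in \<^term>\<open>Y\<close>.
\<close>
lemma restr_norm_le:
  assumes \<phi>: "\<phi> \<in> vecs (dual Y)"
  shows "vnorm (dual Z) (restr \<phi>) \<le> 2 * 2 ^ n * sup_on \<phi> + 2 * (1/2) ^ n * vnorm (dual Y) \<phi>"
  unfolding vnorm_dual[of Z]
proof (rule cSUP_least)
  show "closed_unit_ball Z \<noteq> {}" using zero_in_ball(1)[OF cZ] by blast
  fix z assume "z \<in> closed_unit_ball Z"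
  then have z: "z \<in> vecs Z" "vnorm Z z \<le> 1" by (simp_all add: closed_unit_ball_def)
  note zY = interp_spaceD(1)[OF z(1)]
  have "interp_gauge Y K n z \<le> partial_norm Y K z {..<Suc n}"
    unfolding partial_norm_def by (rule member_le_L2_set) auto
  also have "\<dots> \<le> 1" using interp_spaceD(2)[OF z(1), of "Suc n"] z(2) by linarith
  finally have "gauge_conv (vnorm Y) K ((1/2) ^ n) (2 ^ n) z < 2" by (simp add: interp_gauge_def)
  then obtain s k where sk: "s \<ge> 0" "k \<in> K" "(1/2) ^ n * s + 2 ^ n * vnorm Y (z - s *\<^sub>r k) < 2"
    using gauge_conv_less[OF subY normY KY K zero_le_power zero_le_power, of "1/2" 2 n n z 2] by auto
  have kY: "k \<in> vecs Y" "s *\<^sub>r k \<in> vecs Y" using sk(2) KY subY by auto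
  have d: "z - s *\<^sub>r k \<in> vecs Y" using zY kY subY by simp
  have nn: "0 \<le> vnorm Y (z - s *\<^sub>r k)" by (rule seminormD(1)[OF normY d])
  have "(1/2) ^ n * s \<le> 2"
    using sk(3) mult_nonneg_nonneg[OF zero_le_power[of "2::real" n] nn] by simp
  then have s: "s \<le> 2 * 2 ^ n" by (simp add: power_one_over field_simps)
  have "2 ^ n * vnorm Y (z - s *\<^sub>r k) \<le> 2"
    using sk(3) mult_nonneg_nonneg[OF zero_le_power[of "1/2::real" n] sk(1)] by simp
  then have r: "vnorm Y (z - s *\<^sub>r k) \<le> 2 * (1/2) ^ n" by (simp add: power_one_over field_simps)
  have "\<phi> z = s * \<phi> k + \<phi> (z - s *\<^sub>r k)"
    by (simp add: clin_diff_zero(1)[OF dualD(1)[OF \<phi>] subY zY kY(2)] clinD(2)[OF dualD(1)[OF \<phi>] kY(1)])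
  then have "cmod (\<phi> z) \<le> s * cmod (\<phi> k) + cmod (\<phi> (z - s *\<^sub>r k))"
    using norm_triangle_ineq[of "s * \<phi> k" "\<phi> (z - s *\<^sub>r k)"] sk(1) by (simp add: norm_mult)
  also have "s * cmod (\<phi> k) \<le> 2 * 2 ^ n * sup_on \<phi>"
    using s sk(1) sup_on_upper[OF \<phi> sk(2)] by (intro mult_mono) auto
  also have "cmod (\<phi> (z - s *\<^sub>r k)) \<le> vnorm (dual Y) \<phi> * vnorm Y (z - s *\<^sub>r k)" by (rule dual_bound[OF Y \<phi> d])
  also have "\<dots> \<le> vnorm (dual Y) \<phi> * (2 * (1/2) ^ n)" by (rule mult_left_mono[OF r dual_norm_nonneg[OF Y \<phi>]])
  finally show "cmod (restr \<phi> z) \<le> 2 * 2 ^ n * sup_on \<phi> + 2 * (1/2) ^ n * vnorm (dual Y) \<phi>"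
    using z(1) by (simp add: restr_def mult.commute)
qed

text \<open>
  The functional \<^term>\<open>\<phi>\<close> \<open>\<mapsto>\<close> \<^term>\<open>\<Psi> (restr \<phi>)\<close> is dominated by a multiple of the supremum over \<^term>\<open>K\<close> plus an arbitrarily
  small multiple of the dual norm. The part dominated by \<^term>\<open>K\<close> is an evaluation by weak compactness.
\<close>
lemma bidual_restr_evaluation:
  assumes B: "cbanach Y" and Q: "compactin (weak_topology Y) Q" and KQ: "K \<subseteq> Q"
    and \<Psi>: "\<Psi> \<in> vecs (dual (dual Z))"
  shows "\<exists>y\<in>vecs Y. \<forall>\<phi>\<in>vecs (dual Y). \<Psi> (restr \<phi>) = \<phi> y"
proof -
  note cD = cnormed_dual[OF Y] and cZD = cnormed_dual[OF cZ]
  note sD = cnormedD(1)[OF cD] and nD = cnormedD(2)[OF cD]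
  have QY: "Q \<subseteq> vecs Y" using compactin_subset_topspace[OF Q] topspace_weak_topology[OF Y] by simp
  define r where "r = vnorm (dual (dual Z)) \<Psi>"
  have r: "r \<ge> 0" unfolding r_def by (rule dual_norm_nonneg[OF cZD \<Psi>])
  have \<Psi>_bound: "cmod (\<Psi> \<psi>) \<le> r * vnorm (dual Z) \<psi>" if "\<psi> \<in> vecs (dual Z)" for \<psi>
    unfolding r_def by (rule dual_bound[OF cZD \<Psi> that])
  note \<Psi>_lin = dualD(1)[OF \<Psi>]
  define F where "F \<phi> = \<Psi> (restr \<phi>)" for \<phi>
  have F_lin: "clin (vecs (dual Y)) F"
    unfolding clin_def
  proof (intro conjI ballI allI)
    fix \<phi> assume \<phi>: "\<phi> \<in> vecs (dual Y)"
    have "restr (a *\<^sub>C \<phi>) = a *\<^sub>C restr \<phi>" for a by (simp add: fun_eq_iff restr_def)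
    then show "F (a *\<^sub>C \<phi>) = a * F \<phi>" for a
      by (simp add: F_def clinD(2)[OF \<Psi>_lin restr_mem[OF \<phi>]])
    fix \<psi> assume \<psi>: "\<psi> \<in> vecs (dual Y)"
    have "restr (\<phi> + \<psi>) = restr \<phi> + restr \<psi>" by (simp add: fun_eq_iff restr_def)
    then show "F (\<phi> + \<psi>) = F \<phi> + F \<psi>"
      by (simp add: F_def clinD(1)[OF \<Psi>_lin restr_mem[OF \<phi>] restr_mem[OF \<psi>]])
  qed
  have "\<exists>y\<in>vecs Y. \<forall>\<phi>\<in>vecs (dual Y). F \<phi> = \<phi> y"
  proof (rule evaluations_closed[OF B])
    fix e :: real assume e: "e > 0"
    obtain n where n: "(1/2 :: real) ^ n < e / (2 * r + 1)"
      using real_arch_pow_inv[of "e / (2 * r + 1)" "1/2"] e r by auto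
    have "r * (2 * (1/2) ^ n) \<le> (2 * r + 1) * (1/2) ^ n" by (simp add: algebra_simps)
    also have "\<dots> \<le> e" using n r by (simp add: pos_less_divide_eq mult.commute)
    finally have re: "r * (2 * (1/2) ^ n) \<le> e" .
    \<comment> \<open>Adding \<open>1\<close> allows division by \<open>A\<close> when \<open>r = 0\<close>.\<close>
    define A where "A = r * (2 * 2 ^ n) + 1"
    have A: "A > 0" using r by (simp add: A_def add_nonneg_pos)
    note seminorm_scale[OF sup_on_seminorm less_imp_le[OF A]] seminorm_scale[OF nD less_imp_le[OF e]]
    moreover have "cmod (F \<phi>) \<le> A * sup_on \<phi> + e * vnorm (dual Y) \<phi>" if \<phi>: "\<phi> \<in> vecs (dual Y)" for \<phi>
    proof -
      note nn = seminormD(1)[OF sup_on_seminorm \<phi>] dual_norm_nonneg[OF Y \<phi>]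
      have "cmod (F \<phi>) \<le> r * vnorm (dual Z) (restr \<phi>)" unfolding F_def by (rule \<Psi>_bound[OF restr_mem[OF \<phi>]])
      also have "\<dots> \<le> r * (2 * 2 ^ n * sup_on \<phi> + 2 * (1/2) ^ n * vnorm (dual Y) \<phi>)"
        by (rule mult_left_mono[OF restr_norm_le[OF \<phi>] r])
      also have "\<dots> = (r * (2 * 2 ^ n)) * sup_on \<phi> + (r * (2 * (1/2) ^ n)) * vnorm (dual Y) \<phi>"
        by (simp add: algebra_simps)
      also have "\<dots> \<le> A * sup_on \<phi> + e * vnorm (dual Y) \<phi>"
        using nn re by (intro add_mono mult_right_mono) (auto simp: A_def)
      finally show ?thesis .
    qed
    ultimately obtain F1 where F1: "clin (vecs (dual Y)) F1"
      "\<And>\<phi>. \<phi> \<in> vecs (dual Y) \<Longrightarrow> cmod (F1 \<phi>) \<le> A * sup_on \<phi>"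
      "\<And>\<phi>. \<phi> \<in> vecs (dual Y) \<Longrightarrow> cmod (F \<phi> - F1 \<phi>) \<le> e * vnorm (dual Y) \<phi>"
      using Hahn_Banach_decomposition[OF sD sD order_refl _ _ F_lin] by blast
    have "\<exists>y\<in>Q. \<forall>\<phi>\<in>vecs (dual Y). F1 \<phi> / A = \<phi> y"
    proof (rule dominated_imp_evaluation[OF Y K KY Q KQ])
      show "clin (vecs (dual Y)) (\<lambda>\<phi>. F1 \<phi> / A)"
        unfolding clin_def using clinD[OF F1(1)] by (simp add: add_divide_distrib)
      fix \<phi> assume \<phi>: "\<phi> \<in> vecs (dual Y)" and "\<And>c. c \<in> K \<Longrightarrow> cmod (\<phi> c) \<le> 1"
      then have "sup_on \<phi> \<le> 1" by (intro sup_on_least)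
      then have "A * sup_on \<phi> \<le> A * 1" using A by (intro mult_left_mono) auto
      then have "cmod (F1 \<phi>) \<le> A" using F1(2)[OF \<phi>] by linarith
      then show "cmod (F1 \<phi> / A) \<le> 1" using A by (simp add: norm_divide)
    qed
    then obtain y where y: "y \<in> Q" "\<forall>\<phi>\<in>vecs (dual Y). F1 \<phi> / A = \<phi> y" by (rule bexE)
    have yY: "y \<in> vecs Y" using y QY by blast
    show "\<exists>y\<in>vecs Y. \<forall>\<phi>\<in>vecs (dual Y). cmod (F \<phi> - \<phi> y) \<le> e * vnorm (dual Y) \<phi>"
    proof (rule bexI[OF ballI csub_scale[OF subY yY]])
      fix \<phi> assume \<phi>: "\<phi> \<in> vecs (dual Y)"
      have "\<phi> (A *\<^sub>r y) = F1 \<phi>"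
        unfolding clinD(2)[OF dualD(1)[OF \<phi>] yY] y(2)[rule_format, OF \<phi>, symmetric] using A by simp
      then show "cmod (F \<phi> - \<phi> (A *\<^sub>r y)) \<le> e * vnorm (dual Y) \<phi>" using F1(3)[OF \<phi>] by simp
    qed
  qed
  then show ?thesis by (simp only: F_def)
qed

text \<open>
  Otherwise a functional on \<^term>\<open>Y\<close> separates \<^term>\<open>y\<close> from the ball of radius \<open>r + 1\<close>, where \<open>r\<close> is the norm of
  \<^term>\<open>\<Psi>\<close>; its restriction has norm at most \<open>1 / (r + 1)\<close>, too small for the value of \<^term>\<open>\<Psi>\<close> there.
\<close>
lemma bidual_restr_in_interp_space:
  assumes \<Psi>: "\<Psi> \<in> vecs (dual (dual Z))" and yY: "y \<in> vecs Y"
    and Fy: "\<forall>\<phi>\<in>vecs (dual Y). \<Psi> (restr \<phi>) = \<phi> y"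
  shows "y \<in> vecs Z"
proof -
  note cZD = cnormed_dual[OF cZ]
  define r where "r = vnorm (dual (dual Z)) \<Psi>"
  have r: "r \<ge> 0" unfolding r_def by (rule dual_norm_nonneg[OF cZD \<Psi>])
  have \<Psi>_bound: "cmod (\<Psi> \<psi>) \<le> r * vnorm (dual Z) \<psi>" if "\<psi> \<in> vecs (dual Z)" for \<psi>
    unfolding r_def by (rule dual_bound[OF cZD \<Psi> that])
  show "y \<in> vecs Z"
  proof (rule ccontr)
    assume "y \<notin> vecs Z"
    then have "\<not> (\<forall>e>0. \<exists>z\<in>vecs Z. vnorm Z z \<le> r + 1 \<and> vnorm Y (y - z) < e)"
      using interp_ball_closed(1)[OF yY, of "r + 1"] by blast
    then obtain e where e: "e > 0" "\<And>z. z \<in> vecs Z \<Longrightarrow> vnorm Z z \<le> r + 1 \<Longrightarrow> e \<le> vnorm Y (y - z)"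
      by (auto simp: not_less)
    define C where "C = {z \<in> vecs Z. vnorm Z z \<le> r + 1}"
    have CY: "C \<subseteq> vecs Y" using interp_spaceD(1) by (auto simp: C_def)
    have C: "absconvex C"
      unfolding absconvex_def
    proof (intro conjI ballI allI impI)
      show "C \<noteq> {}" using csub_0[OF sZ] seminorm_diff(1)[OF nZ sZ] r by (auto simp: C_def)
      fix x y a b assume xy: "x \<in> C" "y \<in> C" and ab: "cmod a + cmod b \<le> 1"
      then have m: "x \<in> vecs Z" "y \<in> vecs Z" "vnorm Z x \<le> r + 1" "vnorm Z y \<le> r + 1" by (auto simp: C_def)
      have m': "a *\<^sub>C x \<in> vecs Z" "b *\<^sub>C y \<in> vecs Z" using m sZ by simp_all
      have "vnorm Z (a *\<^sub>C x + b *\<^sub>C y) \<le> vnorm Z (a *\<^sub>C x) + vnorm Z (b *\<^sub>C y)"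
        by (rule seminormD(2)[OF nZ m'])
      also have "\<dots> = cmod a * vnorm Z x + cmod b * vnorm Z y"
        by (simp only: seminormD(3)[OF nZ m(1)] seminormD(3)[OF nZ m(2)])
      also have "\<dots> \<le> cmod a * (r + 1) + cmod b * (r + 1)"
        using m by (intro add_mono mult_left_mono) auto
      also have "\<dots> = (cmod a + cmod b) * (r + 1)" by (simp add: distrib_right)
      also have "\<dots> \<le> 1 * (r + 1)" using ab r by (intro mult_right_mono) auto
      finally show "a *\<^sub>C x + b *\<^sub>C y \<in> C" using m' sZ by (simp add: C_def)
    qed
    have far: "e \<le> vnorm Y (y - c)" if "c \<in> C" for c using e(2) that by (simp add: C_def)
    obtain \<phi> L where \<phi>: "clin (vecs Y) \<phi>" "\<And>v. v \<in> vecs Y \<Longrightarrow> cmod (\<phi> v) \<le> L * vnorm Y v"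
      "\<And>c. c \<in> C \<Longrightarrow> cmod (\<phi> c) \<le> 1" "1 < cmod (\<phi> y)"
      using separation[OF subY normY CY C yY e(1) far] by blast
    define \<phi>' where "\<phi>' = (\<lambda>x. if x \<in> vecs Y then \<phi> x else 0)"
    have \<phi>': "\<phi>' \<in> vecs (dual Y)" unfolding \<phi>'_def by (rule dual_restrict[OF Y \<phi>(1,2)])
    have r1: "0 \<le> 1 / (r + 1)" using r by simp
    have "vnorm (dual Z) (restr \<phi>') \<le> 1 / (r + 1)"
    proof (rule dual_norm_le[OF cZ r1])
      fix z assume z: "z \<in> vecs Z"
      show "cmod (restr \<phi>' z) \<le> 1 / (r + 1) * vnorm Z z"
      proof (cases "vnorm Z z = 0")
        case True
        then have "z = 0" using cnormedD(3)[OF cZ z] by simp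
        then show ?thesis
          using clin_diff_zero(2)[OF dualD(1)[OF restr_mem[OF \<phi>']] sZ] seminorm_diff(1)[OF nZ sZ] by simp
      next
        case False
        then have \<rho>: "vnorm Z z > 0" using seminormD(1)[OF nZ z] by simp
        let ?c = "complex_of_real ((r + 1) / vnorm Z z)"
        note zY = interp_spaceD(1)[OF z]
        have c: "cmod ?c = (r + 1) / vnorm Z z" using \<rho> r by (simp only: norm_of_real) simp
        have "vnorm Z (?c *\<^sub>C z) = (r + 1) / vnorm Z z * vnorm Z z"
          using seminormD(3)[OF nZ z, of ?c] by (simp only: c)
        also have "\<dots> = r + 1" using \<rho> by simp
        finally have "vnorm Z (?c *\<^sub>C z) = r + 1" .
        then have "?c *\<^sub>C z \<in> C" using csub_scale[OF sZ z] by (simp add: C_def)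
        then have "cmod (\<phi> (?c *\<^sub>C z)) \<le> 1" by (rule \<phi>(3))
        moreover have "cmod (\<phi> (?c *\<^sub>C z)) = (r + 1) / vnorm Z z * cmod (\<phi> z)"
          using clinD(2)[OF \<phi>(1) zY, of ?c] by (simp only: norm_mult c)
        ultimately have "(r + 1) / vnorm Z z * cmod (\<phi> z) \<le> 1" by (simp only:)
        moreover have "restr \<phi>' z = \<phi> z" using z zY by (simp add: restr_def \<phi>'_def)
        ultimately show ?thesis using \<rho> r by (simp add: field_simps)
      qed
    qed
    then have "cmod (\<Psi> (restr \<phi>')) \<le> r * (1 / (r + 1))"
      using \<Psi>_bound[OF restr_mem[OF \<phi>']] mult_left_mono[OF _ r] order_trans by blast
    also have "\<dots> \<le> 1" using r by simp
    finally show False using \<phi>(4) Fy[rule_format, OF \<phi>'] yY by (simp add: \<phi>'_def)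
  qed
qed

theorem reflexive_interp_space:
  assumes B: "cbanach Y" and Q: "compactin (weak_topology Y) Q" and KQ: "K \<subseteq> Q"
  shows "reflexive Z"
  unfolding reflexive_def
proof (rule equalityI)
  show "bidual_embedding Z ` vecs Z \<subseteq> vecs (dual (dual Z))"
    by (rule image_subsetI) (rule bidual_embedding_mem[OF cZ])
next
  note cZD = cnormed_dual[OF cZ]
  show "vecs (dual (dual Z)) \<subseteq> bidual_embedding Z ` vecs Z"
  proof
    fix \<Psi> assume \<Psi>: "\<Psi> \<in> vecs (dual (dual Z))"
    obtain y where yY: "y \<in> vecs Y" and Fy: "\<forall>\<phi>\<in>vecs (dual Y). \<Psi> (restr \<phi>) = \<phi> y"
      using bidual_restr_evaluation[OF B Q KQ \<Psi>] by (rule bexE)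
    have yZ: "y \<in> vecs Z" by (rule bidual_restr_in_interp_space[OF \<Psi> yY Fy])
    define r where "r = vnorm (dual (dual Z)) \<Psi>"
    have r: "r \<ge> 0" unfolding r_def by (rule dual_norm_nonneg[OF cZD \<Psi>])
    have \<Psi>_bound: "cmod (\<Psi> \<psi>) \<le> r * vnorm (dual Z) \<psi>" if "\<psi> \<in> vecs (dual Z)" for \<psi>
      unfolding r_def by (rule dual_bound[OF cZD \<Psi> that])
    note \<Psi>_lin = dualD(1)[OF \<Psi>]
    have "\<Psi> \<psi> = \<psi> y" if \<psi>: "\<psi> \<in> vecs (dual Z)" for \<psi>
    proof -
      have "cmod (\<Psi> \<psi> - \<psi> y) \<le> 0"
      proof (rule field_le_epsilon)
        fix d :: real assume d: "d > 0"
        define e where "e = d / (r + vnorm Z y + 1)"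
        have y0: "0 \<le> vnorm Z y" by (rule seminormD(1)[OF nZ yZ])
        have e: "e > 0" using d r y0 by (simp add: e_def)
        obtain \<phi> where \<phi>: "\<phi> \<in> vecs (dual Y)" "\<And>z. z \<in> vecs Z \<Longrightarrow> cmod (\<psi> z - \<phi> z) \<le> e * vnorm Z z"
          using restr_dense[OF \<psi> e] by blast
        note R = restr_mem[OF \<phi>(1)]
        have "vnorm (dual Z) (\<psi> - restr \<phi>) \<le> e"
        proof (rule dual_norm_le[OF cZ less_imp_le[OF e]])
          fix z assume z: "z \<in> vecs Z"
          have "(\<psi> - restr \<phi>) z = \<psi> z - \<phi> z" using z by (simp add: restr_def)
          then show "cmod ((\<psi> - restr \<phi>) z) \<le> e * vnorm Z z" using \<phi>(2)[OF z] by (simp only:)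
        qed
        then have "cmod (\<Psi> (\<psi> - restr \<phi>)) \<le> r * e"
          using \<Psi>_bound[OF csub_diff[OF cnormedD(1)[OF cZD] \<psi> R]] mult_left_mono[OF _ r] order_trans by blast
        then have 1: "cmod (\<Psi> \<psi> - \<Psi> (restr \<phi>)) \<le> r * e"
          by (simp only: clin_diff_zero(1)[OF \<Psi>_lin cnormedD(1)[OF cZD] \<psi> R])
        have 2: "\<Psi> (restr \<phi>) = \<phi> y" by (rule Fy[rule_format, OF \<phi>(1)])
        have "cmod (\<Psi> \<psi> - \<psi> y) \<le> cmod (\<Psi> \<psi> - \<phi> y) + cmod (\<phi> y - \<psi> y)"
          using norm_triangle_ineq[of "\<Psi> \<psi> - \<phi> y" "\<phi> y - \<psi> y"] by simp
        also have "\<dots> \<le> r * e + e * vnorm Z y"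
          using 1 \<phi>(2)[OF yZ] unfolding 2 by (simp add: norm_minus_commute)
        also have "\<dots> \<le> (r + vnorm Z y + 1) * e" using e by (simp add: algebra_simps)
        also have "\<dots> = d" using r y0 by (simp add: e_def)
        finally show "cmod (\<Psi> \<psi> - \<psi> y) \<le> 0 + d" by simp
      qed
      then show ?thesis by simp
    qed
    then have "\<Psi> = bidual_embedding Z y"
      using dualD(2)[OF \<Psi>] by (simp add: fun_eq_iff bidual_embedding_def)
    then show "\<Psi> \<in> bidual_embedding Z ` vecs Z" using yZ by (rule image_eqI)
  qed
qed

end

section \<open>Second-order estimates for scalar maps\<close>
text \<open>
  Apply the Schwarz lemma to \<open>w \<zeta> / \<zeta>\<close>, which vanishes at the origin, after rescaling the disc and the values. The
  constant \<^term>\<open>B'\<close> exceeds \<^term>\<open>B\<close> because the Schwarz lemma asks for a strict bound.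
\<close>
lemma schwarz_second_order:
  fixes w :: "complex \<Rightarrow> complex"
  assumes R: "R > 1" and hol: "w holomorphic_on ball 0 R" and w0: "w 0 = 0" "(w has_field_derivative 0) (at 0)"
    and bound: "\<And>\<zeta>. cmod \<zeta> < R \<Longrightarrow> cmod (w \<zeta>) \<le> B * cmod \<zeta>" and B: "0 \<le> B" "B < B'"
  shows "cmod (w 1) \<le> B' / R"
proof -
  define u where "u \<zeta> = (if \<zeta> = 0 then 0 else w \<zeta> / \<zeta>)" for \<zeta>
  have u_hol: "u holomorphic_on ball 0 R"
  proof (rule pole_theorem_0[OF hol, of 0])
    show "0 \<in> interior (ball (0::complex) R)" using R by simp
    show "w z = (z - 0) * u z" if "z \<in> ball 0 R - {0}" for z using that by (simp add: u_def)
    show "u 0 = deriv w 0" using DERIV_imp_deriv[OF w0(2)] by (simp add: u_def)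
  qed (rule w0)
  have u_bound: "cmod (u \<zeta>) \<le> B" if "cmod \<zeta> < R" for \<zeta>
    using bound[OF that] B by (simp add: u_def norm_divide divide_le_eq)
  define v where "v z = u (R * z) / B'" for z :: complex
  have "v holomorphic_on ball 0 1"
    unfolding v_def
  proof (intro holomorphic_intros)
    have "u \<circ> (\<lambda>z. R * z) holomorphic_on ball 0 1"
      by (rule holomorphic_on_compose_gen[OF _ u_hol]) (use R in \<open>auto intro!: holomorphic_intros simp: norm_mult\<close>)
    then show "(\<lambda>z. u (R * z)) holomorphic_on ball 0 1" by (simp add: o_def)
  qed (use B in auto)
  moreover have "v 0 = 0" by (simp add: v_def u_def)
  moreover have "cmod (v z) < 1" if "cmod z < 1" for z
  proof -
    have "cmod (R * z) < R" using that R by (simp add: norm_mult)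
    then have "cmod (u (R * z)) < B'" using u_bound B by fastforce
    then show ?thesis using B by (simp add: v_def norm_divide)
  qed
  moreover have R1: "cmod (complex_of_real (1 / R)) = 1 / R" using R by (simp add: norm_divide)
  then have "cmod (complex_of_real (1 / R)) < 1" using R by (simp only:) simp
  ultimately have "cmod (v (1 / R)) \<le> cmod (complex_of_real (1 / R))"
    by (rule Schwarz_Lemma(1))
  then have "cmod (w 1) / B' \<le> 1 / R"
    using R B by (simp add: v_def u_def norm_divide)
  then show ?thesis using B R by (simp add: field_simps)
qed

lemma has_deriv_along_line:
  assumes X: "cnormed X" and D: "has_deriv_on_ball X scalars h b D" and b: "b \<in> vecs X" and v: "v \<in> vecs X"
  shows "((\<lambda>\<zeta>. h (b + \<zeta> *\<^sub>C v)) has_field_derivative D v) (at 0)"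
  unfolding has_field_derivative_def has_derivative_at_alt
proof (intro conjI allI impI)
  note sX = cnormedD(1)[OF X] and nX = cnormedD(2)[OF X]
  show "bounded_linear ((*) (D v))" by (rule bounded_linear_mult_right)
  fix e :: real assume e: "e > 0"
  define n where "n = vnorm X v + 1"
  have n: "n > 0" "vnorm X v \<le> n" using seminormD(1)[OF nX v] by (simp_all add: n_def)
  have D': "D \<in> bounded_ops X scalars" using D by (simp add: has_deriv_on_ball_def)
  obtain d where d: "d > 0" "\<And>x. x \<in> vecs X \<Longrightarrow> vnorm X (x - b) < d \<Longrightarrow>
      cmod (h x - h b - D (x - b)) \<le> (e / n) * vnorm X (x - b)"
    using has_derivD[OF D, of "e / n"] e n by auto
  show "\<exists>d>0. \<forall>y. norm (y - 0) < d \<longrightarrow>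
      norm (h (b + y *\<^sub>C v) - h (b + 0 *\<^sub>C v) - D v * (y - 0)) \<le> e * norm (y - 0)"
  proof (intro exI[of _ "d / n"] conjI allI impI)
    show "d / n > 0" using d n by simp
    fix y :: complex assume y: "norm (y - 0) < d / n"
    have m: "b + y *\<^sub>C v \<in> vecs X" using b v sX by simp
    have nm: "vnorm X (b + y *\<^sub>C v - b) = cmod y * vnorm X v" using seminormD(3)[OF nX v] by simp
    have le: "cmod y * vnorm X v \<le> cmod y * n" using n by (intro mult_left_mono) auto
    have "cmod y * n < d" using y n by (simp add: pos_less_divide_eq)
    then have "vnorm X (b + y *\<^sub>C v - b) < d" using nm le by linarith
    then have "cmod (h (b + y *\<^sub>C v) - h b - D (b + y *\<^sub>C v - b)) \<le> (e / n) * vnorm X (b + y *\<^sub>C v - b)"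
      by (rule d(2)[OF m])
    also have "\<dots> \<le> (e / n) * (cmod y * n)" unfolding nm using e n le by (intro mult_left_mono) auto
    also have "\<dots> = e * cmod y" using n by simp
    also have "D (b + y *\<^sub>C v - b) = D v * y" using bounded_opsD(4)[OF D' v, of y] by simp
    finally show "norm (h (b + y *\<^sub>C v) - h (b + 0 *\<^sub>C v) - D v * (y - 0)) \<le> e * norm (y - 0)" by simp
  qed
qed

text \<open>
  On the complex line through \<^term>\<open>a\<close> in direction \<^term>\<open>v\<close> the map is holomorphic on a disc of radius
  \<^term>\<open>(1 - vnorm X a) / vnorm X v\<close>, and the Taylor remainder is at most twice \<^term>\<open>vnorm X v\<close> times the distance to the
  origin. The resulting constant depends on \<^term>\<open>a\<close> only, which allows estimates for all maps \<open>\<phi> \<circ> f\<close> simultaneously.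
\<close>
lemma contraction_taylor:
  assumes X: "cnormed X" and h: "h \<in> vecs (HL0 X scalars)"
    and lip: "\<And>x y. x \<in> open_unit_ball X \<Longrightarrow> y \<in> open_unit_ball X \<Longrightarrow> cmod (h x - h y) \<le> vnorm X (x - y)"
    and a: "a \<in> open_unit_ball X" and D: "has_deriv_on_ball X scalars h a D" and v: "v \<in> vecs X"
  shows "cmod (D v) \<le> vnorm X v"
    and "vnorm X v < 1 - vnorm X a \<Longrightarrow>
      cmod (h (a + v) - h a - D v) \<le> 3 / (1 - vnorm X a) * (vnorm X v)\<^sup>2"
proof -
  note sX = cnormedD(1)[OF X] and nX = cnormedD(2)[OF X]
  define \<rho> where "\<rho> = 1 - vnorm X a"
  define n where "n = vnorm X v"
  have aX: "a \<in> vecs X" and \<rho>: "\<rho> > 0" using a by (simp_all add: open_unit_ball_def \<rho>_def)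
  have n0: "n \<ge> 0" unfolding n_def by (rule seminormD(1)[OF nX v])
  have D': "D \<in> bounded_ops X scalars" using D by (simp add: has_deriv_on_ball_def)
  define l where "l \<zeta> = h (a + \<zeta> *\<^sub>C v)" for \<zeta>
  have line: "a + \<zeta> *\<^sub>C v \<in> open_unit_ball X" if "cmod \<zeta> * n < \<rho>" for \<zeta>
  proof -
    have "vnorm X (a + \<zeta> *\<^sub>C v) \<le> vnorm X a + cmod \<zeta> * n"
      using seminormD(2)[OF nX aX csub_scale[OF sX v], of \<zeta>] seminormD(3)[OF nX v, of \<zeta>]
      by (simp add: n_def)
    then show ?thesis using that aX v sX by (simp add: open_unit_ball_def \<rho>_def)
  qed
  have l_bound: "cmod (l \<zeta> - l 0) \<le> cmod \<zeta> * n" if "cmod \<zeta> * n < \<rho>" for \<zeta>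
    using lip[OF line[OF that] a] seminormD(3)[OF nX v, of \<zeta>] by (simp add: l_def n_def)
  have l_deriv: "\<exists>E. (l has_field_derivative E) (at \<zeta>)" if \<zeta>: "cmod \<zeta> * n < \<rho>" for \<zeta>
  proof -
    let ?b = "a + \<zeta> *\<^sub>C v"
    obtain E where E: "has_deriv_on_ball X scalars h ?b E"
      using HL0D(4)[OF X cnormed_scalars h line[OF \<zeta>]] by (rule exE)
    have "((\<lambda>\<eta>. h (?b + \<eta> *\<^sub>C v)) has_field_derivative E v) (at 0)"
      by (rule has_deriv_along_line[OF X E open_ball_subset[OF line[OF \<zeta>]] v])
    then have "((\<lambda>\<eta>. l (\<zeta> + \<eta>)) has_field_derivative E v) (at 0)"
      by (simp add: l_def scaleC_add_left add.assoc)
    then have "(l has_field_derivative E v) (at \<zeta>)" using DERIV_at_within_shift[of l "E v" \<zeta> 0 UNIV] by simp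
    then show ?thesis by (rule exI)
  qed
  have l0: "(l has_field_derivative D v) (at 0)"
    unfolding l_def by (rule has_deriv_along_line[OF X D aX v])
  show Dv: "cmod (D v) \<le> vnorm X v"
  proof -
    have lim: "((\<lambda>\<zeta>. cmod ((l \<zeta> - l 0) / \<zeta>)) \<longlongrightarrow> cmod (D v)) (at 0)"
      using l0 unfolding has_field_derivative_iff by (intro tendsto_norm) simp
    have "eventually (\<lambda>\<zeta>. cmod ((l \<zeta> - l 0) / \<zeta>) \<le> n) (at 0)"
      unfolding eventually_at
    proof (intro exI[of _ "\<rho> / (n + 1)"] conjI ballI impI)
      show "\<rho> / (n + 1) > 0" using \<rho> n0 by simp
      fix \<zeta> :: complex assume \<zeta>: "\<zeta> \<noteq> 0 \<and> dist \<zeta> 0 < \<rho> / (n + 1)"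
      then have "cmod \<zeta> * (n + 1) < \<rho>" using n0 by (simp add: pos_less_divide_eq)
      then have "cmod \<zeta> * n < \<rho>" by (simp add: distrib_left) (smt (verit) norm_ge_zero)
      then show "cmod ((l \<zeta> - l 0) / \<zeta>) \<le> n"
        using l_bound \<zeta> by (simp add: norm_divide pos_divide_le_eq mult.commute)
    qed
    then show ?thesis unfolding n_def[symmetric]
      using tendsto_upperbound[OF lim] by simp
  qed
  show "cmod (h (a + v) - h a - D v) \<le> 3 / (1 - vnorm X a) * (vnorm X v)\<^sup>2" if vr: "vnorm X v < 1 - vnorm X a"
  proof (cases "n = 0")
    case True
    then have "v = 0" using cnormedD(3)[OF X v] by (simp add: n_def)
    then show ?thesis using bounded_ops_diff_zero(1)[OF X D'] seminorm_diff(1)[OF nX sX] by simp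
  next
    case False
    then have n: "n > 0" using n0 by simp
    define R where "R = \<rho> / n"
    have R: "R > 1" using vr n by (simp add: R_def \<rho>_def n_def)
    have in_R: "cmod \<zeta> * n < \<rho>" if "cmod \<zeta> < R" for \<zeta>
      using that n by (simp add: R_def pos_less_divide_eq)
    define w where "w \<zeta> = l \<zeta> - l 0 - \<zeta> * D v" for \<zeta>
    have w_deriv: "\<exists>E. (w has_field_derivative E) (at \<zeta>)" if \<zeta>: "cmod \<zeta> < R" for \<zeta>
    proof -
      obtain E where "(l has_field_derivative E) (at \<zeta>)" using l_deriv[OF in_R[OF \<zeta>]] by (rule exE)
      then have "(w has_field_derivative (E - D v)) (at \<zeta>)"
        unfolding w_def by (auto intro!: derivative_eq_intros)
      then show ?thesis by (rule exI)
    qed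
    have "cmod (w 1) \<le> (3 * n) / R"
    proof (rule schwarz_second_order[OF R, where B = "2 * n"])
      show "w holomorphic_on ball 0 R"
        using w_deriv by (intro holomorphic_onI) (auto simp: field_differentiable_def intro: has_field_derivative_at_within)
      show "w 0 = 0" by (simp add: w_def)
      show "(w has_field_derivative 0) (at 0)"
        unfolding w_def by (rule derivative_eq_intros l0 refl | simp)+
      show "cmod (w \<zeta>) \<le> 2 * n * cmod \<zeta>" if "cmod \<zeta> < R" for \<zeta>
      proof -
        have "cmod (w \<zeta>) \<le> cmod (l \<zeta> - l 0) + cmod \<zeta> * cmod (D v)"
          unfolding w_def using norm_triangle_ineq4[of "l \<zeta> - l 0" "\<zeta> * D v"] by (simp add: norm_mult)
        also have "\<dots> \<le> cmod \<zeta> * n + cmod \<zeta> * n"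
          using l_bound[OF in_R[OF that]] Dv by (intro add_mono mult_left_mono) (auto simp: n_def)
        finally show ?thesis by (simp add: algebra_simps)
      qed
    qed (use n in auto)
    moreover have "w 1 = h (a + v) - h a - D v" by (simp add: w_def l_def)
    moreover have "(3 * n) / R = 3 / (1 - vnorm X a) * (vnorm X v)\<^sup>2"
      using n \<rho> by (simp add: R_def \<rho>_def n_def power2_eq_square)
    ultimately show ?thesis by simp
  qed
qed

section \<open>Factorization through a reflexive space\<close>
definition polar_bound :: "'a::complex_vector cspace \<Rightarrow> 'a set \<Rightarrow> ('a \<Rightarrow> complex) \<Rightarrow> bool" where
  "polar_bound Y C \<phi> \<longleftrightarrow> \<phi> \<in> vecs (dual Y) \<and> (\<forall>c\<in>C. cmod (\<phi> c) \<le> 1)"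

text \<open>
  Membership is tested by scalar functionals alone, which is how estimates for the maps \<open>\<phi> \<circ> f\<close> are transferred to \<open>f\<close>.
\<close>
definition bipolar :: "'a::complex_vector cspace \<Rightarrow> 'a set \<Rightarrow> 'a set" where
  "bipolar Y C = {y \<in> vecs Y. \<forall>\<phi>. polar_bound Y C \<phi> \<longrightarrow> cmod (\<phi> y) \<le> 1}"

lemma bipolarD: "y \<in> bipolar Y C \<Longrightarrow> polar_bound Y C \<phi> \<Longrightarrow> cmod (\<phi> y) \<le> 1"
  unfolding bipolar_def by (elim CollectE conjE allE impE)

text \<open>
  The last clause shows that passing to the bipolar preserves relative weak compactness: evaluation at
  a point of the bipolar is a functional dominated by \<^term>\<open>C\<close>, so it is evaluation at a point of \<^term>\<open>Q\<close>, and
  functionals separate points.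
\<close>
lemma bipolar_facts:
  assumes Y: "cnormed Y" and CY: "C \<subseteq> vecs Y"
  shows "absconvex (bipolar Y C)" "bipolar Y C \<subseteq> vecs Y" "C \<subseteq> bipolar Y C"
    "M > 0 \<Longrightarrow> (\<And>c. c \<in> C \<Longrightarrow> vnorm Y c \<le> M) \<Longrightarrow> k \<in> bipolar Y C \<Longrightarrow> vnorm Y k \<le> M"
    "C \<subseteq> Q \<Longrightarrow> absconvex C \<Longrightarrow> compactin (weak_topology Y) Q \<Longrightarrow> bipolar Y C \<subseteq> Q"
proof -
  note sY = cnormedD(1)[OF Y]
  have polar: "clin (vecs Y) \<phi>" if "polar_bound Y C \<phi>" for \<phi> using that dualD(1)[of \<phi> Y] by (simp add: polar_bound_def)
  show sub: "bipolar Y C \<subseteq> vecs Y" by (auto simp: bipolar_def)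
  show "C \<subseteq> bipolar Y C" using CY by (auto simp: bipolar_def polar_bound_def)
  show "absconvex (bipolar Y C)"
    unfolding absconvex_def
  proof (intro conjI ballI allI impI)
    have "0 \<in> bipolar Y C"
      unfolding bipolar_def
    proof (intro CollectI conjI allI impI csub_0[OF sY])
      fix \<phi> assume "polar_bound Y C \<phi>"
      then show "cmod (\<phi> 0) \<le> 1" using clin_diff_zero(2)[OF polar[of \<phi>] sY] by simp
    qed
    then show "bipolar Y C \<noteq> {}" by blast
    fix x y a b assume xy: "x \<in> bipolar Y C" "y \<in> bipolar Y C" and ab: "cmod a + cmod b \<le> 1"
    then have m: "x \<in> vecs Y" "y \<in> vecs Y" by (simp_all add: bipolar_def)
    have m': "a *\<^sub>C x \<in> vecs Y" "b *\<^sub>C y \<in> vecs Y" using m sY by simp_all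
    show "a *\<^sub>C x + b *\<^sub>C y \<in> bipolar Y C"
      unfolding bipolar_def
    proof (intro CollectI conjI allI impI csub_add[OF sY m'])
      fix \<phi> assume \<phi>: "polar_bound Y C \<phi>"
      have b: "cmod (\<phi> x) \<le> 1" "cmod (\<phi> y) \<le> 1" using bipolarD[OF xy(1) \<phi>] bipolarD[OF xy(2) \<phi>] .
      have "\<phi> (a *\<^sub>C x + b *\<^sub>C y) = a * \<phi> x + b * \<phi> y"
        by (simp only: clinD(1)[OF polar[OF \<phi>] m'] clinD(2)[OF polar[OF \<phi>] m(1)] clinD(2)[OF polar[OF \<phi>] m(2)])
      then have "cmod (\<phi> (a *\<^sub>C x + b *\<^sub>C y)) \<le> cmod a * cmod (\<phi> x) + cmod b * cmod (\<phi> y)"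
        using norm_triangle_ineq[of "a * \<phi> x" "b * \<phi> y"] by (simp add: norm_mult)
      also have "\<dots> \<le> cmod a * 1 + cmod b * 1" using b by (intro add_mono mult_left_mono) auto
      finally show "cmod (\<phi> (a *\<^sub>C x + b *\<^sub>C y)) \<le> 1" using ab by simp
    qed
  qed
  show "vnorm Y k \<le> M" if M: "M > 0" "\<And>c. c \<in> C \<Longrightarrow> vnorm Y c \<le> M" and k: "k \<in> bipolar Y C"
  proof (rule norm_le_by_dual[OF Y])
    show kY: "k \<in> vecs Y" using k sub by blast
    fix \<phi> assume "\<phi> \<in> closed_unit_ball (dual Y)"
    then have \<phi>: "\<phi> \<in> vecs (dual Y)" "vnorm (dual Y) \<phi> \<le> 1" by (simp_all add: closed_unit_ball_def)
    let ?\<psi> = "(1 / M) *\<^sub>r \<phi>"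
    have "cmod (\<phi> c) \<le> M" if c: "c \<in> C" for c
    proof -
      have cY: "c \<in> vecs Y" using c CY by blast
      have "cmod (\<phi> c) \<le> 1 * vnorm Y c"
        using dual_bound[OF Y \<phi>(1) cY] mult_right_mono[OF \<phi>(2) seminormD(1)[OF cnormedD(2)[OF Y] cY]] by linarith
      then show ?thesis using M(2)[OF c] by simp
    qed
    then have "polar_bound Y C ?\<psi>"
      using csub_scale[OF cnormedD(1)[OF cnormed_dual[OF Y]] \<phi>(1)] M(1)
      by (simp add: polar_bound_def norm_mult norm_divide)
    then have "cmod (?\<psi> k) \<le> 1" by (rule bipolarD[OF k])
    then show "cmod (\<phi> k) \<le> M" using M(1) by (simp add: norm_mult norm_divide)
  qed
  show "bipolar Y C \<subseteq> Q" if Q: "C \<subseteq> Q" "absconvex C" "compactin (weak_topology Y) Q"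
  proof
    fix k assume k: "k \<in> bipolar Y C"
    then have kY: "k \<in> vecs Y" using sub by blast
    have "\<exists>y\<in>Q. \<forall>\<phi>\<in>vecs (dual Y). \<phi> k = \<phi> y"
    proof (rule dominated_imp_evaluation[OF Y Q(2) CY Q(3,1)])
      show "clin (vecs (dual Y)) (\<lambda>\<phi>. \<phi> k)" by (simp add: clin_def)
      show "cmod (\<phi> k) \<le> 1" if "\<phi> \<in> vecs (dual Y)" "\<And>c. c \<in> C \<Longrightarrow> cmod (\<phi> c) \<le> 1" for \<phi>
        by (rule bipolarD[OF k]) (simp add: polar_bound_def that)
    qed
    then obtain y where y: "y \<in> Q" "\<forall>\<phi>\<in>vecs (dual Y). \<phi> k = \<phi> y" by (rule bexE)
    have "y \<in> vecs Y"
      using y(1) compactin_subset_topspace[OF Q(3)] topspace_weak_topology[OF Y] by blast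
    then have "k = y" by (rule dual_separates[OF Y kY]) (rule y(2)[rule_format])
    then show "k \<in> Q" using y(1) by simp
  qed
qed

text \<open>
  The condition through which all the equivalences pass.
\<close>
definition relatively_weakly_compact_image ::
    "'a::complex_vector cspace \<Rightarrow> 'b::complex_vector cspace \<Rightarrow> ('a \<Rightarrow> 'b) \<Rightarrow> bool" where
  "relatively_weakly_compact_image X Y f \<longleftrightarrow>
     (\<exists>C M. absconvex C \<and> C \<subseteq> vecs Y \<and> M > 0 \<and> (\<forall>c\<in>C. vnorm Y c \<le> M) \<and>
        rel_weakly_compact Y C \<and> Im_L X Y f \<subseteq> C)"

lemma polar_contraction:
  assumes X: "cnormed X" and Y: "cnormed Y" and f: "f \<in> vecs (HL0 X Y)"
    and im: "Im_L X Y f \<subseteq> C" and \<phi>: "polar_bound Y C \<phi>"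
    and xy: "x \<in> open_unit_ball X" "y \<in> open_unit_ball X"
  shows "cmod (\<phi> (f x) - \<phi> (f y)) \<le> vnorm X (x - y)"
proof (cases "x = y")
  case True
  then show ?thesis using seminorm_diff(1)[OF cnormedD(2,1)[OF X]] by simp
next
  case False
  note fY = HL0D(1)[OF X Y f] and sY = cnormedD(1)[OF Y]
  have \<phi>': "\<phi> \<in> vecs (dual Y)" and \<phi>C: "\<And>c. c \<in> C \<Longrightarrow> cmod (\<phi> c) \<le> 1" using \<phi> by (simp_all add: polar_bound_def)
  have pos: "vnorm X (x - y) > 0" by (rule ball_diff(3)[OF X xy False])
  have fd: "f x - f y \<in> vecs Y" using fY sY by simp
  let ?c = "complex_of_real (1 / vnorm X (x - y)) *\<^sub>C (f x - f y)"
  have "?c \<in> Im_L X Y f" unfolding Im_L_def using xy False by blast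
  then have "cmod (\<phi> ?c) \<le> 1" using im \<phi>C by blast
  moreover have "cmod (\<phi> ?c) = cmod (\<phi> (f x - f y)) / vnorm X (x - y)"
    using clinD(2)[OF dualD(1)[OF \<phi>'] fd, of "complex_of_real (1 / vnorm X (x - y))"] pos
    by (simp add: norm_mult norm_divide)
  ultimately have "cmod (\<phi> (f x - f y)) / vnorm X (x - y) \<le> 1" by (simp only:)
  then have "cmod (\<phi> (f x - f y)) \<le> vnorm X (x - y)" using pos by (simp add: pos_divide_le_eq)
  then show ?thesis by (simp only: clin_diff_zero(1)[OF dualD(1)[OF \<phi>'] sY fY fY])
qed

lemma polar_lipschitz_le:
  assumes X: "cnormed X" and Y: "cnormed Y" and f: "f \<in> vecs (HL0 X Y)"
    and im: "Im_L X Y f \<subseteq> C" and \<phi>: "polar_bound Y C \<phi>"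
  shows "\<phi> \<circ> f \<in> vecs (HL0 X scalars)" "vnorm (HL0 X scalars) (\<phi> \<circ> f) \<le> 1"
proof -
  have \<phi>': "\<phi> \<in> vecs (dual Y)" using \<phi> by (simp add: polar_bound_def)
  show mem: "\<phi> \<circ> f \<in> vecs (HL0 X scalars)"
    by (rule HL0_compose(1)[OF X Y cnormed_scalars f _ dual_norm_nonneg[OF Y \<phi>']])
       (use \<phi>' dual_bound[OF Y \<phi>'] in \<open>simp_all add: dual_eq_bounded_ops\<close>)
  show "vnorm (HL0 X scalars) (\<phi> \<circ> f) \<le> 1"
    by (rule lipschitz_norm_le[OF X cnormed_scalars mem])
       (use polar_contraction[OF X Y f im \<phi>] in simp_all)
qed

text \<open>
  With \<open>K\<close> the bipolar of \<open>C\<close>, a point \<open>y\<close> of \<^term>\<open>Y\<close> satisfying \<open>\<bar>\<phi> y\<bar> \<le> s\<close> for all \<open>\<phi>\<close> in the polar of \<open>C\<close> lies in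
  \<open>s K\<close>, so its interpolation norm is at most \<open>2 s\<close>. Applied to differences of values, to derivatives and to Taylor
  remainders of \<^term>\<open>f\<close>, this makes \<^term>\<open>f\<close> a holomorphic Lipschitz map into the interpolation space.
\<close>
theorem factorization_through_reflexive:
  fixes Y :: "'b::complex_vector cspace"
  assumes X: "cnormed X" and B: "cbanach Y" and f: "f \<in> vecs (HL0 X Y)"
    and W: "relatively_weakly_compact_image X Y f"
  shows "factors_through_reflexive TYPE('b) X Y f"
proof -
  note Y = cbanach_cnormed[OF B]
  note sY = cnormedD(1)[OF Y] and sX = cnormedD(1)[OF X] and nX = cnormedD(2)[OF X]
  obtain C M where C: "absconvex C" "C \<subseteq> vecs Y" "M > 0" "\<And>c. c \<in> C \<Longrightarrow> vnorm Y c \<le> M"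
    "rel_weakly_compact Y C" "Im_L X Y f \<subseteq> C"
    using W unfolding relatively_weakly_compact_image_def by blast
  obtain Q where Q: "compactin (weak_topology Y) Q" "C \<subseteq> Q" using C(5) by (auto simp: rel_weakly_compact_def)
  define K where "K = bipolar Y C"
  note bp = bipolar_facts[OF Y C(2)]
  have K: "absconvex K" "K \<subseteq> vecs Y" "\<forall>k\<in>K. vnorm Y k \<le> M" "K \<subseteq> Q"
    unfolding K_def using bp(1,2) bp(4)[OF C(3,4)] bp(5)[OF Q(2) C(1) Q(1)] by blast+
  note facts = Y K(1-3)
  define Z where "Z = interp_space Y K"
  have Z: "cbanach Z" "reflexive Z"
    unfolding Z_def using cbanach_interp_space[OF facts B] reflexive_interp_space[OF facts B Q(1) K(4)] .
  note cZ = cbanach_cnormed[OF Z(1)]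
  note sZ = cnormedD(1)[OF cZ] and nZ = cnormedD(2)[OF cZ]
  have ZY: "z \<in> vecs Y" if "z \<in> vecs Z" for z using interp_spaceD(1)[OF facts] that unfolding Z_def .
  have ZK: "y \<in> vecs Z \<and> vnorm Z y \<le> 2 * s"
    if y: "y \<in> vecs Y" and s: "s \<ge> 0" and b: "\<And>\<phi>. polar_bound Y C \<phi> \<Longrightarrow> cmod (\<phi> y) \<le> s" for y s
  proof -
    \<comment> \<open>First for positive bounds, by scaling; the case \<open>s = 0\<close> then follows by approximation.\<close>
    have pos: "y \<in> vecs Z \<and> vnorm Z y \<le> 2 * t"
      if t: "t > 0" and bt: "\<And>\<phi>. polar_bound Y C \<phi> \<Longrightarrow> cmod (\<phi> y) \<le> t" for t
    proof -
      let ?k = "(1 / t) *\<^sub>r y"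
      have "cmod (\<phi> ?k) \<le> 1" if \<phi>: "polar_bound Y C \<phi>" for \<phi>
      proof -
        have "\<phi> \<in> vecs (dual Y)" using \<phi> by (simp add: polar_bound_def)
        from clinD(2)[OF dualD(1)[OF this] y, of "complex_of_real (1 / t)"] show ?thesis
          using bt[OF \<phi>] t by (simp add: norm_mult norm_divide)
      qed
      moreover have "?k \<in> vecs Y" using y sY by simp
      ultimately have kK: "?k \<in> K" unfolding K_def bipolar_def by blast
      have kZ: "?k \<in> vecs Z" "vnorm Z ?k \<le> 2"
        unfolding Z_def by (rule set_in_interp_ball[OF facts kK])+
      have yk: "y = t *\<^sub>r ?k" using t by simp
      have "vnorm Z (t *\<^sub>r ?k) = t * vnorm Z ?k" using seminormD(3)[OF nZ kZ(1), of "complex_of_real t"] t by simp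
      also have "\<dots> \<le> t * 2" using kZ(2) t by (intro mult_left_mono) auto
      finally have "vnorm Z y \<le> 2 * t" unfolding yk[symmetric] by simp
      moreover have "y \<in> vecs Z" using csub_scale[OF sZ kZ(1), of t] unfolding yk[symmetric] .
      ultimately show ?thesis by blast
    qed
    show ?thesis
    proof
      show "y \<in> vecs Z" using pos[of "s + 1"] b s by fastforce
      show "vnorm Z y \<le> 2 * s"
      proof (rule field_le_epsilon)
        fix e :: real assume "e > 0"
        then show "vnorm Z y \<le> 2 * s + e" using pos[of "s + e / 2"] b s by fastforce
      qed
    qed
  qed
  note fY = HL0D[OF X Y f]
  have diff: "f x - f y \<in> vecs Z \<and> vnorm Z (f x - f y) \<le> 2 * vnorm X (x - y)"
    if xy: "x \<in> open_unit_ball X" "y \<in> open_unit_ball X" for x y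
  proof (rule ZK)
    show "f x - f y \<in> vecs Y" using fY(1) sY by simp
    show "0 \<le> vnorm X (x - y)" by (rule ball_diff(2)[OF X xy])
    fix \<phi> assume \<phi>: "polar_bound Y C \<phi>"
    then have "\<phi> \<in> vecs (dual Y)" by (simp add: polar_bound_def)
    from polar_contraction[OF X Y f C(6) \<phi> xy] show "cmod (\<phi> (f x - f y)) \<le> vnorm X (x - y)"
      by (simp only: clin_diff_zero(1)[OF dualD(1)[OF \<open>\<phi> \<in> _\<close>] sY fY(1) fY(1)])
  qed
  have fZ: "f x \<in> vecs Z" for x
  proof (cases "x \<in> open_unit_ball X")
    case True
    then show ?thesis using diff[OF True zero_in_ball(2)[OF X]] fY(3) by simp
  next
    case False
    then show ?thesis using fY(2) sZ by simp
  qed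
  have der: "\<exists>D. has_deriv_on_ball X Z f a D" if a: "a \<in> open_unit_ball X" for a
  proof -
    have aX: "a \<in> vecs X" by (rule open_ball_subset[OF a])
    define \<rho> where "\<rho> = 1 - vnorm X a"
    have \<rho>: "\<rho> > 0" using a by (simp add: \<rho>_def open_unit_ball_def)
    obtain D where D: "has_deriv_on_ball X Y f a D" using fY(4)[OF a] by (rule exE)
    then have D': "D \<in> bounded_ops X Y" by (simp add: has_deriv_on_ball_def)
    note DD = bounded_opsD[OF D']
    have taylor: "cmod (\<phi> (D v)) \<le> vnorm X v"
      "vnorm X v < \<rho> \<Longrightarrow> cmod (\<phi> (f (a + v) - f a - D v)) \<le> 3 / \<rho> * (vnorm X v)\<^sup>2"
      if \<phi>: "polar_bound Y C \<phi>" and v: "v \<in> vecs X" for \<phi> v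
    proof -
      have \<phi>': "\<phi> \<in> vecs (dual Y)" using \<phi> by (simp add: polar_bound_def)
      note lin = dualD(1)[OF \<phi>']
      have T: "\<phi> \<in> bounded_ops Y scalars" using \<phi>' by (simp add: dual_eq_bounded_ops)
      have "has_deriv_on_ball X scalars (\<phi> \<circ> f) a (\<phi> \<circ> D)"
        by (rule has_deriv_compose[OF X Y T fY(1) a D dual_norm_nonneg[OF Y \<phi>']])
           (use dual_bound[OF Y \<phi>'] in simp)
      note t = contraction_taylor[OF X polar_lipschitz_le(1)[OF X Y f C(6) \<phi>] _ a this v]
      have lip: "cmod ((\<phi> \<circ> f) x - (\<phi> \<circ> f) y) \<le> vnorm X (x - y)"
        if "x \<in> open_unit_ball X" "y \<in> open_unit_ball X" for x y
        using polar_contraction[OF X Y f C(6) \<phi> that] by simp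
      show "cmod (\<phi> (D v)) \<le> vnorm X v" using t(1)[OF lip] by simp
      assume v\<rho>: "vnorm X v < \<rho>"
      have "\<phi> (f (a + v) - f a - D v) = \<phi> (f (a + v)) - \<phi> (f a) - \<phi> (D v)"
        using clin_diff_zero(1)[OF lin sY, of "f (a + v) - f a" "D v"]
          clin_diff_zero(1)[OF lin sY fY(1) fY(1), of "a + v" a] DD(1)[OF v] fY(1) sY by simp
      then show "cmod (\<phi> (f (a + v) - f a - D v)) \<le> 3 / \<rho> * (vnorm X v)\<^sup>2"
        using t(2)[OF lip] v\<rho> by (simp add: \<rho>_def)
    qed
    have DZ: "D v \<in> vecs Z \<and> vnorm Z (D v) \<le> 2 * vnorm X v" if v: "v \<in> vecs X" for v
      by (rule ZK[OF DD(1)[OF v] seminormD(1)[OF nX v]]) (rule taylor(1)[OF _ v])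
    have "has_deriv_on_ball X Z f a D"
      unfolding has_deriv_on_ball_def
    proof (intro conjI allI impI)
      show "D \<in> bounded_ops X Z" by (rule bounded_opsI[of _ _ _ 2]) (simp_all add: DD DZ)
      fix e :: real assume e: "e > 0"
      show "\<exists>d>0. \<forall>x\<in>vecs X. vnorm X (x - a) < d \<longrightarrow> vnorm Z (f x - f a - D (x - a)) \<le> e * vnorm X (x - a)"
      proof (intro exI[of _ "min \<rho> (e * \<rho> / 6)"] conjI ballI impI)
        show "min \<rho> (e * \<rho> / 6) > 0" using \<rho> e by simp
        fix x assume x: "x \<in> vecs X" and small: "vnorm X (x - a) < min \<rho> (e * \<rho> / 6)"
        have v: "x - a \<in> vecs X" using x aX sX by simp
        note v0 = seminormD(1)[OF nX v]
        have "vnorm Z (f x - f a - D (x - a)) \<le> 2 * (3 / \<rho> * (vnorm X (x - a))\<^sup>2)"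
        proof (rule conjunct2[OF ZK])
          show "f x - f a - D (x - a) \<in> vecs Y" using fY(1) DD(1)[OF v] sY by simp
          show "0 \<le> 3 / \<rho> * (vnorm X (x - a))\<^sup>2" using \<rho> by simp
          show "cmod (\<phi> (f x - f a - D (x - a))) \<le> 3 / \<rho> * (vnorm X (x - a))\<^sup>2" if "polar_bound Y C \<phi>" for \<phi>
            using taylor(2)[OF that v] small by simp
        qed
        also have "\<dots> = (6 / \<rho> * vnorm X (x - a)) * vnorm X (x - a)" by (simp add: power2_eq_square)
        also have "\<dots> \<le> e * vnorm X (x - a)"
          using small \<rho> v0 by (intro mult_right_mono) (auto simp: field_simps)
        finally show "vnorm Z (f x - f a - D (x - a)) \<le> e * vnorm X (x - a)" .
      qed
    qed
    then show ?thesis by (intro exI[of _ D])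
  qed
  have fHZ: "f \<in> vecs (HL0 X Z)"
    unfolding mem_HL0[OF X cZ] lipschitz_on_ball_def
  proof (intro conjI allI impI ballI der)
    show "\<exists>K. \<forall>x\<in>open_unit_ball X. \<forall>y\<in>open_unit_ball X. vnorm Z (f x - f y) \<le> K * vnorm X (x - y)"
      using diff by (intro exI[of _ 2] ballI) simp
  qed (simp_all add: fZ fY)
  define j where "j = (\<lambda>z. if z \<in> vecs Z then z else 0)"
  have "j \<in> bounded_ops Z Y"
  proof (rule bounded_opsI)
    show "vnorm Y (j z) \<le> max M 1 * vnorm Z z" if "z \<in> vecs Z" for z
      using norm_le_interp_norm[OF facts] that unfolding Z_def j_def by simp
  qed (simp_all add: j_def ZY sZ)
  moreover have "f = j \<circ> f" by (simp add: fun_eq_iff j_def fZ)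
  ultimately show ?thesis unfolding factors_through_reflexive_def using Z fHZ by blast
qed

section \<open>Functionals represented by points, and the linearization\<close>
text \<open>
  The second transpose of \<^term>\<open>f\<close> maps \<^term>\<open>\<Phi>\<close> to the point \<^term>\<open>y\<close> of \<^term>\<open>Y\<close> inside the bidual of \<^term>\<open>Y\<close>.
\<close>
definition represents ::
    "'a::complex_vector cspace \<Rightarrow> 'b::complex_vector cspace \<Rightarrow> ('a \<Rightarrow> 'b) \<Rightarrow> (('a \<Rightarrow> complex) \<Rightarrow> complex) \<Rightarrow> 'b \<Rightarrow> bool" where
  "represents X Y f \<Phi> y \<longleftrightarrow> y \<in> vecs Y \<and> (\<forall>\<phi>\<in>vecs (dual Y). \<Phi> (\<phi> \<circ> f) = \<phi> y)"

lemma representsD: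
  "represents X Y f \<Phi> y \<Longrightarrow> y \<in> vecs Y"
  "represents X Y f \<Phi> y \<Longrightarrow> \<phi> \<in> vecs (dual Y) \<Longrightarrow> \<Phi> (\<phi> \<circ> f) = \<phi> y"
  by (simp_all add: represents_def)

lemma represents_unique:
  assumes Y: "cnormed Y" and y: "represents X Y f \<Phi> y" and z: "represents X Y f \<Phi> z"
  shows "y = z"
proof (rule dual_separates[OF Y representsD(1)[OF y] representsD(1)[OF z]])
  fix \<phi> assume \<phi>: "\<phi> \<in> vecs (dual Y)"
  show "\<phi> y = \<phi> z" using representsD(2)[OF y \<phi>] representsD(2)[OF z \<phi>] by simp
qed

lemma represents_lincomb:
  assumes Y: "cnormed Y" and y: "represents X Y f \<Phi> y" and z: "represents X Y f \<Psi> z"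
  shows "represents X Y f (a *\<^sub>C \<Phi> + b *\<^sub>C \<Psi>) (a *\<^sub>C y + b *\<^sub>C z)"
  unfolding represents_def
proof (intro conjI ballI)
  note sY = cnormedD(1)[OF Y] and m = representsD(1)[OF y] representsD(1)[OF z]
  note m' = csub_scale[OF sY m(1), of a] csub_scale[OF sY m(2), of b]
  show "a *\<^sub>C y + b *\<^sub>C z \<in> vecs Y" by (rule csub_add[OF sY m'])
  fix \<phi> assume \<phi>: "\<phi> \<in> vecs (dual Y)"
  note lin = clinD[OF dualD(1)[OF \<phi>]]
  have "\<phi> (a *\<^sub>C y + b *\<^sub>C z) = a * \<phi> y + b * \<phi> z"
    by (simp only: lin(1)[OF m'] lin(2)[OF m(1)] lin(2)[OF m(2)])
  then show "(a *\<^sub>C \<Phi> + b *\<^sub>C \<Psi>) (\<phi> \<circ> f) = \<phi> (a *\<^sub>C y + b *\<^sub>C z)"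
    by (simp add: representsD(2)[OF y \<phi>] representsD(2)[OF z \<phi>])
qed

lemma eval_at_mem_dual:
  assumes X: "cnormed X" and x: "x \<in> open_unit_ball X"
  shows "eval_at X x \<in> vecs (dual (HL0 X scalars))"
proof (rule dualI)
  note sH = cnormedD(1)[OF cnormed_HL0[OF X cnormed_scalars]]
  show "clin (vecs (HL0 X scalars)) (eval_at X x)"
    unfolding clin_def eval_at_def using sH by simp
  show "cmod (eval_at X x g) \<le> vnorm X x * vnorm (HL0 X scalars) g" if "g \<in> vecs (HL0 X scalars)" for g
    using norm_HL0_value[OF X cnormed_scalars that x] that by (simp add: eval_at_def mult.commute)
qed (simp add: eval_at_def)

definition molecule :: "'a::complex_vector cspace \<Rightarrow> 'a \<Rightarrow> 'a \<Rightarrow> ('a \<Rightarrow> complex) \<Rightarrow> complex" where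
  "molecule X x y = complex_of_real (1 / vnorm X (x - y)) *\<^sub>C (eval_at X x - eval_at X y)"

lemma molecule_mem:
  assumes X: "cnormed X" and x: "x \<in> open_unit_ball X" and y: "y \<in> open_unit_ball X" and "x \<noteq> y"
  shows "molecule X x y \<in> closed_unit_ball (dual (HL0 X scalars))"
proof -
  note cH = cnormed_HL0[OF X cnormed_scalars]
  have pos: "vnorm X (x - y) > 0" by (rule ball_diff(3)[OF X x y \<open>x \<noteq> y\<close>])
  have mem: "molecule X x y \<in> vecs (dual (HL0 X scalars))"
    unfolding molecule_def using cnormedD(1)[OF cnormed_dual[OF cH]] eval_at_mem_dual[OF X x] eval_at_mem_dual[OF X y]
    by (intro csub_scale csub_diff)
  moreover have "vnorm (dual (HL0 X scalars)) (molecule X x y) \<le> 1"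
  proof (rule dual_norm_le[OF cH zero_le_one])
    fix g assume g: "g \<in> vecs (HL0 X scalars)"
    have "cmod (g x - g y) \<le> vnorm (HL0 X scalars) g * vnorm X (x - y)"
      using lipschitz_norm_bound(2)[OF X cnormed_scalars g x y] by simp
    then show "cmod (molecule X x y g) \<le> 1 * vnorm (HL0 X scalars) g"
      using pos g by (simp add: molecule_def eval_at_def norm_mult norm_divide pos_divide_le_eq)
  qed
  ultimately show ?thesis by (simp add: closed_unit_ball_def)
qed

lemma csubspace_norm_closure:
  assumes V: "cnormed V" and S: "csubspace S" "S \<subseteq> vecs V"
  shows "csubspace (norm_topology V closure_of S)"
    "norm_topology V closure_of S = {x \<in> vecs V. \<forall>e>0. \<exists>s\<in>S. vnorm V (x - s) < e}"
proof -
  note sV = cnormedD(1)[OF V] and nV = cnormedD(2)[OF V]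
  note M = Metric_space_cnormed[OF V]
  show eq: "norm_topology V closure_of S = {x \<in> vecs V. \<forall>e>0. \<exists>s\<in>S. vnorm V (x - s) < e}"
    unfolding norm_topology_def Metric_space.metric_closure_of[OF M]
    using S(2) by (auto simp: Metric_space.in_mball[OF M] ndist_def subset_iff)
  show "csubspace (norm_topology V closure_of S)"
    unfolding eq complex_vector.subspace_def
  proof (intro conjI ballI allI)
    show "0 \<in> {x \<in> vecs V. \<forall>e>0. \<exists>s\<in>S. vnorm V (x - s) < e}"
      using csub_0[OF S(1)] seminorm_diff(1)[OF nV sV] sV by (auto intro!: bexI[of _ 0])
    fix x assume "x \<in> {x \<in> vecs V. \<forall>e>0. \<exists>s\<in>S. vnorm V (x - s) < e}"
    then have x: "x \<in> vecs V" "\<And>e. e > 0 \<Longrightarrow> \<exists>s\<in>S. vnorm V (x - s) < e" by blast+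
    show "a *\<^sub>C x \<in> {x \<in> vecs V. \<forall>e>0. \<exists>s\<in>S. vnorm V (x - s) < e}" for a
    proof (intro CollectI conjI allI impI csub_scale[OF sV x(1)])
      fix e :: real assume e: "e > 0"
      obtain s where s: "s \<in> S" "vnorm V (x - s) < e / (cmod a + 1)"
        using x(2)[of "e / (cmod a + 1)"] e by (auto simp: add_nonneg_pos)
      have xs: "x - s \<in> vecs V" using x(1) s(1) S(2) sV by (intro csub_diff) auto
      have "vnorm V (a *\<^sub>C x - a *\<^sub>C s) = cmod a * vnorm V (x - s)"
        using seminormD(3)[OF nV xs, of a] by (simp add: complex_vector.scale_right_diff_distrib)
      also have "\<dots> \<le> (cmod a + 1) * vnorm V (x - s)"
        using seminormD(1)[OF nV xs] by (intro mult_right_mono) auto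
      also have "\<dots> < e" using s(2) by (simp add: pos_less_divide_eq add_nonneg_pos mult.commute)
      finally show "\<exists>s\<in>S. vnorm V (a *\<^sub>C x - s) < e"
        using csub_scale[OF S(1) s(1)] by blast
    qed
    fix y assume "y \<in> {x \<in> vecs V. \<forall>e>0. \<exists>s\<in>S. vnorm V (x - s) < e}"
    then have y: "y \<in> vecs V" "\<And>e. e > 0 \<Longrightarrow> \<exists>s\<in>S. vnorm V (y - s) < e" by blast+
    show "x + y \<in> {x \<in> vecs V. \<forall>e>0. \<exists>s\<in>S. vnorm V (x - s) < e}"
    proof (intro CollectI conjI allI impI csub_add[OF sV x(1) y(1)])
      fix e :: real assume e: "e > 0"
      obtain s where s: "s \<in> S" "vnorm V (x - s) < e / 2" using x(2)[of "e / 2"] e by auto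
      obtain t where t: "t \<in> S" "vnorm V (y - t) < e / 2" using y(2)[of "e / 2"] e by auto
      have d: "x - s \<in> vecs V" "y - t \<in> vecs V"
        using x(1) y(1) s(1) t(1) S(2) sV by (auto intro!: csub_diff)
      have "(x + y) - (s + t) = (x - s) + (y - t)" by simp
      then have "vnorm V ((x + y) - (s + t)) \<le> vnorm V (x - s) + vnorm V (y - t)"
        using seminormD(2)[OF nV d] by (simp only:)
      then have "vnorm V ((x + y) - (s + t)) < e" using s(2) t(2) by simp
      then show "\<exists>s\<in>S. vnorm V (x + y - s) < e"
        using csub_add[OF S(1) s(1) t(1)] by blast
    qed
  qed
qed

text \<open>
  The ball of a reflexive space is the image of the bidual ball under the inverse of the canonical embedding, whose composition
  with a functional is evaluation at that functional.
\<close>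
lemma bounded_op_reflexive_rel_weakly_compact:
  assumes Z: "cnormed Z" and refl: "reflexive Z" and Y: "cnormed Y" and T: "T \<in> bounded_ops Z Y"
  shows "rel_weakly_compact Y (T ` closed_unit_ball Z)"
proof -
  let ?J = "bidual_embedding Z"
  note cD = cnormed_dual[OF Z]
  have surj: "?J ` vecs Z = vecs (dual (dual Z))" using refl by (simp add: reflexive_def)
  have J: "?J z \<psi> = \<psi> z" if "\<psi> \<in> vecs (dual Z)" for z \<psi> using that by (simp add: bidual_embedding_def)
  have inj: "z = z'" if "z \<in> vecs Z" "z' \<in> vecs Z" and eq: "?J z = ?J z'" for z z'
  proof (rule dual_separates[OF Z that(1,2)])
    fix \<psi> assume "\<psi> \<in> vecs (dual Z)"
    from J[OF this, of z] J[OF this, of z'] show "\<psi> z = \<psi> z'" using eq by simp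
  qed
  define pre where "pre \<Phi> = (SOME z. z \<in> vecs Z \<and> ?J z = \<Phi>)" for \<Phi>
  have pre: "pre \<Phi> \<in> vecs Z \<and> ?J (pre \<Phi>) = \<Phi>" if "\<Phi> \<in> closed_unit_ball (dual (dual Z))" for \<Phi>
    unfolding pre_def
  proof (rule someI_ex)
    have "\<Phi> \<in> ?J ` vecs Z" using that unfolding surj by (simp add: closed_unit_ball_def)
    then show "\<exists>z. z \<in> vecs Z \<and> ?J z = \<Phi>" by blast
  qed
  have T': "\<psi> \<circ> T \<in> vecs (dual Z)" if "\<psi> \<in> vecs (dual Y)" for \<psi>
    using bounded_ops_compose[OF Z Y T, of \<psi> scalars] that by (simp add: dual_eq_bounded_ops)
  have "compactin (weak_topology Y) ((\<lambda>\<Phi>. T (pre \<Phi>)) ` closed_unit_ball (dual (dual Z)))"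
  proof (rule compactin_image_of_dual_ball[OF cD Y])
    show "T (pre \<Phi>) \<in> vecs Y" if "\<Phi> \<in> closed_unit_ball (dual (dual Z))" for \<Phi>
      using bounded_opsD(1)[OF T] pre[OF that] by blast
    fix \<psi> assume \<psi>: "\<psi> \<in> vecs (dual Y)"
    show "\<exists>v\<in>vecs (dual Z). \<forall>\<Phi>\<in>closed_unit_ball (dual (dual Z)). \<psi> (T (pre \<Phi>)) = \<Phi> v"
    proof (rule bexI[OF _ T'[OF \<psi>]], rule ballI)
      fix \<Phi> assume \<Phi>: "\<Phi> \<in> closed_unit_ball (dual (dual Z))"
      show "\<psi> (T (pre \<Phi>)) = \<Phi> (\<psi> \<circ> T)"
        using J[OF T'[OF \<psi>], of "pre \<Phi>"] pre[OF \<Phi>] by simp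
    qed
  qed
  moreover have "T ` closed_unit_ball Z \<subseteq> (\<lambda>\<Phi>. T (pre \<Phi>)) ` closed_unit_ball (dual (dual Z))"
  proof (rule image_subsetI)
    fix z assume "z \<in> closed_unit_ball Z"
    then have z: "z \<in> vecs Z" "vnorm Z z \<le> 1" by (simp_all add: closed_unit_ball_def)
    have "vnorm (dual (dual Z)) (?J z) \<le> 1"
    proof (rule dual_norm_le[OF cD zero_le_one])
      fix \<psi> assume \<psi>: "\<psi> \<in> vecs (dual Z)"
      show "cmod (?J z \<psi>) \<le> 1 * vnorm (dual Z) \<psi>"
        using dual_bound[OF Z \<psi> z(1)] mult_left_mono[OF z(2) dual_norm_nonneg[OF Z \<psi>]] by (simp add: J[OF \<psi>])
    qed
    then have mem: "?J z \<in> closed_unit_ball (dual (dual Z))"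
      using bidual_embedding_mem[OF Z z(1)] by (simp add: closed_unit_ball_def)
    then have "pre (?J z) = z" using inj[OF _ z(1)] pre[OF mem] by blast
    then show "T z \<in> (\<lambda>\<Phi>. T (pre \<Phi>)) ` closed_unit_ball (dual (dual Z))" using mem by (intro image_eqI[of _ _ "?J z"]) simp_all
  qed
  ultimately show ?thesis by (auto simp: rel_weakly_compact_def)
qed

lemma absconvex_image_of_ball:
  assumes V: "cnormed V"
    and lin: "\<And>u v a b. u \<in> vecs V \<Longrightarrow> v \<in> vecs V \<Longrightarrow> T (a *\<^sub>C u + b *\<^sub>C v) = a *\<^sub>C T u + b *\<^sub>C T v"
  shows "absconvex (T ` closed_unit_ball V)"
  unfolding absconvex_def
proof (intro conjI ballI allI impI)
  note sV = cnormedD(1)[OF V] and nV = cnormedD(2)[OF V]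
  show "T ` closed_unit_ball V \<noteq> {}" using zero_in_ball(1)[OF V] by blast
  fix x y a b assume "x \<in> T ` closed_unit_ball V" "y \<in> T ` closed_unit_ball V" and ab: "cmod a + cmod b \<le> 1"
  then obtain u v where uv: "x = T u" "y = T v" "u \<in> vecs V" "v \<in> vecs V" "vnorm V u \<le> 1" "vnorm V v \<le> 1"
    by (auto simp: closed_unit_ball_def)
  note m = csub_scale[OF sV uv(3), of a] csub_scale[OF sV uv(4), of b]
  have "vnorm V (a *\<^sub>C u + b *\<^sub>C v) \<le> cmod a * vnorm V u + cmod b * vnorm V v"
    using seminormD(2)[OF nV m] by (simp only: seminormD(3)[OF nV uv(3)] seminormD(3)[OF nV uv(4)])
  also have "\<dots> \<le> cmod a * 1 + cmod b * 1" using uv by (intro add_mono mult_left_mono) auto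
  finally have "a *\<^sub>C u + b *\<^sub>C v \<in> closed_unit_ball V"
    using csub_add[OF sV m] ab by (simp add: closed_unit_ball_def)
  then show "a *\<^sub>C x + b *\<^sub>C y \<in> T ` closed_unit_ball V"
    using lin[OF uv(3,4), of a b] unfolding uv(1,2) by (intro image_eqI[OF sym])
qed

definition dual_functionals_representable ::
    "'a::complex_vector cspace \<Rightarrow> 'b::complex_vector cspace \<Rightarrow> ('a \<Rightarrow> 'b) \<Rightarrow> bool" where
  "dual_functionals_representable X Y f \<longleftrightarrow>
     (\<forall>\<Phi>\<in>vecs (dual (HL0 X scalars)). \<exists>y. represents X Y f \<Phi> y)"

lemma bounded_op_image_of_ball:
  assumes V: "cnormed V" and T: "T \<in> bounded_ops V W"
  shows "absconvex (T ` closed_unit_ball V)" "T ` closed_unit_ball V \<subseteq> vecs W"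
    "\<exists>M>0. \<forall>c\<in>T ` closed_unit_ball V. vnorm W c \<le> M"
proof -
  note TD = bounded_opsD[OF T] and sV = cnormedD(1)[OF V]
  show "absconvex (T ` closed_unit_ball V)"
  proof (rule absconvex_image_of_ball[OF V])
    fix u v a b assume u: "u \<in> vecs V" and v: "v \<in> vecs V"
    show "T (a *\<^sub>C u + b *\<^sub>C v) = a *\<^sub>C T u + b *\<^sub>C T v"
      by (simp only: TD(3)[OF csub_scale[OF sV u] csub_scale[OF sV v]] TD(4)[OF u] TD(4)[OF v])
  qed
  show "T ` closed_unit_ball V \<subseteq> vecs W" using TD(1) by (auto simp: closed_unit_ball_def)
  obtain K where K: "K > 0" "\<And>u. u \<in> vecs V \<Longrightarrow> vnorm W (T u) \<le> K * vnorm V u"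
    using bounded_ops_bound[OF V T] by blast
  have "vnorm W (T u) \<le> K" if "u \<in> closed_unit_ball V" for u
    using that K(2)[of u] mult_left_mono[OF _ less_imp_le[OF K(1)], of "vnorm V u" 1]
    by (simp add: closed_unit_ball_def)
  then show "\<exists>M>0. \<forall>c\<in>T ` closed_unit_ball V. vnorm W c \<le> M" using K(1) by blast
qed

lemma relatively_weakly_compact_imageI:
  assumes V: "cnormed V" and Y: "cnormed Y" and wc: "weakly_compact_op V Y T"
    and im: "Im_L X Y f \<subseteq> T ` closed_unit_ball V"
  shows "relatively_weakly_compact_image X Y f"
proof -
  have T: "T \<in> bounded_ops V Y" and rel: "rel_weakly_compact Y (T ` closed_unit_ball V)"
    using wc by (simp_all add: weakly_compact_op_iff[OF Y])
  note image = bounded_op_image_of_ball[OF V T]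
  obtain M where M: "M > 0" "\<forall>c\<in>T ` closed_unit_ball V. vnorm Y c \<le> M" using image(3) by (elim exE conjE)
  show ?thesis
    unfolding relatively_weakly_compact_image_def
    by (intro exI[of _ "T ` closed_unit_ball V"] exI[of _ M] conjI image(1,2) M rel im)
qed

context
  fixes X :: "'x::complex_vector cspace" and Y :: "'y::complex_vector cspace" and f :: "'x \<Rightarrow> 'y"
  assumes X: "cnormed X" and B: "cbanach Y" and f: "f \<in> vecs (HL0 X Y)"
begin

private abbreviation (input) "H \<equiv> HL0 X scalars"
private lemmas Y = cbanach_cnormed[OF B]
private lemmas cH = cnormed_HL0[OF X cnormed_scalars]
private lemmas sY = cnormedD(1)[OF Y] and nY = cnormedD(2)[OF Y]
private lemmas sH' = cnormedD(1)[OF cnormed_dual[OF cH]] and nH' = cnormedD(2)[OF cnormed_dual[OF cH]]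
private lemmas fY = HL0D[OF X Y f]
private lemmas Lf = lipschitz_norm_bound[OF X Y f]

lemma comp_functional:
  assumes \<phi>: "\<phi> \<in> vecs (dual Y)"
  shows "\<phi> \<circ> f \<in> vecs H" "vnorm H (\<phi> \<circ> f) \<le> vnorm (dual Y) \<phi> * vnorm (HL0 X Y) f"
proof -
  have T: "\<phi> \<in> bounded_ops Y scalars" using \<phi> by (simp add: dual_eq_bounded_ops)
  have K: "vnorm scalars (\<phi> y) \<le> vnorm (dual Y) \<phi> * vnorm Y y" if "y \<in> vecs Y" for y
    using dual_bound[OF Y \<phi> that] by simp
  show "\<phi> \<circ> f \<in> vecs H" "vnorm H (\<phi> \<circ> f) \<le> vnorm (dual Y) \<phi> * vnorm (HL0 X Y) f"
    by (rule HL0_compose[OF X Y cnormed_scalars f T dual_norm_nonneg[OF Y \<phi>] K], assumption)+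
qed

lemma comp_linear: "(\<phi> + \<psi>) \<circ> f = (\<phi> \<circ> f) + (\<psi> \<circ> f)" "(a *\<^sub>C \<phi>) \<circ> f = a *\<^sub>C (\<phi> \<circ> f)"
  for \<phi> \<psi> :: "'y \<Rightarrow> complex"
  by (simp_all add: fun_eq_iff)

lemma clin_comp:
  assumes \<Phi>: "\<Phi> \<in> vecs (dual H)" shows "clin (vecs (dual Y)) (\<lambda>\<phi>. \<Phi> (\<phi> \<circ> f))"
  unfolding clin_def comp_linear
  using clinD[OF dualD(1)[OF \<Phi>]] comp_functional(1) by simp

lemma comp_bound:
  assumes \<Phi>: "\<Phi> \<in> vecs (dual H)" and \<phi>: "\<phi> \<in> vecs (dual Y)"
  shows "cmod (\<Phi> (\<phi> \<circ> f)) \<le> (vnorm (dual H) \<Phi> * vnorm (HL0 X Y) f) * vnorm (dual Y) \<phi>"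
proof -
  have "cmod (\<Phi> (\<phi> \<circ> f)) \<le> vnorm (dual H) \<Phi> * vnorm H (\<phi> \<circ> f)" by (rule dual_bound[OF cH \<Phi> comp_functional(1)[OF \<phi>]])
  also have "\<dots> \<le> vnorm (dual H) \<Phi> * (vnorm (dual Y) \<phi> * vnorm (HL0 X Y) f)"
    by (rule mult_left_mono[OF comp_functional(2)[OF \<phi>] dual_norm_nonneg[OF cH \<Phi>]])
  finally show ?thesis by (simp add: mult_ac)
qed

lemma represents_eval:
  assumes x: "x \<in> open_unit_ball X" shows "represents X Y f (eval_at X x) (f x)"
  unfolding represents_def eval_at_def using fY(1) comp_functional(1) by simp

lemma represents_norm_le:
  assumes \<Phi>: "\<Phi> \<in> vecs (dual H)" and y: "represents X Y f \<Phi> y"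
  shows "vnorm Y y \<le> vnorm (HL0 X Y) f * vnorm (dual H) \<Phi>"
proof (rule norm_le_by_dual[OF Y representsD(1)[OF y]])
  fix \<phi> assume "\<phi> \<in> closed_unit_ball (dual Y)"
  then have \<phi>: "\<phi> \<in> vecs (dual Y)" "vnorm (dual Y) \<phi> \<le> 1" by (simp_all add: closed_unit_ball_def)
  have "0 \<le> vnorm (dual H) \<Phi> * vnorm (HL0 X Y) f"
    using dual_norm_nonneg[OF cH \<Phi>] Lf(1) by simp
  from mult_left_mono[OF \<phi>(2) this] comp_bound[OF \<Phi> \<phi>(1)]
  show "cmod (\<phi> y) \<le> vnorm (HL0 X Y) f * vnorm (dual H) \<Phi>"
    unfolding representsD(2)[OF y \<phi>(1)] by (simp add: mult.commute)
qed

lemma represents_molecule: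
  assumes x: "x \<in> open_unit_ball X" and y: "y \<in> open_unit_ball X"
  shows "represents X Y f (molecule X x y) (complex_of_real (1 / vnorm X (x - y)) *\<^sub>C (f x - f y))"
proof -
  let ?c = "complex_of_real (1 / vnorm X (x - y))"
  have "molecule X x y = ?c *\<^sub>C eval_at X x + (- ?c) *\<^sub>C eval_at X y"
    by (simp add: molecule_def fun_eq_iff algebra_simps)
  moreover have "?c *\<^sub>C (f x - f y) = ?c *\<^sub>C f x + (- ?c) *\<^sub>C f y"
    by (simp add: complex_vector.scale_right_diff_distrib)
  ultimately show ?thesis
    using represents_lincomb[OF Y represents_eval[OF x] represents_eval[OF y], of ?c "- ?c"] by (simp only:)
qed

private abbreviation (input) "S \<equiv> complex_vector.span (eval_at X ` open_unit_ball X)"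

lemma span_eval_subset: "S \<subseteq> vecs (dual H)"
  using eval_at_mem_dual[OF X] by (intro complex_vector.span_minimal sH') blast

lemma vecs_G0: "vecs (G0 X) = norm_topology (dual H) closure_of S"
  and vnorm_G0: "vnorm (G0 X) = vnorm (dual H)"
  by (simp_all add: G0_def)

lemma mem_G0: "u \<in> vecs (G0 X) \<longleftrightarrow> u \<in> vecs (dual H) \<and> (\<forall>e>0. \<exists>s\<in>S. vnorm (dual H) (u - s) < e)"
  unfolding vecs_G0 csubspace_norm_closure(2)[OF cnormed_dual[OF cH] complex_vector.subspace_span span_eval_subset] by simp

lemma G0_dual: "u \<in> vecs (G0 X) \<Longrightarrow> u \<in> vecs (dual H)"
  by (simp add: mem_G0)

lemma span_in_G0: "s \<in> S \<Longrightarrow> s \<in> vecs (G0 X)"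
  using span_eval_subset seminorm_diff(1)[OF nH' sH'] unfolding mem_G0 by (auto intro!: bexI[of _ s])

lemma cnormed_G0: "cnormed (G0 X)"
proof (rule cnormedI)
  show "csubspace (vecs (G0 X))"
    unfolding vecs_G0
    by (rule csubspace_norm_closure(1)[OF cnormed_dual[OF cH] complex_vector.subspace_span span_eval_subset])
  show "seminorm_on (vecs (G0 X)) (vnorm (G0 X))"
    unfolding vnorm_G0 seminorm_on_def using seminormD[OF nH'] G0_dual by blast
  show "u = 0" if "u \<in> vecs (G0 X)" "vnorm (G0 X) u = 0" for u
    using cnormedD(3)[OF cnormed_dual[OF cH] G0_dual[OF that(1)]] that(2) by (simp add: vnorm_G0)
qed

text \<open>
  The representing point is a Lipschitz function of \<^term>\<open>\<Phi>\<close> and \<^term>\<open>Y\<close> is complete, so the represented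
  functionals form a closed subspace of the dual.
\<close>
lemma represents_approx:
  assumes \<Phi>: "\<Phi> \<in> vecs (dual H)"
    and approx: "\<And>e. e > 0 \<Longrightarrow> \<exists>\<Psi>\<in>vecs (dual H). vnorm (dual H) (\<Phi> - \<Psi>) < e \<and> (\<exists>y. represents X Y f \<Psi> y)"
  shows "\<exists>y. represents X Y f \<Phi> y"
proof -
  have "\<exists>y\<in>vecs Y. \<forall>\<phi>\<in>vecs (dual Y). \<Phi> (\<phi> \<circ> f) = \<phi> y"
  proof (rule evaluations_closed[OF B])
    fix e :: real assume e: "e > 0"
    let ?L = "vnorm (HL0 X Y) f"
    have L: "?L + 1 > 0" using Lf(1) by simp
    have "e / (?L + 1) > 0" using e L by simp
    then obtain \<Psi> y where \<Psi>: "\<Psi> \<in> vecs (dual H)" "vnorm (dual H) (\<Phi> - \<Psi>) < e / (?L + 1)"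
      and y: "represents X Y f \<Psi> y"
      using approx by blast
    have d: "\<Phi> - \<Psi> \<in> vecs (dual H)" by (rule csub_diff[OF sH' \<Phi> \<Psi>(1)])
    have "vnorm (dual H) (\<Phi> - \<Psi>) * ?L \<le> vnorm (dual H) (\<Phi> - \<Psi>) * (?L + 1)"
      using dual_norm_nonneg[OF cH d] by (intro mult_left_mono) auto
    also have "\<dots> \<le> e" using \<Psi>(2) L by (simp add: pos_less_divide_eq)
    finally have small: "vnorm (dual H) (\<Phi> - \<Psi>) * ?L \<le> e" .
    show "\<exists>y\<in>vecs Y. \<forall>\<phi>\<in>vecs (dual Y). cmod (\<Phi> (\<phi> \<circ> f) - \<phi> y) \<le> e * vnorm (dual Y) \<phi>"
    proof (rule bexI[OF _ representsD(1)[OF y]], rule ballI)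
      fix \<phi> assume \<phi>: "\<phi> \<in> vecs (dual Y)"
      have "\<Phi> (\<phi> \<circ> f) - \<phi> y = (\<Phi> - \<Psi>) (\<phi> \<circ> f)" by (simp add: representsD(2)[OF y \<phi>])
      then show "cmod (\<Phi> (\<phi> \<circ> f) - \<phi> y) \<le> e * vnorm (dual Y) \<phi>"
        using comp_bound[OF d \<phi>] mult_right_mono[OF small dual_norm_nonneg[OF Y \<phi>]] by simp
    qed
  qed
  then show ?thesis unfolding represents_def by (elim bexE) (intro exI conjI)
qed

lemma represents_G0:
  assumes u: "u \<in> vecs (G0 X)" shows "\<exists>y. represents X Y f u y"
proof -
  have span: "\<exists>y. represents X Y f s y" if "s \<in> S" for s
    using that
  proof (induction rule: complex_vector.span_induct_alt)
    case base
    have "represents X Y f 0 0"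
      unfolding represents_def using sY clin_diff_zero(2)[OF dualD(1) sY] by simp
    then show ?case by (rule exI)
  next
    case (step c v s)
    then obtain x y where "v = eval_at X x" "x \<in> open_unit_ball X" "represents X Y f s y" by blast
    then have "represents X Y f (c *\<^sub>C v + 1 *\<^sub>C s) (c *\<^sub>C f x + 1 *\<^sub>C y)"
      using represents_lincomb[OF Y represents_eval] by blast
    then show ?case by (intro exI[of _ "c *\<^sub>C f x + y"]) (simp only: scaleC_one)
  qed
  show ?thesis
  proof (rule represents_approx[OF G0_dual[OF u]])
    fix e :: real assume "e > 0"
    then obtain s where "s \<in> S" "vnorm (dual H) (u - s) < e" using u unfolding mem_G0 by blast
    then show "\<exists>\<Psi>\<in>vecs (dual H). vnorm (dual H) (u - \<Psi>) < e \<and> (\<exists>y. represents X Y f \<Psi> y)"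
      using span_eval_subset span by blast
  qed
qed

text \<open>
  An operator that agrees with \<^term>\<open>f\<close> on the evaluations represents the elements of their span; both the operator and
  the representing point are continuous, so this extends to the closure and determines the operator.
\<close>
lemma represents_of_operator:
  assumes T: "T \<in> bounded_ops (G0 X) Y" and Tf: "\<forall>x\<in>open_unit_ball X. T (eval_at X x) = f x"
    and u: "u \<in> vecs (G0 X)"
  shows "represents X Y f u (T u)"
proof -
  note TD = bounded_opsD[OF T]
  note sG = cnormedD(1)[OF cnormed_G0]
  have span: "s \<in> vecs (G0 X) \<and> represents X Y f s (T s)" if "s \<in> S" for s
    using that
  proof (induction rule: complex_vector.span_induct_alt)
    case base
    have "represents X Y f 0 (T 0)"
      unfolding represents_def bounded_ops_diff_zero(1)[OF cnormed_G0 T]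
      using sY clin_diff_zero(2)[OF dualD(1) sY] by simp
    then show ?case using csub_0[OF sG] by blast
  next
    case (step c v s)
    then obtain x where x: "v = eval_at X x" "x \<in> open_unit_ball X" by blast
    have v: "v \<in> vecs (G0 X)"
      using x by (auto intro!: span_in_G0 complex_vector.span_base)
    have s: "s \<in> vecs (G0 X)" "represents X Y f s (T s)" using step.IH by blast+
    have cv: "c *\<^sub>C v \<in> vecs (G0 X)" by (rule csub_scale[OF sG v])
    have "T (c *\<^sub>C v + s) = c *\<^sub>C f x + 1 *\<^sub>C T s"
      using TD(3)[OF cv s(1)] TD(4)[OF v, of c] Tf x by simp
    moreover have "represents X Y f (c *\<^sub>C v + 1 *\<^sub>C s) (c *\<^sub>C f x + 1 *\<^sub>C T s)"
      unfolding x(1) by (rule represents_lincomb[OF Y represents_eval[OF x(2)] s(2)])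
    ultimately show ?case using csub_add[OF sG cv s(1)] by (simp only: scaleC_one)
  qed
  obtain y where y: "represents X Y f u y" using represents_G0[OF u] by (rule exE)
  obtain K where K: "K > 0" "\<And>u. u \<in> vecs (G0 X) \<Longrightarrow> vnorm Y (T u) \<le> K * vnorm (G0 X) u"
    using bounded_ops_bound[OF cnormed_G0 T] by blast
  let ?L = "vnorm (HL0 X Y) f"
  have KL: "K + ?L > 0" using K(1) Lf(1) by simp
  have yT: "T u - y \<in> vecs Y" using TD(1)[OF u] representsD(1)[OF y] sY by simp
  have "vnorm Y (T u - y) \<le> 0"
  proof (rule field_le_epsilon)
    fix e :: real assume "e > 0"
    then have "e / (K + ?L) > 0" using KL by simp
    then obtain s where s: "s \<in> S" "vnorm (dual H) (u - s) < e / (K + ?L)" using u unfolding mem_G0 by blast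
    have sG0: "s \<in> vecs (G0 X)" by (rule span_in_G0[OF s(1)])
    have us: "u - s \<in> vecs (G0 X)" "u - s \<in> vecs (dual H)"
      using csub_diff[OF sG u sG0] G0_dual by blast+
    have "represents X Y f (1 *\<^sub>C s + (- 1) *\<^sub>C u) (1 *\<^sub>C T s + (- 1) *\<^sub>C y)"
      by (rule represents_lincomb[OF Y conjunct2[OF span[OF s(1)]] y])
    then have rep: "represents X Y f (- (u - s)) (T s - y)" by simp
    have n: "vnorm (dual H) (- (u - s)) = vnorm (dual H) (u - s)" by (rule seminorm_diff(2)[OF nH' sH' us(2)])
    have "vnorm Y (T s - y) \<le> ?L * vnorm (dual H) (u - s)"
      using represents_norm_le[OF _ rep] csub_neg[OF sH' us(2)] unfolding n by blast
    moreover have "vnorm Y (T (u - s)) \<le> K * vnorm (dual H) (u - s)" using K(2)[OF us(1)] by (simp add: vnorm_G0)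
    moreover have "vnorm Y (T u - y) \<le> vnorm Y (T (u - s)) + vnorm Y (T s - y)"
    proof -
      have eq: "T u - y = T (u - s) + (T s - y)" by (simp add: bounded_ops_diff_zero(2)[OF cnormed_G0 T u sG0])
      have "T s - y \<in> vecs Y" using TD(1)[OF sG0] representsD(1)[OF y] sY by simp
      then show ?thesis unfolding eq by (rule seminormD(2)[OF nY TD(1)[OF us(1)]])
    qed
    ultimately have "vnorm Y (T u - y) \<le> (K + ?L) * vnorm (dual H) (u - s)" by (simp add: distrib_right)
    also have "\<dots> \<le> e" using s(2) KL by (simp add: pos_less_divide_eq mult.commute)
    finally show "vnorm Y (T u - y) \<le> 0 + e" by simp
  qed
  then have "T u - y = 0"
    using seminormD(1)[OF nY yT] cnormedD(3)[OF Y yT] by simp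
  then show ?thesis using y by simp
qed

text \<open>
  The operator sending \<^term>\<open>u\<close> to its representing point satisfies the defining conditions of the linearization, and
  by the preceding lemma it is the only one.
\<close>
lemma linearization_properties:
  shows linearization_bounded: "linearization X Y f \<in> bounded_ops (G0 X) Y"
    and linearization_represents: "u \<in> vecs (G0 X) \<Longrightarrow> represents X Y f u (linearization X Y f u)"
proof -
  note sG = cnormedD(1)[OF cnormed_G0]
  define T where "T u = (if u \<in> vecs (G0 X) then SOME y. represents X Y f u y else 0)" for u
  have rep: "represents X Y f u (T u)" if "u \<in> vecs (G0 X)" for u
    using someI_ex[OF represents_G0[OF that]] that by (simp add: T_def)
  have T: "T \<in> bounded_ops (G0 X) Y"
  proof (rule bounded_opsI)
    fix u assume u: "u \<in> vecs (G0 X)"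
    show "T u \<in> vecs Y" by (rule representsD(1)[OF rep[OF u]])
    show "vnorm Y (T u) \<le> vnorm (HL0 X Y) f * vnorm (G0 X) u"
      unfolding vnorm_G0 by (rule represents_norm_le[OF G0_dual[OF u] rep[OF u]])
    show "T (a *\<^sub>C u) = a *\<^sub>C T u" for a
      using represents_unique[OF Y rep[OF csub_scale[OF sG u, of a]]]
        represents_lincomb[OF Y rep[OF u] rep[OF u], of a 0] by simp
    show "T (u + v) = T u + T v" if v: "v \<in> vecs (G0 X)" for v
      using represents_unique[OF Y rep[OF csub_add[OF sG u v]]]
        represents_lincomb[OF Y rep[OF u] rep[OF v], of 1 1] by simp
  qed (simp add: T_def)
  have eval: "eval_at X x \<in> vecs (G0 X)" if "x \<in> open_unit_ball X" for x
    using that by (intro span_in_G0 complex_vector.span_base) blast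
  have "linearization X Y f = T"
    unfolding linearization_def
  proof (rule the_equality)
    show "T \<in> bounded_ops (G0 X) Y \<and> (\<forall>x\<in>open_unit_ball X. T (eval_at X x) = f x)"
      using T represents_unique[OF Y rep[OF eval] represents_eval] by blast
    fix T' assume T': "T' \<in> bounded_ops (G0 X) Y \<and> (\<forall>x\<in>open_unit_ball X. T' (eval_at X x) = f x)"
    show "T' = T"
    proof
      fix u show "T' u = T u"
      proof (cases "u \<in> vecs (G0 X)")
        case True
        then show ?thesis using represents_unique[OF Y represents_of_operator rep] T' by blast
      next
        case False
        then show ?thesis using bounded_opsD(2)[OF T] bounded_opsD(2)[OF conjunct1[OF T']] by simp
      qed
    qed
  qed
  then show "linearization X Y f \<in> bounded_ops (G0 X) Y"
    "u \<in> vecs (G0 X) \<Longrightarrow> represents X Y f u (linearization X Y f u)"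
    using T rep by simp_all
qed

section \<open>The equivalences\<close>
lemma compact_image_imp_representable:
  assumes W: "relatively_weakly_compact_image X Y f"
  shows "dual_functionals_representable X Y f"
  unfolding dual_functionals_representable_def
proof
  fix \<Phi> assume \<Phi>: "\<Phi> \<in> vecs (dual H)"
  obtain C M where C: "absconvex C" "C \<subseteq> vecs Y" "rel_weakly_compact Y C" "Im_L X Y f \<subseteq> C"
    using W unfolding relatively_weakly_compact_image_def by blast
  obtain Q where Q: "compactin (weak_topology Y) Q" "C \<subseteq> Q" using C(3) by (auto simp: rel_weakly_compact_def)
  define a where "a = vnorm (dual H) \<Phi> + 1"
  have a: "a > 0" "vnorm (dual H) \<Phi> \<le> a" using dual_norm_nonneg[OF cH \<Phi>] by (simp_all add: a_def)
  have "\<exists>y\<in>Q. \<forall>\<phi>\<in>vecs (dual Y). \<Phi> (\<phi> \<circ> f) / a = \<phi> y"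
  proof (rule dominated_imp_evaluation[OF Y C(1,2) Q])
    show "clin (vecs (dual Y)) (\<lambda>\<phi>. \<Phi> (\<phi> \<circ> f) / a)"
      using clin_comp[OF \<Phi>] unfolding clin_def by (simp add: add_divide_distrib)
    fix \<phi> assume "\<phi> \<in> vecs (dual Y)" "\<And>c. c \<in> C \<Longrightarrow> cmod (\<phi> c) \<le> 1"
    then have \<phi>: "polar_bound Y C \<phi>" by (simp add: polar_bound_def)
    note L = polar_lipschitz_le[OF X Y f C(4) \<phi>]
    have "cmod (\<Phi> (\<phi> \<circ> f)) \<le> vnorm (dual H) \<Phi> * 1"
      using dual_bound[OF cH \<Phi> L(1)] mult_left_mono[OF L(2) dual_norm_nonneg[OF cH \<Phi>]] by linarith
    then have "cmod (\<Phi> (\<phi> \<circ> f)) \<le> a" using a(2) by simp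
    then show "cmod (\<Phi> (\<phi> \<circ> f) / a) \<le> 1" using a(1) by (simp add: norm_divide)
  qed
  then obtain y where y: "y \<in> Q" "\<forall>\<phi>\<in>vecs (dual Y). \<Phi> (\<phi> \<circ> f) / a = \<phi> y" by (rule bexE)
  have yY: "y \<in> vecs Y"
    using y(1) compactin_subset_topspace[OF Q(1)] topspace_weak_topology[OF Y] by blast
  have "represents X Y f \<Phi> (a *\<^sub>r y)"
    unfolding represents_def
  proof (intro conjI ballI csub_scale[OF sY yY])
    fix \<phi> assume \<phi>: "\<phi> \<in> vecs (dual Y)"
    have "\<phi> (a *\<^sub>r y) = a * (\<Phi> (\<phi> \<circ> f) / a)"
      using clinD(2)[OF dualD(1)[OF \<phi>] yY, of "complex_of_real a"] y(2)[rule_format, OF \<phi>] by simp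
    then show "\<Phi> (\<phi> \<circ> f) = \<phi> (a *\<^sub>r y)" using a(1) by simp
  qed
  then show "\<exists>y. represents X Y f \<Phi> y" by (rule exI)
qed

text \<open>
  The representing points of the dual ball form the required set \<open>C\<close>: difference quotients of \<^term>\<open>f\<close> represent the
  molecules.
\<close>
lemma representable_imp_compact_image:
  assumes R: "dual_functionals_representable X Y f"
  shows "relatively_weakly_compact_image X Y f"
proof -
  define y where "y \<Phi> = (SOME y. represents X Y f \<Phi> y)" for \<Phi>
  have y: "represents X Y f \<Phi> (y \<Phi>)" if "\<Phi> \<in> vecs (dual H)" for \<Phi>
    unfolding y_def by (rule someI_ex) (rule R[unfolded dual_functionals_representable_def, rule_format, OF that])
  let ?B = "closed_unit_ball (dual H)"
  have ball: "\<Phi> \<in> vecs (dual H)" "vnorm (dual H) \<Phi> \<le> 1" if "\<Phi> \<in> ?B" for \<Phi>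
    using that by (simp_all add: closed_unit_ball_def)
  have "compactin (weak_topology Y) (y ` ?B)"
  proof (rule compactin_image_of_dual_ball[OF cH Y])
    show "y \<Phi> \<in> vecs Y" if "\<Phi> \<in> ?B" for \<Phi> by (rule representsD(1)[OF y[OF ball(1)[OF that]]])
    fix \<phi> assume \<phi>: "\<phi> \<in> vecs (dual Y)"
    show "\<exists>v\<in>vecs H. \<forall>\<Phi>\<in>?B. \<phi> (y \<Phi>) = \<Phi> v"
    proof (rule bexI[OF _ comp_functional(1)[OF \<phi>]], rule ballI)
      fix \<Phi> assume "\<Phi> \<in> ?B"
      from representsD(2)[OF y[OF ball(1)[OF this]] \<phi>] show "\<phi> (y \<Phi>) = \<Phi> (\<phi> \<circ> f)" by simp
    qed
  qed
  then have rel: "rel_weakly_compact Y (y ` ?B)" unfolding rel_weakly_compact_def by blast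
  have conv: "absconvex (y ` ?B)"
  proof (rule absconvex_image_of_ball[OF cnormed_dual[OF cH]])
    note sD = cnormedD(1)[OF cnormed_dual[OF cH]]
    fix \<Phi> \<Psi> a b assume \<Phi>: "\<Phi> \<in> vecs (dual H)" and \<Psi>: "\<Psi> \<in> vecs (dual H)"
    have "a *\<^sub>C \<Phi> + b *\<^sub>C \<Psi> \<in> vecs (dual H)"
      by (intro csub_add csub_scale sD \<Phi> \<Psi>)
    then show "y (a *\<^sub>C \<Phi> + b *\<^sub>C \<Psi>) = a *\<^sub>C y \<Phi> + b *\<^sub>C y \<Psi>"
      by (rule represents_unique[OF Y y represents_lincomb[OF Y y[OF \<Phi>] y[OF \<Psi>]]])
  qed
  have sub: "y ` ?B \<subseteq> vecs Y" using representsD(1)[OF y] ball(1) by blast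
  have bdd: "\<forall>c\<in>y ` ?B. vnorm Y c \<le> vnorm (HL0 X Y) f + 1"
  proof
    fix c assume "c \<in> y ` ?B"
    then obtain \<Phi> where \<Phi>: "\<Phi> \<in> ?B" "c = y \<Phi>" by blast
    note b = ball[OF \<Phi>(1)]
    show "vnorm Y c \<le> vnorm (HL0 X Y) f + 1"
      using represents_norm_le[OF b(1) y[OF b(1)]] mult_left_mono[OF b(2) Lf(1)] unfolding \<Phi>(2) by linarith
  qed
  have "Im_L X Y f \<subseteq> y ` ?B"
  proof
    fix c assume "c \<in> Im_L X Y f"
    then obtain u v where c: "c = complex_of_real (1 / vnorm X (u - v)) *\<^sub>C (f u - f v)"
      and uv: "u \<in> open_unit_ball X" "v \<in> open_unit_ball X" "u \<noteq> v"
      unfolding Im_L_def by blast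
    note m = molecule_mem[OF X uv]
    have "c = y (molecule X u v)"
      unfolding c by (rule represents_unique[OF Y represents_molecule[OF uv(1,2)] y[OF ball(1)[OF m]]])
    then show "c \<in> y ` ?B" using m by (rule image_eqI)
  qed
  then show ?thesis
    unfolding relatively_weakly_compact_image_def
    by (intro exI[of _ "y ` ?B"] exI[of _ "vnorm (HL0 X Y) f + 1"] conjI conv sub bdd rel) (use Lf(1) in simp_all)
qed

lemma compact_image_iff_linearization:
  "relatively_weakly_compact_image X Y f \<longleftrightarrow> weakly_compact_op (G0 X) Y (linearization X Y f)"
proof -
  let ?T = "linearization X Y f" and ?G = "closed_unit_ball (G0 X)"
  note T = linearization_bounded and rep = linearization_represents
  note cG = cnormed_G0
  have ball: "u \<in> vecs (G0 X)" "vnorm (dual H) u \<le> 1" if "u \<in> ?G" for u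
    using that by (simp_all add: closed_unit_ball_def G0_def)
  show ?thesis
  proof
    assume "relatively_weakly_compact_image X Y f"
    then obtain C M where C: "absconvex C" "C \<subseteq> vecs Y" "rel_weakly_compact Y C" "Im_L X Y f \<subseteq> C"
      unfolding relatively_weakly_compact_image_def by blast
    obtain Q where Q: "compactin (weak_topology Y) Q" "C \<subseteq> Q" using C(3) by (auto simp: rel_weakly_compact_def)
    have "?T ` ?G \<subseteq> bipolar Y C"
    proof (rule image_subsetI)
      fix u assume u: "u \<in> ?G"
      note r = rep[OF ball(1)[OF u]] and uH = G0_dual[OF ball(1)[OF u]]
      show "?T u \<in> bipolar Y C"
        unfolding bipolar_def
      proof (intro CollectI conjI allI impI representsD(1)[OF r])
        fix \<phi> assume \<phi>: "polar_bound Y C \<phi>"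
        then have \<phi>': "\<phi> \<in> vecs (dual Y)" by (simp add: polar_bound_def)
        note L = polar_lipschitz_le[OF X Y f C(4) \<phi>]
        have "cmod (u (\<phi> \<circ> f)) \<le> vnorm (dual H) u * vnorm H (\<phi> \<circ> f)" by (rule dual_bound[OF cH uH L(1)])
        also have "\<dots> \<le> 1 * 1"
          using L(2) ball(2)[OF u] lipschitz_norm_bound(1)[OF X cnormed_scalars L(1)] by (intro mult_mono) auto
        finally show "cmod (\<phi> (?T u)) \<le> 1" using representsD(2)[OF r \<phi>'] by simp
      qed
    qed
    then have "?T ` ?G \<subseteq> Q" using bipolar_facts(5)[OF Y C(2) Q(2) C(1) Q(1)] by blast
    then show "weakly_compact_op (G0 X) Y ?T"
      unfolding weakly_compact_op_iff[OF Y] rel_weakly_compact_def using T Q(1) by blast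
  next
    assume wc: "weakly_compact_op (G0 X) Y ?T"
    have "Im_L X Y f \<subseteq> ?T ` ?G"
    proof
      fix c assume "c \<in> Im_L X Y f"
      then obtain u v where c: "c = complex_of_real (1 / vnorm X (u - v)) *\<^sub>C (f u - f v)"
        and uv: "u \<in> open_unit_ball X" "v \<in> open_unit_ball X" "u \<noteq> v"
        unfolding Im_L_def by blast
      have "molecule X u v \<in> vecs (G0 X)"
        unfolding molecule_def using uv
        by (intro span_in_G0 complex_vector.span_scale complex_vector.span_diff complex_vector.span_base) blast+
      then have m: "molecule X u v \<in> ?G" "molecule X u v \<in> vecs (G0 X)"
        using molecule_mem[OF X uv] by (simp_all add: closed_unit_ball_def G0_def)
      have "c = ?T (molecule X u v)"
        unfolding c by (rule represents_unique[OF Y represents_molecule[OF uv(1,2)] rep[OF m(2)]])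
      then show "c \<in> ?T ` ?G" using m(1) by (rule image_eqI)
    qed
    then show "relatively_weakly_compact_image X Y f"
      by (rule relatively_weakly_compact_imageI[OF cG Y wc])
  qed
qed

lemma transpose_bounded: "transpose_map Y f \<in> bounded_ops (dual Y) H"
proof (rule bounded_opsI)
  note sD = cnormedD(1)[OF cnormed_dual[OF Y]]
  note c = comp_functional
  fix \<phi> assume \<phi>: "\<phi> \<in> vecs (dual Y)"
  show "transpose_map Y f \<phi> \<in> vecs H" using c(1)[OF \<phi>] \<phi> by (simp add: transpose_map_def)
  show "vnorm H (transpose_map Y f \<phi>) \<le> vnorm (HL0 X Y) f * vnorm (dual Y) \<phi>"
    using c(2)[OF \<phi>] \<phi> by (simp add: transpose_map_def mult.commute)
  show "transpose_map Y f (a *\<^sub>C \<phi>) = a *\<^sub>C transpose_map Y f \<phi>" for a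
    using csub_scale[OF sD \<phi>, of a] \<phi>
    by (simp only: transpose_map_def comp_linear if_True)
  show "transpose_map Y f (\<phi> + \<psi>) = transpose_map Y f \<phi> + transpose_map Y f \<psi>" if \<psi>: "\<psi> \<in> vecs (dual Y)" for \<psi>
    using csub_add[OF sD \<phi> \<psi>] \<phi> \<psi>
    by (simp only: transpose_map_def comp_linear if_True)
qed (simp add: transpose_map_def)

lemma transpose_apply: "\<phi> \<in> vecs (dual Y) \<Longrightarrow> transpose_map Y f \<phi> = \<phi> \<circ> f"
  by (simp add: transpose_map_def)

lemma representable_imp_transpose_continuous:
  assumes R: "dual_functionals_representable X Y f"
  shows "continuous_map (weak_star_topology Y) (weak_topology H) (transpose_map Y f)"
proof (rule continuous_map_weak_topology[OF cH], unfold topspace_weak_star[OF Y])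
  show "transpose_map Y f \<phi> \<in> vecs H" if "\<phi> \<in> vecs (dual Y)" for \<phi>
    by (rule bounded_opsD(1)[OF transpose_bounded that])
  fix \<Phi> U assume \<Phi>: "\<Phi> \<in> vecs (dual H)" and U: "open (U :: complex set)"
  obtain y where y: "represents X Y f \<Phi> y" using R \<Phi> unfolding dual_functionals_representable_def by blast
  have "{\<phi> \<in> vecs (dual Y). \<Phi> (transpose_map Y f \<phi>) \<in> U} = {\<phi> \<in> vecs (dual Y). \<phi> y \<in> U}"
  proof (rule Collect_cong, rule conj_cong[OF refl])
    fix \<phi> assume \<phi>: "\<phi> \<in> vecs (dual Y)"
    show "\<Phi> (transpose_map Y f \<phi>) \<in> U \<longleftrightarrow> \<phi> y \<in> U"
      unfolding transpose_apply[OF \<phi>] representsD(2)[OF y \<phi>] ..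
  qed
  then show "openin (weak_star_topology Y) {\<phi> \<in> vecs (dual Y). \<Phi> (transpose_map Y f \<phi>) \<in> U}"
    using openin_weak_star[OF representsD(1)[OF y] U] by (simp only:)
qed

lemma transpose_continuous_imp_weakly_compact:
  assumes cont: "continuous_map (weak_star_topology Y) (weak_topology H) (transpose_map Y f)"
  shows "weakly_compact_op (dual Y) H (transpose_map Y f)"
  unfolding weakly_compact_op_iff[OF cH] rel_weakly_compact_def
  using transpose_bounded image_compactin[OF Banach_Alaoglu[OF Y] cont] by blast

text \<open>
  Inside a weakly compact set \<^term>\<open>Q\<close> of scalar maps, the maps \<^term>\<open>h\<close> with \<^term>\<open>cmod (\<Phi> h) \<ge> e\<close> form a compact set that
  omits \<open>0\<close>, hence finitely many points of the ball suffice to witness that its elements are nonzero. So \<^term>\<open>\<Phi> (\<phi> \<circ> f)\<close> is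
  small as soon as \<^term>\<open>\<phi>\<close> is small at finitely many points of \<^term>\<open>Y\<close>, which is weak-star continuity on the ball.
\<close>
lemma transpose_weakly_compact_imp_representable:
  assumes wc: "weakly_compact_op (dual Y) H (transpose_map Y f)"
  shows "dual_functionals_representable X Y f"
  unfolding dual_functionals_representable_def
proof
  note sH = cnormedD(1)[OF cH]
  fix \<Phi> assume \<Phi>: "\<Phi> \<in> vecs (dual H)"
  obtain Q where Q: "compactin (weak_topology H) Q" "transpose_map Y f ` closed_unit_ball (dual Y) \<subseteq> Q"
    using wc unfolding weakly_compact_op_iff[OF cH] rel_weakly_compact_def by blast
  have "\<exists>y\<in>vecs Y. \<forall>\<phi>\<in>vecs (dual Y). \<Phi> (\<phi> \<circ> f) = \<phi> y"
  proof (rule weak_star_continuous_on_ball_imp_evaluation[OF B clin_comp[OF \<Phi>]])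
    fix e :: real assume e: "e > 0"
    define Q' where "Q' = {h \<in> vecs H. \<Phi> h \<in> - ball 0 e} \<inter> Q"
    have "closedin (weak_topology H) {h \<in> vecs H. \<Phi> h \<in> - ball 0 e}"
      by (rule closedin_weak_topology[OF cH \<Phi>]) (simp add: closed_Compl)
    then have Q': "compactin (weak_topology H) Q'"
      unfolding Q'_def by (rule closed_Int_compactin[OF _ Q(1)])
    define U where "U = (\<lambda>(x, \<delta>). {h \<in> vecs H. eval_at X x h \<in> - cball 0 \<delta>})"
    define I where "I = open_unit_ball X \<times> {0::real<..}"
    have cover: "Q' \<subseteq> \<Union> (U ` I)"
    proof
      fix h assume h: "h \<in> Q'"
      then have hH: "h \<in> vecs H" and "\<not> cmod (\<Phi> h) < e" by (simp_all add: Q'_def)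
      then have "h \<noteq> 0" using e clin_diff_zero(2)[OF dualD(1)[OF \<Phi>] sH] by auto
      then obtain x where hx: "h x \<noteq> 0" by (auto simp: fun_eq_iff)
      then have x: "x \<in> open_unit_ball X" using HL0D(2)[OF X cnormed_scalars hH] by blast
      have "h \<in> U (x, cmod (h x) / 2)" using hH hx by (simp add: U_def eval_at_def)
      moreover have "(x, cmod (h x) / 2) \<in> I" using x hx by (simp add: I_def)
      ultimately show "h \<in> \<Union> (U ` I)" by blast
    qed
    have open_U: "openin (weak_topology H) A" if A: "A \<in> U ` I" for A
    proof -
      obtain i where i: "i \<in> I" "A = U i" using A by (rule imageE)
      have x: "fst i \<in> open_unit_ball X" using i by (auto simp: I_def)
      have "A = {h \<in> vecs H. eval_at X (fst i) h \<in> - cball 0 (snd i)}" unfolding i U_def by (simp add: split_beta)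
      then show ?thesis using openin_weak_topology[OF eval_at_mem_dual[OF X x], of "- cball 0 (snd i)"] by (simp add: open_Compl)
    qed
    obtain \<F> where \<F>: "finite \<F>" "\<F> \<subseteq> U ` I" "Q' \<subseteq> \<Union> \<F>"
      using Q' cover open_U unfolding compactin_def by meson
    obtain J where J: "J \<subseteq> I" "finite J" "\<F> = U ` J"
      using finite_subset_image[OF \<F>(1,2)] by blast
    note cover_J = \<F>(3)[unfolded J(3)]
    define s where "s = (\<lambda>(x, \<delta>). complex_of_real (1 / \<delta>) *\<^sub>C f x)"
    show "\<exists>S. finite S \<and> S \<subseteq> vecs Y \<and> (\<forall>\<phi>\<in>closed_unit_ball (dual Y). (\<forall>y\<in>S. cmod (\<phi> y) \<le> 1) \<longrightarrow> cmod (\<Phi> (\<phi> \<circ> f)) \<le> e)"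
    proof (intro exI[of _ "s ` J"] conjI ballI impI)
      show "finite (s ` J)" using J by simp
      show "s ` J \<subseteq> vecs Y" using fY(1) sY by (auto simp: s_def)
      fix \<phi> assume \<phi>: "\<phi> \<in> closed_unit_ball (dual Y)" and small: "\<forall>y\<in>s ` J. cmod (\<phi> y) \<le> 1"
      have \<phi>': "\<phi> \<in> vecs (dual Y)" using \<phi> by (simp add: closed_unit_ball_def)
      have cH': "\<phi> \<circ> f \<in> vecs H" by (rule comp_functional(1)[OF \<phi>'])
      have "\<phi> \<circ> f \<in> Q" using Q(2) \<phi> transpose_apply[OF \<phi>'] by (metis image_subset_iff)
      moreover have "\<phi> \<circ> f \<notin> Q'"
      proof
        assume "\<phi> \<circ> f \<in> Q'"
        then obtain j where j: "j \<in> J" "\<phi> \<circ> f \<in> U j" using cover_J by blast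
        obtain x \<delta> where j': "j = (x, \<delta>)" by (cases j)
        have \<delta>: "\<delta> > 0" using j j' J(1) by (auto simp: I_def)
        have "\<delta> < cmod (\<phi> (f x))" using j(2) cH' by (simp add: j' U_def eval_at_def)
        moreover have "cmod (\<phi> (s j)) \<le> 1" using small j(1) by blast
        then have "cmod (\<phi> (f x)) \<le> \<delta>"
          using clinD(2)[OF dualD(1)[OF \<phi>'] fY(1), of "complex_of_real (1 / \<delta>)" x] \<delta>
          by (simp add: j' s_def norm_mult norm_divide pos_divide_le_eq)
        ultimately show False by simp
      qed
      ultimately show "cmod (\<Phi> (\<phi> \<circ> f)) \<le> e" using cH' by (simp add: Q'_def)
    qed
  qed
  then show "\<exists>y. represents X Y f \<Phi> y" unfolding represents_def by (elim bexE) (intro exI conjI)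
qed

lemma weakly_compact_hol_lip_imp_compact_image:
  assumes "weakly_compact_hol_lip TYPE('c::complex_vector) X Y f"
  shows "relatively_weakly_compact_image X Y f"
proof -
  obtain E :: "'c cspace" and S where E: "cbanach E" and wc: "weakly_compact_op E Y S"
    and im: "Im_L X Y f \<subseteq> S ` closed_unit_ball E"
    using assms unfolding weakly_compact_hol_lip_def by blast
  show ?thesis by (rule relatively_weakly_compact_imageI[OF cbanach_cnormed[OF E] Y wc im])
qed

lemma factorization_imp_weakly_compact_hol_lip:
  assumes "factors_through_reflexive TYPE('c::complex_vector) X Y f"
  shows "weakly_compact_hol_lip TYPE('c) X Y f"
proof -
  obtain Z :: "'c cspace" and T g where Z: "cbanach Z" "reflexive Z" and T: "T \<in> bounded_ops Z Y"
    and g: "g \<in> vecs (HL0 X Z)" and fTg: "f = T \<circ> g"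
    using assms unfolding factors_through_reflexive_def by blast
  note cZ = cbanach_cnormed[OF Z(1)]
  note sZ = cnormedD(1)[OF cZ] and nZ = cnormedD(2)[OF cZ] and TD = bounded_opsD[OF T]
  note gZ = HL0D[OF X cZ g] and Lg = lipschitz_norm_bound[OF X cZ g]
  define c where "c = vnorm (HL0 X Z) g + 1"
  have c: "c > 0" "vnorm (HL0 X Z) g \<le> c" using Lg(1) by (simp_all add: c_def)
  define S where "S = complex_of_real c *\<^sub>C T"
  have S: "S \<in> bounded_ops Z Y" unfolding S_def by (rule bounded_ops_add_scale(2)[OF cZ Y T T])
  have "Im_L X Y f \<subseteq> S ` closed_unit_ball Z"
  proof
    fix w assume "w \<in> Im_L X Y f"
    then obtain u v where w: "w = complex_of_real (1 / vnorm X (u - v)) *\<^sub>C (f u - f v)"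
      and uv: "u \<in> open_unit_ball X" "v \<in> open_unit_ball X" "u \<noteq> v"
      unfolding Im_L_def by blast
    define n where "n = vnorm X (u - v)"
    have n: "n > 0" unfolding n_def by (rule ball_diff(3)[OF X uv])
    have gd: "g u - g v \<in> vecs Z" by (rule csub_diff[OF sZ gZ(1) gZ(1)])
    define z where "z = (1 / (n * c)) *\<^sub>r (g u - g v)"
    have zZ: "z \<in> vecs Z" unfolding z_def by (rule csub_scale[OF sZ gd])
    have "vnorm Z (g u - g v) \<le> vnorm (HL0 X Z) g * n" unfolding n_def by (rule Lg(2)[OF uv(1,2)])
    also have "\<dots> \<le> c * n" using c(2) n by (intro mult_right_mono) auto
    finally have "vnorm Z (g u - g v) \<le> n * c" by (simp add: mult.commute)
    moreover have "vnorm Z z = vnorm Z (g u - g v) / (n * c)"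
      using seminormD(3)[OF nZ gd, of "complex_of_real (1 / (n * c))"] n c(1)
      by (simp add: z_def norm_mult norm_divide)
    ultimately have "z \<in> closed_unit_ball Z" using zZ n c(1) by (simp add: closed_unit_ball_def pos_divide_le_eq)
    moreover have "w = S z"
    proof -
      have "S z = c *\<^sub>r ((1 / (n * c)) *\<^sub>r T (g u - g v))" by (simp only: S_def fun_simps z_def TD(4)[OF gd])
      also have "\<dots> = (1 / n) *\<^sub>r T (g u - g v)" using n c(1) by simp
      also have "T (g u - g v) = f u - f v" by (simp add: fTg bounded_ops_diff_zero(2)[OF cZ T gZ(1) gZ(1)])
      finally show ?thesis by (simp add: w n_def)
    qed
    ultimately show "w \<in> S ` closed_unit_ball Z" by (intro image_eqI)
  qed
  moreover have "weakly_compact_op Z Y S"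
    unfolding weakly_compact_op_iff[OF Y]
    using S bounded_op_reflexive_rel_weakly_compact[OF cZ Z(2) Y S] by blast
  ultimately show ?thesis unfolding weakly_compact_hol_lip_def using f Z(1) by blast
qed

end

theorem theorem3p3:
  fixes X :: "'x::complex_vector cspace" and Y :: "'y::complex_vector cspace"
    and f :: "'x \<Rightarrow> 'y"
  assumes "cbanach X" and "cbanach Y" and "f \<in> vecs (HL0 X Y)"
  shows "(weakly_compact_hol_lip TYPE('y) X Y f \<longleftrightarrow>
            weakly_compact_op (G0 X) Y (linearization X Y f)) \<and>
         (weakly_compact_op (G0 X) Y (linearization X Y f) \<longleftrightarrow>
            weakly_compact_op (dual Y) (HL0 X scalars) (transpose_map Y f)) \<and>
         (weakly_compact_op (dual Y) (HL0 X scalars) (transpose_map Y f) \<longleftrightarrow>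
            continuous_map (weak_star_topology Y) (weak_topology (HL0 X scalars)) (transpose_map Y f)) \<and>
         (continuous_map (weak_star_topology Y) (weak_topology (HL0 X scalars)) (transpose_map Y f) \<longleftrightarrow>
            factors_through_reflexive TYPE('y) X Y f) \<and>
         (weakly_compact_hol_lip TYPE('z::complex_vector) X Y f \<longrightarrow>
            weakly_compact_hol_lip TYPE('y) X Y f) \<and>
         (factors_through_reflexive TYPE('z) X Y f \<longrightarrow>
            factors_through_reflexive TYPE('y) X Y f)"
proof -
  note facts = cbanach_cnormed[OF assms(1)] assms(2,3)
  let ?W = "relatively_weakly_compact_image X Y f"
  have v: "?W \<Longrightarrow> factors_through_reflexive TYPE('y) X Y f"
    by (rule factorization_through_reflexive[OF facts])
  have i: "weakly_compact_hol_lip TYPE('y) X Y f \<Longrightarrow> ?W" "weakly_compact_hol_lip TYPE('z) X Y f \<Longrightarrow> ?W"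
    by (rule weakly_compact_hol_lip_imp_compact_image[OF facts], assumption)+
  have vi: "factors_through_reflexive TYPE('y) X Y f \<Longrightarrow> weakly_compact_hol_lip TYPE('y) X Y f"
    "factors_through_reflexive TYPE('z) X Y f \<Longrightarrow> weakly_compact_hol_lip TYPE('z) X Y f"
    by (rule factorization_imp_weakly_compact_hol_lip[OF facts], assumption)+
  note ii = compact_image_iff_linearization[OF facts]
  note R = compact_image_imp_representable[OF facts] representable_imp_compact_image[OF facts]
    representable_imp_transpose_continuous[OF facts] transpose_continuous_imp_weakly_compact[OF facts]
    transpose_weakly_compact_imp_representable[OF facts]
  show ?thesis using v i vi ii R by argo
qed

end
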